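(* Let $\pi\in S_n$. The following are equivalent: (1) the weak rectangulation $\gamma_w(\pi)$ is guillotine; (2) the strong rectangulation $\gamma_s(\pi)$ is guillotine; (3) $\pi$ avoids both mesh patterns $p_1$ and $p_2$.
   Context: A rectangulation of an axis-aligned rectangle $R$ is a decomposition into finitely many interior-disjoint axis-aligned rectangles; size = number of rectangles; generic (no point is a corner of four rectangles). A segment is a maximal straight line segment that is a union of rectangle sides and not contained in a side of $R$. $r$ is on the left of $r'$ if there is a sequence $r=r^1,\dots,r^k=r'$ with the right side of $r^i$ and the left side of $r^{i+1}$ in a common segment; $r$ is below $r'$ analogously with top/bottom sides. Weak equivalence: bijection of rectangles preserving on-the-left and below; strong equivalence additionally preserves adjacency (sharing a boundary piece of positive length); weak/strong rectangulations are the classes. A cut is a segment joining two opposite sides of $R$; a rectangulation is guillotine if it has size 1 or has a cut such that both sub-rectangulations it separates are guillotine (this is invariant under both equivalences). Mesh patterns: for $\pi\in S_n$ and $(\tau,\mu)$ with $\tau\in S_k$, $\mu\subseteq\{0,\dots,k\}^2$, an occurrence is a set of positions $s_1<\dots<s_k$ with $\pi_{s_1}\cdots\pi_{s_k}$ order-isomorphic to $\tau$, such that, writing $t_1<\dots<t_k$ for the sorted values $\pi_{s_i}$ and $s_0=t_0=0$, $s_{k+1}=t_{k+1}=n+1$, for every $(i,j)\in\mu$ there is no $\ell$ with $s_i<\ell<s_{i+1}$ and $t_j<\pi_\ell<t_{j+1}$. $p_1=(25314,\{(0,3),(0,4),(1,3),(4,2),(5,1),(5,2)\})$ and $p_2=(41352,\{(0,1),(0,2),(1,2),(4,3),(5,3),(5,4)\})$.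 The map $\gamma_w$: take an $n\times n$ grid square $R$ with diagonal cells labeled $1,\dots,n$ from top-left to bottom-right, plus auxiliary rectangles $r_0$ (the column left of the grid) and $r_{n+1}$ (the row below the grid). Maintain a staircase (initially the left and bottom sides of $R$, extended by a unit horizontal segment at its top-left end and a unit vertical segment at its bottom-right end) whose peaks are the top-right corners of rectangles with labels in a set $P$ (initially $\{0,n+1\}$). For $i=1..n$ with $j=\pi_i$, insert $r_j$ with bottom-left corner at the valley between consecutive peaks with labels $a<j<b$ in $P$; if all $r_k$, $a<k<j$, are already inserted, the top of $r_j$ aligns with the top of $r_a$ and $a$ is removed from $P$, otherwise the top of $r_j$ is on the grid line between rows $j-1$ and $j$; if all $r_k$, $j<k<b$, are inserted, the right of $r_j$ aligns with the right of $r_b$ and $b$ is removed from $P$, otherwise the right of $r_j$ is on the grid line between columns $j$ and $j+1$; then replace the left and bottom sides of $r_j$ in the staircase by its top and right sides and add $j$ to $P$. $\gamma_w(\pi)$ is the weak class of the result. The map $\gamma_s$ is defined by the same procedure except that sizes are combinatorial: in the non-aligned cases, the top side of $r_j$ ends on the vertical line containing the right side of $r_a$ strictly below the top of $r_a$ (a T-joint), resp. the right side of $r_j$ ends on the horizontal line containing the top side of $r_b$ strictly left of the right side of $r_b$ (a T-joint); $\gamma_s(\pi)$ is the strong class of the result. *)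

theory Defs
  imports "HOL-Analysis.Analysis" "HOL-Combinatorics.Permutations"
begin

section \<open>Rectangulations\<close>

datatype rect = Rect (xmin: real) (ymin: real) (xmax: real) (ymax: real)

definition proper :: "rect \<Rightarrow> bool" where
  "proper r \<longleftrightarrow> xmin r < xmax r \<and> ymin r < ymax r"

definition region :: "rect \<Rightarrow> (real \<times> real) set" where
  "region r = {xmin r..xmax r} \<times> {ymin r..ymax r}"

definition corners :: "rect \<Rightarrow> (real \<times> real) set" where
  "corners r = {xmin r, xmax r} \<times> {ymin r, ymax r}"

definition left_side :: "rect \<Rightarrow> (real \<times> real) set" where
  "left_side r = {xmin r} \<times> {ymin r..ymax r}"

definition right_side :: "rect \<Rightarrow> (real \<times> real) set" where
  "right_side r = {xmax r} \<times> {ymin r..ymax r}"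

definition bottom_side :: "rect \<Rightarrow> (real \<times> real) set" where
  "bottom_side r = {xmin r..xmax r} \<times> {ymin r}"

definition top_side :: "rect \<Rightarrow> (real \<times> real) set" where
  "top_side r = {xmin r..xmax r} \<times> {ymax r}"

definition sides :: "rect \<Rightarrow> (real \<times> real) set set" where
  "sides r = {left_side r, right_side r, bottom_side r, top_side r}"

definition rectangulation :: "rect \<Rightarrow> rect set \<Rightarrow> bool" where
  "rectangulation R D \<longleftrightarrow>
     proper R \<and> finite D \<and> (\<forall>r\<in>D. proper r) \<and>
     (\<forall>r\<in>D. \<forall>r'\<in>D. r \<noteq> r' \<longrightarrow> interior (region r) \<inter> interior (region r') = {}) \<and>
     (\<Union>r\<in>D. region r) = region R"

definition generic :: "rect set \<Rightarrow> bool" where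
  "generic D \<longleftrightarrow> (\<forall>p. card {r \<in> D. p \<in> corners r} < 4)"

definition straight_union_of_sides :: "rect set \<Rightarrow> (real \<times> real) set \<Rightarrow> bool" where
  "straight_union_of_sides D s \<longleftrightarrow>
     (\<exists>p q. p \<noteq> q \<and> s = closed_segment p q) \<and>
     (\<exists>Q \<subseteq> (\<Union>r\<in>D. sides r). s = \<Union>Q)"

definition segment :: "rect \<Rightarrow> rect set \<Rightarrow> (real \<times> real) set \<Rightarrow> bool" where
  "segment R D s \<longleftrightarrow>
     straight_union_of_sides D s \<and>
     (\<forall>s'. straight_union_of_sides D s' \<and> s \<subseteq> s' \<longrightarrow> s' = s) \<and>
     (\<forall>e\<in>sides R. \<not> s \<subseteq> e)"

text \<open>Both relations below allow sequences consisting of a single rectangle, hence are reflexive.\<close>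

definition on_the_left :: "rect \<Rightarrow> rect set \<Rightarrow> rect \<Rightarrow> rect \<Rightarrow> bool" where
  "on_the_left R D =
     (\<lambda>r r'. r \<in> D \<and> r' \<in> D \<and>
        (\<exists>s. segment R D s \<and> right_side r \<subseteq> s \<and> left_side r' \<subseteq> s))\<^sup>*\<^sup>*"

definition below :: "rect \<Rightarrow> rect set \<Rightarrow> rect \<Rightarrow> rect \<Rightarrow> bool" where
  "below R D =
     (\<lambda>r r'. r \<in> D \<and> r' \<in> D \<and>
        (\<exists>s. segment R D s \<and> top_side r \<subseteq> s \<and> bottom_side r' \<subseteq> s))\<^sup>*\<^sup>*"

definition adjacent :: "rect \<Rightarrow> rect \<Rightarrow> bool" where
  "adjacent r r' \<longleftrightarrow>
     (\<exists>p q. p \<noteq> q \<and> closed_segment p q \<subseteq> frontier (region r) \<inter> frontier (region r'))"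

definition weak_iso :: "rect \<Rightarrow> rect set \<Rightarrow> rect \<Rightarrow> rect set \<Rightarrow> (rect \<Rightarrow> rect) \<Rightarrow> bool" where
  "weak_iso R D R' D' f \<longleftrightarrow>
     bij_betw f D D' \<and>
     (\<forall>r\<in>D. \<forall>r'\<in>D.
        (on_the_left R D r r' \<longleftrightarrow> on_the_left R' D' (f r) (f r')) \<and>
        (below R D r r' \<longleftrightarrow> below R' D' (f r) (f r')))"

definition strong_iso :: "rect \<Rightarrow> rect set \<Rightarrow> rect \<Rightarrow> rect set \<Rightarrow> (rect \<Rightarrow> rect) \<Rightarrow> bool" where
  "strong_iso R D R' D' f \<longleftrightarrow>
     weak_iso R D R' D' f \<and>
     (\<forall>r\<in>D. \<forall>r'\<in>D. adjacent r r' \<longleftrightarrow> adjacent (f r) (f r'))"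

definition weak_class :: "rect \<Rightarrow> rect set \<Rightarrow> (rect \<times> rect set) set" where
  "weak_class R D =
     {(R', D'). rectangulation R' D' \<and> generic D' \<and> (\<exists>f. weak_iso R D R' D' f)}"

definition strong_class :: "rect \<Rightarrow> rect set \<Rightarrow> (rect \<times> rect set) set" where
  "strong_class R D =
     {(R', D'). rectangulation R' D' \<and> generic D' \<and> (\<exists>f. strong_iso R D R' D' f)}"

inductive guillotine :: "rect \<Rightarrow> rect set \<Rightarrow> bool" where
  single: "card D = 1 \<Longrightarrow> guillotine R D"
| vertical_cut:
    "segment R D ({c} \<times> {ymin R..ymax R}) \<Longrightarrow>
     guillotine (Rect (xmin R) (ymin R) c (ymax R)) {r \<in> D. xmax r \<le> c} \<Longrightarrow>
     guillotine (Rect c (ymin R) (xmax R) (ymax R)) {r \<in> D. c \<le> xmin r} \<Longrightarrow>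
     guillotine R D"
| horizontal_cut:
    "segment R D ({xmin R..xmax R} \<times> {c}) \<Longrightarrow>
     guillotine (Rect (xmin R) (ymin R) (xmax R) c) {r \<in> D. ymax r \<le> c} \<Longrightarrow>
     guillotine (Rect (xmin R) c (xmax R) (ymax R)) {r \<in> D. c \<le> ymin r} \<Longrightarrow>
     guillotine R D"

text \<open>Being guillotine is invariant under both equivalences, so it does not matter whether one
  asks for one or for all representatives; nonemptiness excludes the degenerate case.\<close>

definition guillotine_class :: "(rect \<times> rect set) set \<Rightarrow> bool" where
  "guillotine_class C \<longleftrightarrow> C \<noteq> {} \<and> (\<forall>(R, D)\<in>C. guillotine R D)"

section \<open>The insertion procedure\<close>

text \<open>The grid square is $[0,n]^2$, with the $y$-axis pointing upwards; the diagonal cell labelled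
  $j$ is $[j-1,j] \times [n-j,n-j+1]$.

  A state \<open>(P, m)\<close> consists of the set of labels of peaks and the finite map from labels to
  inserted rectangles. The staircase is determined by it: its peaks are the top-right corners of the
  rectangles with labels in \<open>P\<close>, and the valley between consecutive peaks \<open>a < b\<close> has the
  abscissa of peak \<open>a\<close> and the ordinate of peak \<open>b\<close>.\<close>

type_synonym state = "nat set \<times> (nat \<rightharpoonup> rect)"

definition grid_square :: "nat \<Rightarrow> rect" where
  "grid_square n = Rect 0 0 (real n) (real n)"

definition initial :: "nat \<Rightarrow> state" where
  "initial n = ({0, n + 1}, [0 \<mapsto> Rect (-1) 0 0 (real n), n + 1 \<mapsto> Rect 0 (-1) (real n) 0])"

definition prev_peak :: "state \<Rightarrow> nat \<Rightarrow> nat" where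
  "prev_peak st j = Max {a \<in> fst st. a < j}"

definition next_peak :: "state \<Rightarrow> nat \<Rightarrow> nat" where
  "next_peak st j = Min {b \<in> fst st. j < b}"

definition top_aligned :: "state \<Rightarrow> nat \<Rightarrow> bool" where
  "top_aligned st j \<longleftrightarrow> {prev_peak st j<..<j} \<subseteq> dom (snd st)"

definition right_aligned :: "state \<Rightarrow> nat \<Rightarrow> bool" where
  "right_aligned st j \<longleftrightarrow> {j<..<next_peak st j} \<subseteq> dom (snd st)"

text \<open>Insertion of \<open>r\<^sub>j\<close>; the reals \<open>x\<close> and \<open>y\<close> are the abscissa of its right side and
  the ordinate of its top side, each used only if that side is not aligned.\<close>

definition insert_rect :: "nat \<Rightarrow> real \<Rightarrow> real \<Rightarrow> state \<Rightarrow> state" where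
  "insert_rect j x y st =
     (let a = prev_peak st j; b = next_peak st j;
          ra = the (snd st a); rb = the (snd st b)
      in (insert j (fst st - (if top_aligned st j then {a} else {})
                           - (if right_aligned st j then {b} else {})),
          (snd st)(j \<mapsto> Rect (xmax ra) (ymax rb)
                       (if right_aligned st j then xmax rb else x)
                       (if top_aligned st j then ymax ra else y))))"

text \<open>The state after the first \<open>i\<close> insertions; \<open>x j\<close> and \<open>y j\<close> are the positions for
  \<open>r\<^sub>j\<close> in the non-aligned cases.\<close>

primrec run :: "nat \<Rightarrow> (nat \<Rightarrow> nat) \<Rightarrow> (nat \<Rightarrow> real) \<Rightarrow> (nat \<Rightarrow> real) \<Rightarrow> nat \<Rightarrow> state" where
  "run n \<pi> x y 0 = initial n"
| "run n \<pi> x y (Suc i) =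
     (let j = \<pi> (Suc i) in insert_rect j (x j) (y j) (run n \<pi> x y i))"

definition drawing :: "nat \<Rightarrow> (nat \<Rightarrow> nat) \<Rightarrow> (nat \<Rightarrow> real) \<Rightarrow> (nat \<Rightarrow> real) \<Rightarrow> rect set" where
  "drawing n \<pi> x y = (\<lambda>j. the (snd (run n \<pi> x y n) j)) ` {1..n}"

definition gamma_w :: "nat \<Rightarrow> (nat \<Rightarrow> nat) \<Rightarrow> (rect \<times> rect set) set" where
  "gamma_w n \<pi> =
     weak_class (grid_square n) (drawing n \<pi> (\<lambda>j. real j) (\<lambda>j. real n - real j + 1))"

text \<open>The size choices allowed for \<open>\<gamma>\<^sub>s\<close>: a non-aligned top side of \<open>r\<^sub>j\<close> lies above the
  valley and forms a T-joint with the right side of \<open>r\<^sub>a\<close>, i.e.\ it ends in the interior of that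
  side. Its ordinate must therefore also exceed that of the bottom of \<open>r\<^sub>a\<close>, which may lie above
  the valley; without this the strong class would depend on the choices (for instance for the
  permutation 3412). Symmetrically for the right side.\<close>

definition T_joint_choice ::
    "nat \<Rightarrow> (nat \<Rightarrow> nat) \<Rightarrow> (nat \<Rightarrow> real) \<Rightarrow> (nat \<Rightarrow> real) \<Rightarrow> bool" where
  "T_joint_choice n \<pi> x y \<longleftrightarrow>
     (\<forall>i<n. let st = run n \<pi> x y i; j = \<pi> (Suc i);
                ra = the (snd st (prev_peak st j)); rb = the (snd st (next_peak st j))
            in (\<not> top_aligned st j \<longrightarrow> max (ymin ra) (ymax rb) < y j \<and> y j < ymax ra) \<and>
               (\<not> right_aligned st j \<longrightarrow> max (xmin rb) (xmax ra) < x j \<and> x j < xmax rb))"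

text \<open>All admissible choices yield the same strong class, so the union is that class.\<close>

definition gamma_s :: "nat \<Rightarrow> (nat \<Rightarrow> nat) \<Rightarrow> (rect \<times> rect set) set" where
  "gamma_s n \<pi> =
     (\<Union>(x, y) \<in> {(x, y). T_joint_choice n \<pi> x y}.
        strong_class (grid_square n) (drawing n \<pi> x y))"

section \<open>Mesh patterns\<close>

text \<open>A mesh pattern is a permutation in one-line notation together with a set of cells.\<close>

type_synonym mesh_pattern = "nat list \<times> (nat \<times> nat) set"

text \<open>\<open>s\<close> and \<open>t\<close> are $s_0,\dots,s_{k+1}$ and $t_0,\dots,t_{k+1}$, whereas the list \<open>\<tau>\<close>
  is indexed from 0.\<close>

definition mesh_occurrence :: "nat \<Rightarrow> (nat \<Rightarrow> nat) \<Rightarrow> mesh_pattern \<Rightarrow> nat set \<Rightarrow> bool" where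
  "mesh_occurrence n \<pi> p S \<longleftrightarrow>
     (let \<tau> = fst p; \<mu> = snd p; k = length \<tau>;
          s = 0 # sorted_list_of_set S @ [n + 1];
          t = 0 # sorted_list_of_set (\<pi> ` S) @ [n + 1]
      in S \<subseteq> {1..n} \<and> card S = k \<and>
         (\<forall>i\<in>{1..k}. \<forall>j\<in>{1..k}. \<pi> (s ! i) < \<pi> (s ! j) \<longleftrightarrow> \<tau> ! (i - 1) < \<tau> ! (j - 1)) \<and>
         (\<forall>(i, j)\<in>\<mu>. \<not> (\<exists>l\<in>{1..n}. s ! i < l \<and> l < s ! (i + 1) \<and> t ! j < \<pi> l \<and> \<pi> l < t ! (j + 1))))"

definition avoids :: "nat \<Rightarrow> (nat \<Rightarrow> nat) \<Rightarrow> mesh_pattern \<Rightarrow> bool" where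
  "avoids n \<pi> p \<longleftrightarrow> \<not> (\<exists>S. mesh_occurrence n \<pi> p S)"

definition p1 :: mesh_pattern where
  "p1 = ([2, 5, 3, 1, 4], {(0,3), (0,4), (1,3), (4,2), (5,1), (5,2)})"

definition p2 :: mesh_pattern where
  "p2 = ([4, 1, 3, 5, 2], {(0,1), (0,2), (1,2), (4,3), (5,3), (5,4)})"

end

theory Submission
  imports Defs
begin

text \<open>Let \<open>q\<close> be the inverse of \<open>\<pi>\<close>. A rectangulation is guillotine iff its set of rectangles can be
  split recursively into two parts, one entirely on the left of (or entirely below) the other; this
  depends only on the relations on-the-left and below, hence is invariant under weak equivalence.

  The sides of \<open>r\<^sub>j\<close> lie on lines that can be read off from \<open>q\<close>: for instance its left side lies on
  the line after the last \<open>w < j\<close> with \<open>q w < q j\<close>, and its right side on the line before the first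
  \<open>w > j\<close> with \<open>q w > q j\<close>. Distinct lines never touch, whatever the admissible sizes, so
  \<open>r\<^sub>i\<close> and \<open>r\<^sub>j\<close> have the right side of one and the left side of the other in a common segment iff the
  corresponding line numbers agree. Consequently a vertical cut separates the labels \<open>{l..k}\<close> from
  \<open>{k+1..u}\<close> iff \<open>q (k + 1)\<close> is the maximum of \<open>q\<close> on \<open>{l..k+1}\<close> and \<open>q k\<close> is the minimum of \<open>q\<close> on
  \<open>{k..u}\<close>; horizontal cuts correspond to vertical cuts of \<open>- q\<close>.

  An occurrence of a mesh pattern survives in one of the two parts of every cut, so the recursion
  never ends if there is one. Conversely, if \<open>{l..u}\<close> has no cut but \<open>{l..u-1}\<close> has a cut \<open>k\<close>, then
  cutting \<open>{l..k}\<close> repeatedly spirals towards an occurrence.\<close>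

section \<open>Cuts and windmills of a permutation\<close>

text \<open>Coordinates are the obstacle. For the sizes of \<open>gamma_s\<close>, lines with
  different indices may share an abscissa, and \<open>segment\<close> takes maximal unions of sides;
  two collinear lines that touched would merge into one segment and create relations that the
  permutation does not show. The grid sizes exclude this because all abscissae differ; the T-joint
  sizes exclude it because the lower end of each inner line rests in the interior of a top side or
  on the bottom of the square. Both cases are condensed into \<open>disjoint_lines\<close>, after
  which only line indices matter. Reflection in the diagonal x = y exchanges the labels j and n + 1
  - j and preserves the insertion times, so the geometry is done for vertical lines only; on cuts of
  permutations it corresponds to a change of sign of \<open>q\<close>, which is why \<open>q\<close>
  takes integer values. The pattern 25314 is the smallest pinwheel: its drawing has four arms around
  \<open>r_3\<close>, and the shaded cells guarantee that no cut destroys it.\<close>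

text \<open>Horizontal cuts are the vertical cuts of \<open>- q\<close>.\<close>

definition vcut :: "(nat \<Rightarrow> int) \<Rightarrow> nat \<Rightarrow> nat \<Rightarrow> nat \<Rightarrow> bool" where
  "vcut q l u k \<longleftrightarrow> l \<le> k \<and> k < u \<and> (\<forall>i\<in>{l..k}. q i < q (k + 1)) \<and> (\<forall>j\<in>{k+1..u}. q k < q j)"

text \<open>A tree of cuts on intervals of labels. Intervals suffice: on-the-left respects the order
  of the labels and below reverses it, so both parts of a cut are again intervals.\<close>

inductive interval_sep :: "(nat \<Rightarrow> int) \<Rightarrow> nat \<Rightarrow> nat \<Rightarrow> bool" for q where
  single: "interval_sep q l l"
| cut: "vcut q l u k \<or> vcut (\<lambda>i. - q i) l u k \<Longrightarrow> interval_sep q l k \<Longrightarrow> interval_sep q (k + 1) u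
    \<Longrightarrow> interval_sep q l u"

text \<open>\<open>v1 < \<dots> < v5\<close> are the values of an occurrence of 25314, whose positions are \<open>q v2 < q v5 < q v3 < q v1 <
  q v4\<close>; the last four conditions say that the shaded cells are empty. The pattern 41352 is the
  reverse of 25314, i.e.\ it is obtained from \<open>- q\<close>.\<close>

definition windmill :: "(nat \<Rightarrow> int) \<Rightarrow> nat \<Rightarrow> nat \<Rightarrow> nat \<Rightarrow> nat \<Rightarrow> nat \<Rightarrow> bool" where
  "windmill q v1 v2 v3 v4 v5 \<longleftrightarrow>
     v1 < v2 \<and> v2 < v3 \<and> v3 < v4 \<and> v4 < v5 \<and>
     q v2 < q v5 \<and> q v5 < q v3 \<and> q v3 < q v1 \<and> q v1 < q v4 \<and>
     (\<forall>v\<in>{v1<..<v2}. q v < q v4) \<and> (\<forall>v\<in>{v2<..<v3}. q v < q v1) \<and>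
     (\<forall>v\<in>{v3<..<v4}. q v5 < q v) \<and> (\<forall>v\<in>{v4<..<v5}. q v2 < q v)"

definition has_windmill :: "(nat \<Rightarrow> int) \<Rightarrow> nat \<Rightarrow> nat \<Rightarrow> bool" where
  "has_windmill q l u \<longleftrightarrow> (\<exists>v1 v2 v3 v4 v5. l \<le> v1 \<and> v5 \<le> u \<and> windmill q v1 v2 v3 v4 v5)"

section \<open>Windmills obstruct recursive cutting\<close>

lemma has_windmill_mono: "has_windmill q l u \<Longrightarrow> l' \<le> l \<Longrightarrow> u \<le> u' \<Longrightarrow> has_windmill q l' u'"
  unfolding has_windmill_def by (meson le_trans)

text \<open>A cut between \<open>v2\<close> and \<open>v4\<close> contradicts the order of the
  positions or an empty cell. Between \<open>v1\<close> and \<open>v2\<close> the label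
  \<open>k + 1\<close> can take over the role of \<open>v1\<close>, and between \<open>v4\<close>
  and \<open>v5\<close> the label \<open>k\<close> that of \<open>v5\<close>, since the cut makes
  \<open>q (k + 1)\<close> larger than \<open>q v1\<close> and \<open>q k\<close> smaller than
  \<open>q v5\<close>.\<close>

lemma windmill_vcut:
  assumes w: "windmill q v1 v2 v3 v4 v5" and lu: "l \<le> v1" "v5 \<le> u" and c: "vcut q l u k"
  shows "has_windmill q l k \<or> has_windmill q (k + 1) u"
proof -
  note W = w[unfolded windmill_def]
  have L: "q i < q (k + 1)" if "l \<le> i" "i \<le> k" for i using c that by (auto simp: vcut_def)
  have U: "q k < q j" if "k < j" "j \<le> u" for j using c that by (auto simp: vcut_def)
  consider "k < v1" | "v1 \<le> k" "k < v2" | "v2 \<le> k" "k < v3" | "v3 \<le> k" "k < v4" | "v4 \<le> k" "k < v5" | "v5 \<le> k"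
    by linarith
  then show ?thesis
  proof cases
    case 1
    then have "has_windmill q (k + 1) u" unfolding has_windmill_def using w lu by (metis Suc_eq_plus1 Suc_leI)
    then show ?thesis ..
  next
    case 6
    then have "has_windmill q l k" unfolding has_windmill_def using w lu by metis
    then show ?thesis ..
  next
    case 2
    have a: "q v1 < q (k + 1)" using L[of v1] 2 lu by auto
    then have "k + 1 \<noteq> v2" using W by auto
    then have k: "k + 1 < v2" using 2 by auto
    then have b: "q (k + 1) < q v4" using W 2 by auto
    have "windmill q (k + 1) v2 v3 v4 v5" unfolding windmill_def using W k a b 2 by force
    then have "has_windmill q (k + 1) u" unfolding has_windmill_def using lu by blast
    then show ?thesis ..
  next
    case 3
    have a: "q v1 < q (k + 1)" using L[of v1] 3 lu W by auto
    then have "k + 1 \<noteq> v3" using W by auto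
    then have "k + 1 \<in> {v2<..<v3}" using 3 by auto
    then have "q (k + 1) < q v1" using W by blast
    then show ?thesis using a by simp
  next
    case 4
    have a: "q k < q v5" using U[of v5] 4 lu W by auto
    then have "k \<noteq> v3" using W by auto
    then have "k \<in> {v3<..<v4}" using 4 by auto
    then have "q v5 < q k" using W by blast
    then show ?thesis using a by simp
  next
    case 5
    have a: "q k < q v5" using U[of v5] 5 lu W by auto
    then have k: "v4 < k" using W 5 by (cases "k = v4") auto
    then have b: "q v2 < q k" using W 5 by auto
    have "windmill q v1 v2 v3 v4 k" unfolding windmill_def using W k a b 5 by force
    then have "has_windmill q l k" unfolding has_windmill_def using lu by blast
    then show ?thesis ..
  qed
qed

text \<open>The two directions are not symmetric: a horizontal cut between \<open>v1\<close> and
  \<open>v5\<close> never yields a modified windmill but always a contradiction, because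
  \<open>v2\<close> and \<open>v4\<close> have the extreme positions.\<close>

lemma windmill_hcut:
  assumes w: "windmill q v1 v2 v3 v4 v5" and lu: "l \<le> v1" "v5 \<le> u" and c: "vcut (\<lambda>i. - q i) l u k"
  shows "has_windmill q l k \<or> has_windmill q (k + 1) u"
proof -
  note W = w[unfolded windmill_def]
  have L: "q (k + 1) < q i" if "l \<le> i" "i \<le> k" for i using c that by (auto simp: vcut_def)
  have U: "q j < q k" if "k < j" "j \<le> u" for j using c that by (auto simp: vcut_def)
  consider "k < v1" | "v1 \<le> k" "k < v2" | "v2 \<le> k" "k < v3" | "v3 \<le> k" "k < v4" | "v4 \<le> k" "k < v5" | "v5 \<le> k"
    by linarith
  then show ?thesis
  proof cases
    case 1
    then have "has_windmill q (k + 1) u" unfolding has_windmill_def using w lu by (metis Suc_eq_plus1 Suc_leI)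
    then show ?thesis ..
  next
    case 6
    then have "has_windmill q l k" unfolding has_windmill_def using w lu by metis
    then show ?thesis ..
  next
    case 2
    have a: "q v4 < q k" using U[of v4] 2 lu W by auto
    then have "k \<noteq> v1" using W by auto
    then have "q k < q v4" using W 2 by auto
    then show ?thesis using a by simp
  next
    case 3
    have a: "q v4 < q k" using U[of v4] 3 lu W by auto
    then have "k \<noteq> v2" using W by auto
    then have "k \<in> {v2<..<v3}" using 3 by auto
    then have "q k < q v1" using W by blast
    then show ?thesis using a W by simp
  next
    case 4
    have a: "q (k + 1) < q v2" using L[of v2] 4 lu W by auto
    then have "k + 1 \<noteq> v4" using W by auto
    then have "k + 1 \<in> {v3<..<v4}" using 4 by auto
    then have "q v5 < q (k + 1)" using W by blast
    then show ?thesis using a W by simp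
  next
    case 5
    have a: "q (k + 1) < q v2" using L[of v2] 5 lu W by auto
    then have "k + 1 \<noteq> v5" using W by auto
    then have "k + 1 \<in> {v4<..<v5}" using 5 by auto
    then have "q v2 < q (k + 1)" using W by blast
    then show ?thesis using a by simp
  qed
qed

lemma interval_sep_no_windmill:
  "interval_sep q l u \<Longrightarrow> \<not> has_windmill q l u"
proof (induction rule: interval_sep.induct)
  case (single l)
  then show ?case by (auto simp: has_windmill_def windmill_def)
next
  case (cut l u k)
  show ?case
  proof
    assume "has_windmill q l u"
    then obtain v1 v2 v3 v4 v5 where "windmill q v1 v2 v3 v4 v5" "l \<le> v1" "v5 \<le> u"
      unfolding has_windmill_def by blast
    then have "has_windmill q l k \<or> has_windmill q (k + 1) u"
      using cut.hyps(1) windmill_vcut windmill_hcut by blast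
    then show False using cut.IH by blast
  qed
qed

section \<open>Spirals in intervals without a cut\<close>

lemma interval_sep_uminus: "interval_sep q l u \<Longrightarrow> interval_sep (\<lambda>i. - q i) l u"
  by (induction rule: interval_sep.induct) (auto intro: interval_sep.intros)

text \<open>The block \<open>{l'..k}\<close> is cut down until its cut passes \<open>u\<close>; the arm above it ends at \<open>k0\<close>.\<close>

lemma windmill_in_spiral:
  assumes cuts: "\<And>l' u'. l \<le> l' \<Longrightarrow> l' < u' \<Longrightarrow> u' < u \<Longrightarrow>
      (\<exists>k. vcut q l' u' k \<or> vcut (\<lambda>i. - q i) l' u' k)"
    and nocut: "\<And>k. \<not> vcut q l u k"
    and inj: "inj_on q {l..u}"
  shows "\<lbrakk>l \<le> l'; l' \<le> k; k + 1 < u; \<And>i. l' \<le> i \<Longrightarrow> i \<le> k \<Longrightarrow> q i < q (k + 1);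
      \<And>j. k \<le> j \<Longrightarrow> j < u \<Longrightarrow> q k \<le> q j; q u < q k; \<exists>m\<in>{l'..k}. q m < q u;
      l' = l \<or> (\<exists>k0. l < l' \<and> k \<le> k0 \<and> k0 + 1 < u \<and> q u < q k0 \<and> q (l' - 1) < q (k0 + 1) \<and>
        (\<forall>i\<in>{l'..k0}. q i < q (l' - 1)))\<rbrakk>
    \<Longrightarrow> has_windmill q l u"
proof (induction "k - l'" arbitrary: l' k rule: less_induct)
  case less
  note prems = less.prems
  obtain m where m: "l' \<le> m" "m \<le> k" "q m < q u" using prems(7) by auto
  \<comment> \<open>\<open>q m < q u < q k\<close>, so the block has at least two labels and
    \<open>cuts\<close> applies to it.\<close>
  have "m \<noteq> k" using m prems(6) by auto
  with m have lk: "l' < k" by auto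
  from cuts[OF prems(1) this] prems(3)
  obtain i where "vcut q l' k i \<or> vcut (\<lambda>i. - q i) l' k i" by auto
  then show ?case
  proof
    assume c: "vcut q l' k i"
    have i: "l' \<le> i" "i < k" using c by (auto simp: vcut_def)
    have i1: "q j < q (i + 1)" if "l' \<le> j" "j \<le> i" for j using c that by (auto simp: vcut_def)
    have i2: "q i < q j" if "i < j" "j \<le> k" for j using c that by (auto simp: vcut_def)
    have i3: "q i \<le> q j" if "i \<le> j" "j < u" for j
      using i2[of j] i2[of k] prems(5)[of j] that i by (cases "j \<le> k"; cases "i = j") auto
    have iu: "q i \<noteq> q u" using inj_onD[OF inj, of i u] i prems(1,3) by auto
    \<comment> \<open>If \<open>q u < q i\<close>, the block shrinks to \<open>{l'..i}\<close> and
      the arm stays. Otherwise the spiral closes: without an arm, \<open>i\<close> would be a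
      vertical cut of \<open>{l..u}\<close>; with one, \<open>i\<close> is the missing
      \<open>v2\<close>.\<close>
    show ?case
    proof (cases "q u < q i")
      case True
      have "m \<le> i" using m i2[of m] True by force
      show ?thesis
      proof (rule less.hyps[of i l'])
        show "i - l' < k - l'" using i by auto
        show "\<exists>m\<in>{l'..i}. q m < q u" using m \<open>m \<le> i\<close> by auto
        show "l' = l \<or> (\<exists>k0. l < l' \<and> i \<le> k0 \<and> k0 + 1 < u \<and> q u < q k0 \<and> q (l' - 1) < q (k0 + 1) \<and>
           (\<forall>i\<in>{l'..k0}. q i < q (l' - 1)))"
          using prems(8) i by (meson less_imp_le le_trans)
      qed (use prems i i1 i3 True in auto)
    next
      case False
      with iu have iu: "q i < q u" by simp
      from prems(8) show ?thesis
      proof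
        assume "l' = l"
        have "q i < q j" if "i < j" "j \<le> u" for j
          using i2[of j] i2[of k] prems(5)[of j] that i iu by (cases "j \<le> k"; cases "j = u") auto
        then have "vcut q l u i" using \<open>l' = l\<close> i i1 prems(3) by (auto simp: vcut_def)
        then show ?thesis using nocut by blast
      next
        assume "\<exists>k0. l < l' \<and> k \<le> k0 \<and> k0 + 1 < u \<and> q u < q k0 \<and> q (l' - 1) < q (k0 + 1) \<and>
          (\<forall>i\<in>{l'..k0}. q i < q (l' - 1))"
        then obtain k0 where k0: "l < l'" "k \<le> k0" "k0 + 1 < u" "q u < q k0" "q (l' - 1) < q (k0 + 1)"
          "\<And>i. l' \<le> i \<Longrightarrow> i \<le> k0 \<Longrightarrow> q i < q (l' - 1)" by auto
        have "q i < q v" if "k0 + 1 < v" "v < u" for v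
          using i2[of k] prems(5)[of v] that k0 i by auto
        moreover have "q v < q (k0 + 1)" if "l' - 1 < v" "v < i" for v
        proof -
          have "l' \<le> v" using that k0(1) by linarith
          then show ?thesis using k0(5) k0(6)[of v] k0(2) i that by auto
        qed
        moreover have "q k0 < q (l' - 1)" using k0 i by auto
        \<comment> \<open>The label \<open>l' - 1\<close> ends the part removed by the last
          horizontal cut, and \<open>k0\<close>, \<open>k0 + 1\<close> lie on both sides of the
          right end of the block at that time; they become \<open>v1\<close>, \<open>v3\<close> and
          \<open>v4\<close>.\<close>
        ultimately have "windmill q (l' - 1) i k0 (k0 + 1) u"
          unfolding windmill_def using k0 i iu by auto
        then show ?thesis unfolding has_windmill_def using k0(1) by (metis One_nat_def Suc_leI Suc_pred le_refl less_Suc_eq_le less_nat_zero_code neq0_conv)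
      qed
    qed
  next
    assume c: "vcut (\<lambda>i. - q i) l' k i"
    have i: "l' \<le> i" "i < k" using c by (auto simp: vcut_def)
    have i1: "q (i + 1) < q j" if "l' \<le> j" "j \<le> i" for j using c that by (auto simp: vcut_def)
    have i2: "q j < q i" if "i < j" "j \<le> k" for j using c that by (auto simp: vcut_def)
    show ?case
    \<comment> \<open>A horizontal cut discards \<open>{l'..i}\<close>. All remaining labels come
      before \<open>i\<close>, so \<open>i\<close> and the current \<open>k\<close> form the new
      arm.\<close>
    proof (rule less.hyps[of k "i + 1"])
      show "k - (i + 1) < k - l'" using i by auto
      show "\<exists>m\<in>{i + 1..k}. q m < q u"
        using m i1[of m] i by (cases "i + 1 \<le> m") (auto intro: bexI[of _ m] bexI[of _ "i+1"])
      show "i + 1 = l \<or> (\<exists>k0. l < i + 1 \<and> k \<le> k0 \<and> k0 + 1 < u \<and> q u < q k0 \<and> q (i + 1 - 1) < q (k0 + 1) \<and>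
           (\<forall>j\<in>{i + 1..k0}. q j < q (i + 1 - 1)))"
        using i i2 prems by (intro disjI2 exI[of _ k]) auto
    qed (use prems i in auto)
  qed
qed

text \<open>The cut \<open>k\<close> of \<open>{l..u - 1}\<close> fails for \<open>{l..u}\<close>
  only through \<open>u\<close>, so \<open>q u < q k\<close>. As \<open>u - 1\<close> is no
  horizontal cut either, some label of \<open>{l..k}\<close> comes before \<open>u\<close>. This is
  the starting position of the spiral, with no arm yet.\<close>

lemma vcut_or_windmill:
  assumes cuts: "\<And>l' u'. l \<le> l' \<Longrightarrow> l' < u' \<Longrightarrow> u' < u \<Longrightarrow>
      (\<exists>k. vcut q l' u' k \<or> vcut (\<lambda>i. - q i) l' u' k)"
    and nov: "\<And>k. \<not> vcut q l u k" and noh: "\<And>k. \<not> vcut (\<lambda>i. - q i) l u k"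
    and inj: "inj_on q {l..u}" and c: "vcut q l (u - 1) k"
  shows "has_windmill q l u"
proof -
  have k: "l \<le> k" "k + 1 < u" using c by (auto simp: vcut_def)
  have L: "q i < q (k + 1)" if "l \<le> i" "i \<le> k" for i using c that by (auto simp: vcut_def)
  have U: "q k < q j" if "k < j" "j < u" for j using c that by (auto simp: vcut_def)
  have ne: "q i \<noteq> q u" if "l \<le> i" "i < u" for i using inj_onD[OF inj, of i u] that by auto
  have uk: "q u < q k"
  proof (rule ccontr)
    assume "\<not> q u < q k"
    then have "q k < q u" using ne[of k] k by auto
    then have "q k < q j" if "k < j" "j \<le> u" for j using U[of j] that by (cases "j = u") auto
    then have "vcut q l u k" using k L by (auto simp: vcut_def)
    then show False using nov by blast
  qed
  have "\<exists>m\<in>{l..k}. q m < q u"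
  proof (rule ccontr)
    assume *: "\<not> (\<exists>m\<in>{l..k}. q m < q u)"
    have "q u < q j" if "l \<le> j" "j < u" for j
      using * ne[of j] U[of j] uk that by (cases "j \<le> k") force+
    then have "vcut (\<lambda>i. - q i) l u (u - 1)" using k by (auto simp: vcut_def le_Suc_eq)
    then show False using noh by blast
  qed
  moreover have "q k \<le> q j" if "k \<le> j" "j < u" for j using U[of j] that by (cases "k = j") auto
  ultimately show ?thesis
    using windmill_in_spiral[OF cuts nov inj, of l k] k L uk by auto
qed

text \<open>For the converse, an interval without a cut is inspected whose proper subintervals can
  all be separated: dropping its last label leaves an interval with a cut, and the direction of that
  cut decides which of the two windmills appears.\<close>

theorem interval_sep_iff:
  assumes "l \<le> u" and "inj_on q {l..u}"
  shows "interval_sep q l u \<longleftrightarrow> \<not> has_windmill q l u \<and> \<not> has_windmill (\<lambda>i. - q i) l u"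
proof
  show "interval_sep q l u \<Longrightarrow> \<not> has_windmill q l u \<and> \<not> has_windmill (\<lambda>i. - q i) l u"
    using interval_sep_no_windmill interval_sep_uminus by blast
next
  assume "\<not> has_windmill q l u \<and> \<not> has_windmill (\<lambda>i. - q i) l u"
  then show "interval_sep q l u"
    using assms
  proof (induction "u - l" arbitrary: l u rule: less_induct)
    case less
    have sub: "interval_sep q l' u'" if "l \<le> l'" "l' \<le> u'" "u' \<le> u" "u' - l' < u - l" for l' u'
    proof (rule less.hyps)
      show "\<not> has_windmill q l' u' \<and> \<not> has_windmill (\<lambda>i. - q i) l' u'"
        using less.prems(1) has_windmill_mono that by blast
      show "inj_on q {l'..u'}" using less.prems(3) that by (auto intro: inj_on_subset)
    qed (use that in auto)
    show ?case
    proof (cases "l = u")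
      case True
      then show ?thesis by (simp add: single)
    next
      case False
      have "\<exists>k. vcut q l u k \<or> vcut (\<lambda>i. - q i) l u k"
      proof (rule ccontr)
        assume no: "\<nexists>k. vcut q l u k \<or> vcut (\<lambda>i. - q i) l u k"
        have cuts: "\<exists>k. vcut q l' u' k \<or> vcut (\<lambda>i. - q i) l' u' k" if "l \<le> l'" "l' < u'" "u' < u" for l' u'
          proof -
          have "u' - l' < u - l" "l' \<noteq> u'" using that by auto
          with sub[of l' u'] that show ?thesis by (auto elim: interval_sep.cases)
        qed
        \<comment> \<open>Two labels can always be separated, one way or the other, so the shortened
          interval still has at least two labels.\<close>
        have "l \<noteq> u - 1"
        proof
          assume "l = u - 1"
          then have u: "u = l + 1" using less.prems(2) False by auto
          have "q l \<noteq> q (l + 1)" using inj_onD[OF less.prems(3), of l "l + 1"] u by auto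
          then have "vcut q l u l \<or> vcut (\<lambda>i. - q i) l u l" using u by (auto simp: vcut_def le_Suc_eq)
          then show False using no by blast
        qed
        then have "l < u - 1" using less.prems(2) False by auto
        with cuts[of l "u - 1"] obtain k where "vcut q l (u - 1) k \<or> vcut (\<lambda>i. - q i) l (u - 1) k" by auto
        then show False
        proof
          assume "vcut q l (u - 1) k"
          then show False using vcut_or_windmill[OF cuts _ _ less.prems(3)] no less.prems(1) by blast
        next
          assume c: "vcut (\<lambda>i. - q i) l (u - 1) k"
          have i: "inj_on (\<lambda>i. - q i) {l..u}" using less.prems(3) by (auto simp: inj_on_def)
          have "has_windmill (\<lambda>i. - q i) l u"
          proof (rule vcut_or_windmill[OF _ _ _ i c])
            show "\<exists>k. vcut (\<lambda>i. - q i) l' u' k \<or> vcut (\<lambda>i. - (- q i)) l' u' k"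
              if "l \<le> l'" "l' < u'" "u' < u" for l' u'
              using cuts[OF that] by auto
          qed (use no in auto)
          then show False using less.prems(1) by blast
        qed
      qed
      then obtain k where k: "vcut q l u k \<or> vcut (\<lambda>i. - q i) l u k" by blast
      then have "l \<le> k" "k < u" by (auto simp: vcut_def)
      then show ?thesis using sub[of l k] sub[of "k + 1" u] by (intro interval_sep.cut[OF k]) auto
    qed
  qed
qed

section \<open>Transposition\<close>

text \<open>Reflection in the diagonal x = y. Left and bottom, right and top change places without
  reversing direction, so \<open>below\<close> turns into \<open>on_the_left\<close> and horizontal
  statements follow from vertical ones.\<close>

definition transpose_rect :: "rect \<Rightarrow> rect" where
  "transpose_rect r = Rect (ymin r) (xmin r) (ymax r) (xmax r)"

lemma transpose_rect_simps [simp]: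
  "xmin (transpose_rect r) = ymin r" "ymin (transpose_rect r) = xmin r"
  "xmax (transpose_rect r) = ymax r" "ymax (transpose_rect r) = xmax r"
  "transpose_rect (transpose_rect r) = r" "proper (transpose_rect r) \<longleftrightarrow> proper r"
  by (auto simp: transpose_rect_def proper_def)

lemma inj_transpose_rect [simp]: "transpose_rect r = transpose_rect r' \<longleftrightarrow> r = r'"
  by (metis transpose_rect_simps(5))

lemma transpose_rect_image_image [simp]: "transpose_rect ` transpose_rect ` D = D"
  by (simp add: image_image)

lemma swap_image_image [simp]: "prod.swap ` prod.swap ` (s :: ('a \<times> 'a) set) = s"
  by (simp add: image_image)

lemma transpose_rect_sides [simp]:
  "left_side (transpose_rect r) = prod.swap ` bottom_side r"
  "right_side (transpose_rect r) = prod.swap ` top_side r"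
  "bottom_side (transpose_rect r) = prod.swap ` left_side r"
  "top_side (transpose_rect r) = prod.swap ` right_side r"
  "region (transpose_rect r) = prod.swap ` region r"
  by (auto simp: left_side_def right_side_def bottom_side_def top_side_def region_def product_swap)

lemma sides_transpose_rect: "sides (transpose_rect r) = (`) prod.swap ` sides r"
  by (auto simp: sides_def)

lemma swap_closed_segment:
  "prod.swap ` closed_segment p q = closed_segment (prod.swap p) (prod.swap (q :: real \<times> real))"
proof -
  have "linear (prod.swap :: real \<times> real \<Rightarrow> real \<times> real)"
    by (rule linearI) (auto simp: prod.swap_def)
  then show ?thesis by (rule closed_segment_linear_image[symmetric])
qed

lemma straight_union_transpose:
  assumes "straight_union_of_sides D s"
  shows "straight_union_of_sides (transpose_rect ` D) (prod.swap ` s)"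
proof -
  obtain p q Q where s: "p \<noteq> q" "s = closed_segment p q" "Q \<subseteq> (\<Union>r\<in>D. sides r)" "s = \<Union>Q"
    using assms unfolding straight_union_of_sides_def by blast
  have "prod.swap p \<noteq> prod.swap q" using s(1) by (metis swap_swap)
  moreover have "prod.swap ` s = \<Union>((`) prod.swap ` Q)" unfolding s(4) by blast
  moreover have "(`) prod.swap ` Q \<subseteq> (\<Union>r\<in>transpose_rect ` D. sides r)"
    using s(3) by (fastforce simp: sides_transpose_rect)
  ultimately show ?thesis
    unfolding straight_union_of_sides_def using s(2) swap_closed_segment by metis
qed

lemma segment_transpose:
  assumes "segment R D s"
  shows "segment (transpose_rect R) (transpose_rect ` D) (prod.swap ` s)"
proof -
  have "s' = prod.swap ` s" if "straight_union_of_sides (transpose_rect ` D) s'" "prod.swap ` s \<subseteq> s'" for s'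
  proof -
    have "straight_union_of_sides D (prod.swap ` s')" using straight_union_transpose[OF that(1)] by simp
    moreover have "s \<subseteq> prod.swap ` s'" using image_mono[OF that(2), of prod.swap] by simp
    ultimately have "prod.swap ` s' = s" using assms unfolding segment_def by blast
    then show ?thesis by (metis swap_image_image)
  qed
  moreover have "\<not> prod.swap ` s \<subseteq> e" if "e \<in> sides (transpose_rect R)" for e
  proof
    assume "prod.swap ` s \<subseteq> e"
    then have "s \<subseteq> prod.swap ` e" using image_mono[of "prod.swap ` s" e prod.swap] by simp
    moreover have "prod.swap ` e \<in> sides R" using that by (auto simp: sides_transpose_rect)
    ultimately show False using assms unfolding segment_def by blast
  qed
  moreover have "straight_union_of_sides (transpose_rect ` D) (prod.swap ` s)"
    using assms straight_union_transpose by (simp add: segment_def)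
  ultimately show ?thesis unfolding segment_def by simp
qed

lemma segment_transpose_iff:
  "segment (transpose_rect R) (transpose_rect ` D) s \<longleftrightarrow> segment R D (prod.swap ` s)"
  using segment_transpose[of R D "prod.swap ` s"]
    segment_transpose[of "transpose_rect R" "transpose_rect ` D" s] by auto

text \<open>The step of the chain behind \<open>on_the_left\<close>, named so that inductions over
  the closure can speak of it.\<close>

definition left_step :: "rect \<Rightarrow> rect set \<Rightarrow> rect \<Rightarrow> rect \<Rightarrow> bool" where
  "left_step R D r r' \<longleftrightarrow> r \<in> D \<and> r' \<in> D \<and>
     (\<exists>s. segment R D s \<and> right_side r \<subseteq> s \<and> left_side r' \<subseteq> s)"

lemma on_the_left_eq: "on_the_left R D = (left_step R D)\<^sup>*\<^sup>*"
  unfolding on_the_left_def left_step_def ..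

lemma below_step_iff:
  "r \<in> D \<and> r' \<in> D \<and> (\<exists>s. segment R D s \<and> top_side r \<subseteq> s \<and> bottom_side r' \<subseteq> s) \<longleftrightarrow>
     left_step (transpose_rect R) (transpose_rect ` D) (transpose_rect r) (transpose_rect r')"
proof -
  have "(\<exists>s. segment R D s \<and> top_side r \<subseteq> s \<and> bottom_side r' \<subseteq> s) \<longleftrightarrow>
    (\<exists>s. segment R D (prod.swap ` s) \<and> prod.swap ` top_side r \<subseteq> s \<and> prod.swap ` bottom_side r' \<subseteq> s)"
    (is "?L \<longleftrightarrow> ?R")
  proof
    assume ?L
    then obtain s where "segment R D s" "top_side r \<subseteq> s" "bottom_side r' \<subseteq> s" by blast
    then show ?R by (intro exI[of _ "prod.swap ` s"]) auto
  next
    assume ?R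
    then obtain s where s: "segment R D (prod.swap ` s)" "prod.swap ` top_side r \<subseteq> s"
      "prod.swap ` bottom_side r' \<subseteq> s" by blast
    then show ?L
      using image_mono[OF s(2), of prod.swap] image_mono[OF s(3), of prod.swap]
      by (intro exI[of _ "prod.swap ` s"]) auto
  qed
  then show ?thesis
    by (auto simp: left_step_def segment_transpose_iff image_iff)
qed

lemma below_transpose:
  "below R D r r' \<longleftrightarrow>
     on_the_left (transpose_rect R) (transpose_rect ` D) (transpose_rect r) (transpose_rect r')"
proof -
  let ?B = "\<lambda>r r'. left_step (transpose_rect R) (transpose_rect ` D) (transpose_rect r) (transpose_rect r')"
  have "below R D = ?B\<^sup>*\<^sup>*"
    unfolding below_def by (simp only: below_step_iff)
  moreover have "?B\<^sup>*\<^sup>* a b \<Longrightarrow>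
      (left_step (transpose_rect R) (transpose_rect ` D))\<^sup>*\<^sup>* (transpose_rect a) (transpose_rect b)" for a b
    by (induction rule: rtranclp_induct) auto
  moreover have "(left_step (transpose_rect R) (transpose_rect ` D))\<^sup>*\<^sup>* a b \<Longrightarrow>
      ?B\<^sup>*\<^sup>* (transpose_rect a) (transpose_rect b)" for a b
  proof (induction rule: rtranclp_induct)
    case (step y z)
    then have "?B (transpose_rect y) (transpose_rect z)" by simp
    with step.IH show ?case by (rule rtranclp.rtrancl_into_rtrancl)
  qed simp
  ultimately show ?thesis
    unfolding on_the_left_eq by (metis transpose_rect_simps(5))
qed

section \<open>Elementary facts on rectangulations\<close>

lemma rectangulationD:
  assumes "rectangulation R D"
  shows "proper R" "finite D" "\<And>r. r \<in> D \<Longrightarrow> proper r" "(\<Union>r\<in>D. region r) = region R"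
    "\<And>r r'. r \<in> D \<Longrightarrow> r' \<in> D \<Longrightarrow> r \<noteq> r' \<Longrightarrow> interior (region r) \<inter> interior (region r') = {}"
  using assms by (simp_all add: rectangulation_def)

lemma interior_region: "interior (region r) = {xmin r<..<xmax r} \<times> {ymin r<..<ymax r}"
  by (simp add: region_def interior_Times)

lemma mem_interior_region:
    "(x, y) \<in> interior (region r) \<longleftrightarrow> xmin r < x \<and> x < xmax r \<and> ymin r < y \<and> y < ymax r"
  and mem_region: "(x, y) \<in> region r \<longleftrightarrow> xmin r \<le> x \<and> x \<le> xmax r \<and> ymin r \<le> y \<and> y \<le> ymax r"
  unfolding interior_region by (auto simp: region_def)

lemma rectangulation_transpose:
  assumes "rectangulation R D"
  shows "rectangulation (transpose_rect R) (transpose_rect ` D)"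
proof -
  have "interior (region (transpose_rect r)) \<inter> interior (region (transpose_rect r')) = {}"
    if "r \<in> D" "r' \<in> D" "r \<noteq> r'" for r r'
  proof -
    have "interior (region r) \<inter> interior (region r') = {}"
      using rectangulationD(5)[OF assms that] .
    then show ?thesis
      by (simp add: interior_region Times_Int_Times Times_empty del: transpose_rect_sides) blast
  qed
  moreover have "(\<Union>r\<in>transpose_rect ` D. region r) = region (transpose_rect R)"
  proof -
    have "(\<Union>r\<in>transpose_rect ` D. region r) = (\<Union>r\<in>D. prod.swap ` region r)"
      by (simp only: image_image transpose_rect_sides)
    also have "\<dots> = prod.swap ` (\<Union>r\<in>D. region r)" by (simp only: image_UN)
    also have "(\<Union>r\<in>D. region r) = region R" using rectangulationD(4)[OF assms] .
    finally show ?thesis by simp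
  qed
  ultimately show ?thesis using rectangulationD[OF assms] unfolding rectangulation_def by (simp del: transpose_rect_sides)
qed

section \<open>Segments\<close>

lemma vertical_closed_segment:
  fixes a b c :: real
  assumes "a \<le> b"
  shows "closed_segment (c, a) (c, b) = {c} \<times> {a..b}"
proof -
  have "closed_segment (c, a) (c, b) = Pair c ` closed_segment a b"
    by (force simp: closed_segment_def algebra_simps)
  then show ?thesis using assms by (auto simp: closed_segment_eq_real_ivl)
qed

text \<open>Along a segment the abscissa is an affine function of the parameter; equal values at two
  parameters make it constant. Hence a segment containing a vertical side is vertical.\<close>

lemma closed_segment_vertical:
  fixes p q :: "real \<times> real"
  assumes "(c, y1) \<in> closed_segment p q" "(c, y2) \<in> closed_segment p q" "y1 \<noteq> y2" "z \<in> closed_segment p q"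
  shows "fst z = c"
proof -
  obtain t1 where t1: "(c, y1) = (1 - t1) *\<^sub>R p + t1 *\<^sub>R q" using assms(1) by (auto simp: in_segment)
  obtain t2 where t2: "(c, y2) = (1 - t2) *\<^sub>R p + t2 *\<^sub>R q" using assms(2) by (auto simp: in_segment)
  obtain t where t: "z = (1 - t) *\<^sub>R p + t *\<^sub>R q" using assms(4) by (auto simp: in_segment)
  have 1: "c = (1 - t1) * fst p + t1 * fst q" using arg_cong[OF t1, of fst] by simp
  have 2: "c = (1 - t2) * fst p + t2 * fst q" using arg_cong[OF t2, of fst] by simp
  have "t1 \<noteq> t2"
  proof
    assume "t1 = t2"
    then have "(c, y1) = (c, y2)" using t1 t2 by metis
    then show False using assms(3) by simp
  qed
  moreover have "(t1 - t2) * (fst q - fst p) = 0" using 1 2 by (simp add: algebra_simps)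
  ultimately have "fst q = fst p" by simp
  moreover have "fst z = (1 - t) * fst p + t * fst q" using arg_cong[OF t, of fst] by simp
  ultimately show ?thesis using 1 by (simp add: algebra_simps)
qed

lemma sides_subset_region: "proper r \<Longrightarrow> e \<in> sides r \<Longrightarrow> e \<subseteq> region r"
  by (auto simp: sides_def left_side_def right_side_def bottom_side_def top_side_def region_def proper_def)

lemma compact_connected_sides: "e \<in> sides r \<Longrightarrow> compact e \<and> connected e"
  by (auto simp: sides_def left_side_def right_side_def bottom_side_def top_side_def
      intro!: compact_Times connected_Times)

text \<open>The union projects onto a compact connected set of ordinates, hence onto a closed
  interval. This is how a chain of touching sides is recognised as one straight segment.\<close>

lemma vertical_straight_union:
  assumes Q: "finite Q" "Q \<subseteq> (\<Union>r\<in>D. sides r)" and v: "\<Union>Q \<subseteq> {c} \<times> UNIV"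
    and con: "connected (\<Union>Q)" and two: "(c, y1) \<in> \<Union>Q" "(c, y2) \<in> \<Union>Q" "y1 \<noteq> y2"
  shows "straight_union_of_sides D (\<Union>Q)"
proof -
  have "compact (\<Union>Q)" using Q compact_connected_sides by (intro compact_Union) auto
  then have "connected (snd ` \<Union>Q) \<and> compact (snd ` \<Union>Q)"
    using con by (intro conjI connected_continuous_image compact_continuous_image
        continuous_on_snd continuous_on_id)
  then obtain a b where ab: "snd ` \<Union>Q = {a..b}"
    unfolding connected_compact_interval_1 by blast
  have "y1 \<in> {a..b}" "y2 \<in> {a..b}" unfolding ab[symmetric] using two(1,2)[THEN imageI, of snd] by simp_all
  then have "a < b" using two(3) by auto
  have "\<Union>Q = {c} \<times> snd ` \<Union>Q"
  proof -
    have "A = {c} \<times> snd ` A" if "A \<subseteq> {c} \<times> UNIV" for A :: "(real \<times> real) set"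
      using that by force
    then show ?thesis using v by blast
  qed
  also have "\<dots> = closed_segment (c, a) (c, b)"
    unfolding ab using \<open>a < b\<close> by (simp add: vertical_closed_segment)
  finally have "\<Union>Q = closed_segment (c, a) (c, b)" .
  moreover have "(c, a) \<noteq> (c, b)" using \<open>a < b\<close> by simp
  ultimately show ?thesis unfolding straight_union_of_sides_def using Q(2) by blast
qed

text \<open>\<open>D\<close> has finitely many sides, hence only finitely many unions of
  sides.\<close>

lemma straight_union_maximal:
  assumes "finite D" "straight_union_of_sides D s"
  obtains s' where "s \<subseteq> s'" "straight_union_of_sides D s'"
    "\<forall>t. straight_union_of_sides D t \<and> s' \<subseteq> t \<longrightarrow> t = s'"
proof -
  have "finite (\<Union>r\<in>D. sides r)" using assms(1) by (auto simp: sides_def)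
  moreover have "{s. straight_union_of_sides D s} \<subseteq> Union ` Pow (\<Union>r\<in>D. sides r)"
    unfolding straight_union_of_sides_def by blast
  ultimately have "finite {s. straight_union_of_sides D s}"
    by (meson finite_Pow_iff finite_imageI finite_subset)
  from finite_has_maximal2[OF this, of s] assms(2)
  obtain m where "s \<subseteq> m" "straight_union_of_sides D m"
    "\<forall>b\<in>{s. straight_union_of_sides D s}. m \<subseteq> b \<longrightarrow> m = b" by auto
  then show ?thesis using that[of m] by (metis mem_Collect_eq)
qed

lemma straight_union_mono:
  assumes "straight_union_of_sides A s" "A \<subseteq> D"
  shows "straight_union_of_sides D s"
proof -
  have "(\<Union>r\<in>A. sides r) \<subseteq> (\<Union>r\<in>D. sides r)" using assms(2) by (rule UN_mono) simp
  moreover obtain p q Q where s: "p \<noteq> q" "s = closed_segment p q" "Q \<subseteq> (\<Union>r\<in>A. sides r)" "s = \<Union>Q"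
    using assms(1) unfolding straight_union_of_sides_def by blast
  ultimately have "Q \<subseteq> (\<Union>r\<in>D. sides r)" by (meson subset_trans)
  then show ?thesis unfolding straight_union_of_sides_def using s by metis
qed

section \<open>Rectangulations\<close>

lemma segment_closed_segment:
  assumes "segment R D s"
  obtains p q where "s = closed_segment p q"
  using assms unfolding segment_def straight_union_of_sides_def by (elim conjE exE)

lemma rectangulation_bounds:
  assumes "rectangulation R D" "r \<in> D"
  shows "xmin R \<le> xmin r" "xmin r < xmax r" "xmax r \<le> xmax R"
    "ymin R \<le> ymin r" "ymin r < ymax r" "ymax r \<le> ymax R"
proof -
  have "proper r" "region r \<subseteq> region R" using rectangulationD[OF assms(1)] assms(2) by auto
  moreover from this(1) have "(xmin r, ymin r) \<in> region r" "(xmax r, ymax r) \<in> region r"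
    by (auto simp: proper_def region_def)
  ultimately have "(xmin r, ymin r) \<in> region R" "(xmax r, ymax r) \<in> region R" by blast+
  then show "xmin R \<le> xmin r" "xmax r \<le> xmax R" "ymin R \<le> ymin r" "ymax r \<le> ymax R"
    by (auto simp: region_def)
  show "xmin r < xmax r" "ymin r < ymax r" using \<open>proper r\<close> by (auto simp: proper_def)
qed

text \<open>An open set that misses a set misses its closure, and a proper rectangle is the closure
  of its interior.\<close>

lemma interior_region_disjoint:
  assumes "rectangulation R D" "r \<in> D" "r' \<in> D" "r \<noteq> r'"
  shows "interior (region r) \<inter> region r' = {}"
proof -
  have "region r' = closure (interior (region r'))"
    using rectangulation_bounds[OF assms(1,3)]
    unfolding interior_region closure_Times by (simp add: region_def)
  moreover have "interior (region r) \<inter> interior (region r') = {}"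
    using rectangulationD(5)[OF assms] .
  ultimately show ?thesis using open_Int_closure_eq_empty[OF open_interior] by metis
qed

text \<open>This is what prevents cuts and lines, being unions of sides, from running through a
  tile.\<close>

lemma interior_region_sides_disjoint:
  assumes "rectangulation R D" "r \<in> D" "r' \<in> D" "e \<in> sides r'"
  shows "interior (region r) \<inter> e = {}"
proof (cases "r = r'")
  case True
  then show ?thesis using assms(4)
    by (auto simp: interior_region sides_def left_side_def right_side_def bottom_side_def top_side_def)
next
  case False
  have "proper r'" using rectangulationD(3)[OF assms(1,3)] .
  then show ?thesis
    using interior_region_disjoint[OF assms(1-3) False] sides_subset_region assms(4) by blast
qed

lemma mem_right_side: "(x, y) \<in> right_side r \<longleftrightarrow> x = xmax r \<and> ymin r \<le> y \<and> y \<le> ymax r"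
  and mem_left_side: "(x, y) \<in> left_side r \<longleftrightarrow> x = xmin r \<and> ymin r \<le> y \<and> y \<le> ymax r"
  by (auto simp: right_side_def left_side_def)

text \<open>Maximality need not be checked by hand: any straight union that contains both sides
  extends to a maximal one.\<close>

lemma left_stepI:
  assumes R: "rectangulation R D" and r: "r \<in> D" "r' \<in> D"
    and s: "straight_union_of_sides D s" "right_side r \<subseteq> s" "left_side r' \<subseteq> s"
  shows "left_step R D r r'"
proof -
  obtain s' where s': "s \<subseteq> s'" "straight_union_of_sides D s'"
    "\<forall>t. straight_union_of_sides D t \<and> s' \<subseteq> t \<longrightarrow> t = s'"
    by (rule straight_union_maximal[OF rectangulationD(2)[OF R] s(1)])
  note b = rectangulation_bounds[OF R r(1)] rectangulation_bounds[OF R r(2)]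
  have p: "(xmax r, ymin r) \<in> s'" "(xmax r, ymax r) \<in> s'" "(xmin r', ymin r') \<in> s'"
    by (rule subsetD[OF s'(1)], rule subsetD[OF s(2)], use b in \<open>simp add: mem_right_side\<close>)
      (rule subsetD[OF s'(1)], rule subsetD[OF s(2)], use b in \<open>simp add: mem_right_side\<close>,
       rule subsetD[OF s'(1)], rule subsetD[OF s(3)], use b in \<open>simp add: mem_left_side\<close>)
  \<comment> \<open>No side of \<open>R\<close> contains these three corners: a horizontal one has
    no height, the left one lies to the left of \<open>xmax r\<close>, the right one to the right of
    \<open>xmin r'\<close>.\<close>
  have "\<not> s' \<subseteq> e" if "e \<in> sides R" for e
  proof
    assume "s' \<subseteq> e"
    with p have "(xmax r, ymin r) \<in> e" "(xmax r, ymax r) \<in> e" "(xmin r', ymin r') \<in> e" by auto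
    then show False using that b
      by (auto simp: sides_def left_side_def right_side_def bottom_side_def top_side_def)
  qed
  then have "segment R D s'" using s' unfolding segment_def by blast
  then show ?thesis unfolding left_step_def using r s s'(1) by blast
qed

lemma left_step_xmax:
  assumes R: "rectangulation R D" and "left_step R D r r'"
  shows "xmax r = xmin r'"
proof -
  obtain s where s: "segment R D s" "right_side r \<subseteq> s" "left_side r' \<subseteq> s" and r: "r \<in> D" "r' \<in> D"
    using assms(2) unfolding left_step_def by blast
  obtain p q where pq: "s = closed_segment p q"
    using segment_closed_segment[OF s(1)] .
  note b = rectangulation_bounds[OF R r(1)] rectangulation_bounds[OF R r(2)]
  have p: "(xmax r, ymin r) \<in> s" "(xmax r, ymax r) \<in> s" "(xmin r', ymin r') \<in> s"
    by (rule subsetD[OF s(2)], use b in \<open>simp add: mem_right_side\<close>)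
      (rule subsetD[OF s(2)], use b in \<open>simp add: mem_right_side\<close>,
       rule subsetD[OF s(3)], use b in \<open>simp add: mem_left_side\<close>)
  then show ?thesis
    using closed_segment_vertical[OF p(1,2)[unfolded pq] _ p(3)[unfolded pq]] b by simp
qed

lemma on_the_left_less:
  assumes R: "rectangulation R D" and "on_the_left R D r r'" "r \<noteq> r'"
  shows "xmax r \<le> xmin r'"
proof -
  have "(left_step R D)\<^sup>*\<^sup>* r r' \<Longrightarrow> r = r' \<or> xmax r \<le> xmin r'"
  proof (induction rule: rtranclp_induct)
    case (step y z)
    have "y \<in> D" using step.hyps by (simp add: left_step_def)
    from rectangulation_bounds[OF R this] left_step_xmax[OF R step.hyps(2)] step.IH
    show ?case by auto
  qed simp
  then show ?thesis using assms unfolding on_the_left_eq by blast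
qed

text \<open>Two vertical sides that share a point have a connected union, which is already
  straight.\<close>

lemma left_step_touching:
  assumes R: "rectangulation R D" and r: "r \<in> D" "r' \<in> D" "xmax r = xmin r'"
    and y: "ymin r \<le> y" "y \<le> ymax r" "ymin r' \<le> y" "y \<le> ymax r'"
  shows "left_step R D r r'"
proof -
  note b = rectangulation_bounds[OF R r(1)]
  have "straight_union_of_sides D (\<Union>{right_side r, left_side r'})"
  proof (rule vertical_straight_union[of _ _ "xmax r" "ymin r" "ymax r"])
    have "(xmax r, y) \<in> right_side r" "(xmax r, y) \<in> left_side r'"
      using y r(3) by (auto simp: right_side_def left_side_def)
    moreover have "connected (right_side r)" "connected (left_side r')"
      using compact_connected_sides by (auto simp: sides_def)
    ultimately show "connected (\<Union>{right_side r, left_side r'})"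
      using connected_Un[of "right_side r" "left_side r'"] by auto
    show "{right_side r, left_side r'} \<subseteq> (\<Union>r\<in>D. sides r)" using r by (auto simp: sides_def)
  qed (use b r in \<open>auto simp: right_side_def left_side_def\<close>)
  then show ?thesis by (rule left_stepI[OF R r(1,2)]) auto
qed

text \<open>The neighbour is found at mid height of \<open>r\<close>, at an abscissa so close to
  \<open>xmax r\<close> that no left side lies strictly between.\<close>

lemma right_neighbour:
  assumes R: "rectangulation R A" and r: "r \<in> A" "xmax r < xmax R"
  obtains r' y where "r' \<in> A" "xmin r' = xmax r" "ymin r \<le> y" "y \<le> ymax r" "ymin r' \<le> y" "y \<le> ymax r'"
proof -
  note b = rectangulation_bounds[OF R r(1)]
  define y where "y = (ymin r + ymax r) / 2"
  have y: "ymin r < y" "y < ymax r" using b by (auto simp: y_def)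
  \<comment> \<open>The minimum \<open>d\<close> is the nearest abscissa beyond
    \<open>xmax r\<close> of a left side or of the right side of \<open>R\<close>.\<close>
  define E where "E = insert (xmax R) (xmin ` {r'\<in>A. xmax r < xmin r'})"
  have "finite E" using rectangulationD(2)[OF R] by (simp add: E_def)
  define d where "d = Min E"
  have d: "xmax r < d" "d \<le> xmax R"
    using \<open>finite E\<close> r unfolding d_def by (auto simp: E_def)
  have "((xmax r + d) / 2, y) \<in> region R" using d y b by (auto simp: region_def)
  then obtain r' where r': "r' \<in> A" "((xmax r + d) / 2, y) \<in> region r'"
    unfolding rectangulationD(4)[OF R, symmetric] by blast
  have "xmin r' \<le> xmax r"
  proof (rule ccontr)
    assume "\<not> xmin r' \<le> xmax r"
    then have "xmin r' \<in> E" using r' by (auto simp: E_def)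
    then have "d \<le> xmin r'" using \<open>finite E\<close> by (simp add: d_def)
    then show False using r'(2) d by (auto simp: region_def)
  qed
  moreover have "xmax r \<le> xmin r'"
  proof (rule ccontr)
    assume "\<not> xmax r \<le> xmin r'"
    \<comment> \<open>A point slightly to the left of \<open>xmax r\<close>, inside \<open>r\<close>
      and still in \<open>r'\<close>.\<close>
    then have "((max (xmin r) (xmin r') + xmax r) / 2, y) \<in> interior (region r) \<inter> region r'"
      using r'(2) b y d by (auto simp: mem_interior_region mem_region max_def min_def)
    moreover have "r \<noteq> r'" using r'(2) d by (auto simp: region_def)
    ultimately show False using interior_region_disjoint[OF R r(1) r'(1)] by blast
  qed
  ultimately show ?thesis using that[of r' y] r' y by (auto simp: region_def)
qed

lemma left_neighbour:
  assumes R: "rectangulation R A" and r: "r \<in> A" "xmin R < xmin r"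
  obtains r' y where "r' \<in> A" "xmax r' = xmin r" "ymin r \<le> y" "y \<le> ymax r" "ymin r' \<le> y" "y \<le> ymax r'"
proof -
  note b = rectangulation_bounds[OF R r(1)]
  define y where "y = (ymin r + ymax r) / 2"
  have y: "ymin r < y" "y < ymax r" using b by (auto simp: y_def)
  define E where "E = insert (xmin R) (xmax ` {r'\<in>A. xmax r' < xmin r})"
  have "finite E" using rectangulationD(2)[OF R] by (simp add: E_def)
  define d where "d = Max E"
  have d: "d < xmin r" "xmin R \<le> d"
    using \<open>finite E\<close> r unfolding d_def by (auto simp: E_def)
  have "((xmin r + d) / 2, y) \<in> region R" using d y b by (auto simp: region_def)
  then obtain r' where r': "r' \<in> A" "((xmin r + d) / 2, y) \<in> region r'"
    unfolding rectangulationD(4)[OF R, symmetric] by blast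
  have "xmin r \<le> xmax r'"
  proof (rule ccontr)
    assume "\<not> xmin r \<le> xmax r'"
    then have "xmax r' \<in> E" using r' by (auto simp: E_def)
    then have "xmax r' \<le> d" using \<open>finite E\<close> by (simp add: d_def)
    then show False using r'(2) d by (auto simp: region_def)
  qed
  moreover have "xmax r' \<le> xmin r"
  proof (rule ccontr)
    assume "\<not> xmax r' \<le> xmin r"
    then have "((min (xmax r) (xmax r') + xmin r) / 2, y) \<in> interior (region r) \<inter> region r'"
      using r'(2) b y d by (auto simp: mem_interior_region mem_region max_def min_def)
    moreover have "r \<noteq> r'" using r'(2) d by (auto simp: region_def)
    ultimately show False using interior_region_disjoint[OF R r(1) r'(1)] by blast
  qed
  ultimately show ?thesis using that[of r' y] r' y by (auto simp: region_def)
qed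

section \<open>Cuts of rectangulations\<close>

text \<open>The neighbours are taken inside \<open>A\<close>, whereas \<open>on_the_left\<close>
  refers to the segments of \<open>D\<close>; touching sides suffice for a step there. No rectangle
  of \<open>A\<close> straddles \<open>c\<close>, so the chain cannot jump over it, and every step
  increases \<open>xmax\<close>.\<close>

lemma chain_to_cut_right:
  assumes R: "rectangulation R D" "A \<subseteq> D" "rectangulation B A"
    and c: "c < xmax B" "\<forall>r\<in>A. xmax r \<le> c \<or> c \<le> xmin r"
  shows "r \<in> A \<Longrightarrow> xmax r \<le> c \<Longrightarrow> \<exists>r0\<in>A. on_the_left R D r r0 \<and> xmax r0 = c"
proof (induction "card {r'\<in>A. xmax r < xmax r'}" arbitrary: r rule: less_induct)
  case less
  show ?case
  proof (cases "xmax r = c")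
    case True
    then show ?thesis using less.prems by (auto simp: on_the_left_eq)
  next
    case False
    then have r: "xmax r < c" using less.prems by simp
    obtain r' y where r': "r' \<in> A" "xmin r' = xmax r" "ymin r \<le> y" "y \<le> ymax r" "ymin r' \<le> y" "y \<le> ymax r'"
      using right_neighbour[OF R(3) less.prems(1)] r c(1) by (metis less_trans)
    have step: "left_step R D r r'"
      using left_step_touching[OF R(1), of r r' y] r' less.prems(1) R(2) by auto
    have lt: "xmax r < xmax r'" using rectangulation_bounds(2)[OF R(3) r'(1)] r'(2) by simp
    have "xmax r' \<le> c" using c(2) r' r by force
    moreover have "card {s\<in>A. xmax r' < xmax s} < card {s\<in>A. xmax r < xmax s}"
      using r'(1) lt rectangulationD(2)[OF R(3)] by (intro psubset_card_mono) auto
    ultimately obtain r0 where "r0 \<in> A" "on_the_left R D r' r0" "xmax r0 = c"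
      using less.hyps r'(1) by blast
    then show ?thesis using step unfolding on_the_left_eq by (blast intro: converse_rtranclp_into_rtranclp)
  qed
qed

lemma chain_to_cut_left:
  assumes R: "rectangulation R D" "A \<subseteq> D" "rectangulation B A"
    and c: "xmin B < c" "\<forall>r\<in>A. xmax r \<le> c \<or> c \<le> xmin r"
  shows "r \<in> A \<Longrightarrow> c \<le> xmin r \<Longrightarrow> \<exists>r0\<in>A. on_the_left R D r0 r \<and> xmin r0 = c"
proof (induction "card {r'\<in>A. xmin r' < xmin r}" arbitrary: r rule: less_induct)
  case less
  show ?case
  proof (cases "xmin r = c")
    case True
    then show ?thesis using less.prems by (auto simp: on_the_left_eq)
  next
    case False
    then have r: "c < xmin r" using less.prems by simp
    obtain r' y where r': "r' \<in> A" "xmax r' = xmin r" "ymin r \<le> y" "y \<le> ymax r" "ymin r' \<le> y" "y \<le> ymax r'"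
      using left_neighbour[OF R(3) less.prems(1)] r c(1) by (metis less_trans)
    have step: "left_step R D r' r"
      using left_step_touching[OF R(1), of r' r y] r' less.prems(1) R(2) by auto
    have lt: "xmin r' < xmin r" using rectangulation_bounds(2)[OF R(3) r'(1)] r'(2) by simp
    have "c \<le> xmin r'" using c(2) r' r by force
    moreover have "card {s\<in>A. xmin s < xmin r'} < card {s\<in>A. xmin s < xmin r}"
      using r'(1) lt rectangulationD(2)[OF R(3)] by (intro psubset_card_mono) auto
    ultimately obtain r0 where "r0 \<in> A" "on_the_left R D r0 r'" "xmin r0 = c"
      using less.hyps r'(1) by blast
    then show ?thesis using step unfolding on_the_left_eq by (blast intro: rtranclp.rtrancl_into_rtrancl)
  qed
qed

lemma straight_union_subset_region:
  assumes "rectangulation R D" "straight_union_of_sides D s"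
  shows "s \<subseteq> region R"
proof -
  obtain Q where Q: "Q \<subseteq> (\<Union>r\<in>D. sides r)" "s = \<Union>Q"
    using assms(2) unfolding straight_union_of_sides_def by blast
  have "e \<subseteq> region R" if e: "e \<in> Q" for e
  proof -
    obtain r where r: "r \<in> D" "e \<in> sides r" using Q(1) e by blast
    then have "e \<subseteq> region r" using sides_subset_region rectangulationD(3)[OF assms(1)] by blast
    then show ?thesis using r(1) unfolding rectangulationD(4)[OF assms(1), symmetric] by blast
  qed
  then show ?thesis unfolding Q(2) by (rule Union_least)
qed

text \<open>A cut is a union of sides and sides avoid the interiors of rectangles, so no rectangle
  straddles a cut.\<close>

lemma vertical_cut_position:
  assumes B: "rectangulation B A" and s: "segment B A ({c} \<times> {ymin B..ymax B})"
  shows "xmin B < c" "c < xmax B" "\<forall>r\<in>A. xmax r \<le> c \<or> c \<le> xmin r"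
proof -
  have su: "straight_union_of_sides A ({c} \<times> {ymin B..ymax B})" using s by (simp add: segment_def)
  have "ymin B < ymax B" using rectangulationD(1)[OF B] by (simp add: proper_def)
  then have "(c, ymin B) \<in> region B"
    using subsetD[OF straight_union_subset_region[OF B su], of "(c, ymin B)"] by simp
  then have "xmin B \<le> c" "c \<le> xmax B" by (simp_all add: mem_region)
  moreover have "left_side B \<in> sides B" "right_side B \<in> sides B" by (simp_all add: sides_def)
  then have "c \<noteq> xmin B" "c \<noteq> xmax B"
    using s unfolding segment_def left_side_def right_side_def by blast+
  ultimately show "xmin B < c" "c < xmax B" by simp_all
  show "\<forall>r\<in>A. xmax r \<le> c \<or> c \<le> xmin r"
  proof (rule ballI, rule ccontr)
    fix r assume r: "r \<in> A" "\<not> (xmax r \<le> c \<or> c \<le> xmin r)"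
    note b = rectangulation_bounds[OF B r(1)]
    define y where "y = (ymin r + ymax r) / 2"
    have int: "(c, y) \<in> interior (region r)" using b r(2) by (simp add: mem_interior_region y_def)
    have "(c, y) \<in> {c} \<times> {ymin B..ymax B}" using b by (simp add: y_def)
    moreover obtain Q where "Q \<subseteq> (\<Union>r\<in>A. sides r)" "{c} \<times> {ymin B..ymax B} = \<Union>Q"
      using su unfolding straight_union_of_sides_def by blast
    ultimately obtain e r' where "r' \<in> A" "e \<in> sides r'" "(c, y) \<in> e" by blast
    then show False using interior_region_sides_disjoint[OF B r(1)] int by blast
  qed
qed

lemma vertical_split:
  assumes B: "rectangulation B A" and c: "xmin B < c" "c < xmax B" "\<forall>r\<in>A. xmax r \<le> c \<or> c \<le> xmin r"
  shows "rectangulation (Rect (xmin B) (ymin B) c (ymax B)) {r\<in>A. xmax r \<le> c}" (is "rectangulation ?L ?AL")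
    and "rectangulation (Rect c (ymin B) (xmax B) (ymax B)) {r\<in>A. c \<le> xmin r}" (is "rectangulation ?R ?AR")
proof -
  note b = rectangulation_bounds[OF B]
  have y: "ymin B < ymax B" using rectangulationD(1)[OF B] by (simp add: proper_def)
  have cl: "closed (\<Union>r\<in>A'. region r)" if "A' \<subseteq> A" for A'
    using that rectangulationD(2)[OF B] by (intro closed_UN) (auto simp: region_def closed_Times intro: finite_subset)
  \<comment> \<open>The rectangle found for a point with abscissa \<open>c\<close> may belong to the
    other part, so only the half-open strip is covered directly and its closure is taken.\<close>
  have "region ?L = closure ({xmin B..<c} \<times> {ymin B..ymax B})"
    using c y by (simp add: region_def closure_Times)
  also have "\<dots> \<subseteq> (\<Union>r\<in>?AL. region r)"
  proof (rule closure_minimal[OF subsetI cl])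
    fix p assume p: "p \<in> {xmin B..<c} \<times> {ymin B..ymax B}"
    then have "p \<in> region B" using c by (auto simp: region_def)
    then obtain r where r: "r \<in> A" "p \<in> region r" unfolding rectangulationD(4)[OF B, symmetric] by blast
    then have "\<not> c \<le> xmin r" using p by (auto simp: region_def)
    then show "p \<in> (\<Union>r\<in>?AL. region r)" using r c(3) by auto
  qed auto
  finally have L: "region ?L \<subseteq> (\<Union>r\<in>?AL. region r)" .
  have "region ?R = closure ({c<..xmax B} \<times> {ymin B..ymax B})"
    using c y by (simp add: region_def closure_Times)
  also have "\<dots> \<subseteq> (\<Union>r\<in>?AR. region r)"
  proof (rule closure_minimal[OF subsetI cl])
    fix p assume p: "p \<in> {c<..xmax B} \<times> {ymin B..ymax B}"
    then have "p \<in> region B" using c by (auto simp: region_def)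
    then obtain r where r: "r \<in> A" "p \<in> region r" unfolding rectangulationD(4)[OF B, symmetric] by blast
    then have "\<not> xmax r \<le> c" using p by (auto simp: region_def)
    then show "p \<in> (\<Union>r\<in>?AR. region r)" using r c(3) by auto
  qed auto
  finally have R: "region ?R \<subseteq> (\<Union>r\<in>?AR. region r)" .
  have "region r \<subseteq> region ?L" if "r \<in> ?AL" for r
    using b(1,4,6)[of r] that by (auto simp: region_def)
  then have L': "(\<Union>r\<in>?AL. region r) = region ?L" using L by blast
  have "region r \<subseteq> region ?R" if "r \<in> ?AR" for r
    using b(3,4,6)[of r] that by (auto simp: region_def)
  then have R': "(\<Union>r\<in>?AR. region r) = region ?R" using R by blast
  show "rectangulation ?L ?AL" "rectangulation ?R ?AR"
    unfolding rectangulation_def L' R' using rectangulationD(2,3,5)[OF B] c y by (simp_all add: proper_def)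
qed

text \<open>If no rectangle straddles \<open>c\<close>, the rectangles on the left form a
  rectangulation by themselves; those that meet the abscissa \<open>c\<close> must end there, and
  their right sides fill the cut.\<close>

lemma vertical_cutI:
  assumes B: "rectangulation B A" and c: "xmin B < c" "c < xmax B" "\<forall>r\<in>A. xmax r \<le> c \<or> c \<le> xmin r"
  shows "segment B A ({c} \<times> {ymin B..ymax B})" (is "segment B A ?s")
proof -
  note b = rectangulation_bounds[OF B]
  have y: "ymin B < ymax B" using rectangulationD(1)[OF B] by (simp add: proper_def)
  let ?Q = "right_side ` {r\<in>A. xmax r = c}"
  have "?s \<subseteq> \<Union>?Q"
  proof
    fix p assume "p \<in> ?s"
    then have "p \<in> region (Rect (xmin B) (ymin B) c (ymax B))" using c by (auto simp: region_def)
    then obtain r where r: "r \<in> A" "xmax r \<le> c" "p \<in> region r"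
      unfolding rectangulationD(4)[OF vertical_split(1)[OF B c], symmetric] by blast
    then have "xmax r = c" "p \<in> right_side r" using \<open>p \<in> ?s\<close> by (auto simp: region_def right_side_def)
    then show "p \<in> \<Union>?Q" using r(1) by blast
  qed
  moreover have "right_side r \<subseteq> ?s" if "r \<in> A" "xmax r = c" for r
    using b(4,6)[OF that(1)] that(2) by (auto simp: right_side_def)
  ultimately have "?s = \<Union>?Q" by blast
  moreover have "?Q \<subseteq> (\<Union>r\<in>A. sides r)" by (auto simp: sides_def)
  moreover have "?s = closed_segment (c, ymin B) (c, ymax B)" using y by (simp add: vertical_closed_segment)
  moreover have "(c, ymin B) \<noteq> (c, ymax B)" using y by simp
  ultimately have "straight_union_of_sides A ?s" unfolding straight_union_of_sides_def by metis
  \<comment> \<open>A longer segment would have to stay at the abscissa \<open>c\<close> and leave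
    \<open>B\<close>.\<close>
  moreover have "s' = ?s" if s': "straight_union_of_sides A s'" "?s \<subseteq> s'" for s'
  proof -
    obtain p q where pq: "s' = closed_segment p q"
      using s'(1) unfolding straight_union_of_sides_def by (elim conjE exE)
    have "(c, ymin B) \<in> s'" "(c, ymax B) \<in> s'" by (rule subsetD[OF s'(2)], use y in simp)+
    then have "fst z = c" if "z \<in> s'" for z
      using closed_segment_vertical[of c "ymin B" p q "ymax B" z] y that unfolding pq by simp
    moreover have "s' \<subseteq> region B" using straight_union_subset_region[OF B s'(1)] .
    ultimately have "s' \<subseteq> ?s" by (fastforce simp: region_def)
    then show ?thesis using s'(2) by blast
  qed
  moreover have "\<not> ?s \<subseteq> e" if "e \<in> sides B" for e
  proof
    assume "?s \<subseteq> e"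
    then have "(c, ymin B) \<in> e" "(c, ymax B) \<in> e" using y by auto
    then show False using that c y
      by (auto simp: sides_def left_side_def right_side_def bottom_side_def top_side_def)
  qed
  ultimately show ?thesis unfolding segment_def by simp
qed

text \<open>The cut is known to be maximal only within \<open>A\<close>; in \<open>D\<close> it is a
  straight union that \<open>left_stepI\<close> may extend. A chain up to the cut, one step across
  it and a chain away from it relate every pair.\<close>

lemma vertical_cut_separates:
  assumes R: "rectangulation R D" "A \<subseteq> D" and B: "rectangulation B A"
    and s: "segment B A ({c} \<times> {ymin B..ymax B})"
    and r: "r \<in> A" "xmax r \<le> c" "r' \<in> A" "c \<le> xmin r'"
  shows "on_the_left R D r r'"
proof -
  note c = vertical_cut_position[OF B s]
  obtain r0 where r0: "r0 \<in> A" "on_the_left R D r r0" "xmax r0 = c"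
    using chain_to_cut_right[OF R B c(2,3) r(1,2)] by blast
  obtain r1 where r1: "r1 \<in> A" "on_the_left R D r1 r'" "xmin r1 = c"
    using chain_to_cut_left[OF R B c(1,3) r(3,4)] by blast
  have "left_step R D r0 r1"
  proof (rule left_stepI[OF R(1)])
    show "straight_union_of_sides D ({c} \<times> {ymin B..ymax B})"
      using s straight_union_mono R(2) by (auto simp: segment_def)
    show "right_side r0 \<subseteq> {c} \<times> {ymin B..ymax B}" "left_side r1 \<subseteq> {c} \<times> {ymin B..ymax B}"
      using r0 r1 rectangulation_bounds[OF B r0(1)] rectangulation_bounds[OF B r1(1)]
      by (auto simp: right_side_def left_side_def)
  qed (use r0 r1 R in auto)
  then show ?thesis using r0(2) r1(2) unfolding on_the_left_eq
    by (meson rtranclp.rtrancl_into_rtrancl rtranclp_trans)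
qed

lemma image_transpose_filter:
  "{r \<in> transpose_rect ` A. P r} = transpose_rect ` {r \<in> A. P (transpose_rect r)}"
  by auto

lemma horizontal_cut_facts:
  assumes R: "rectangulation R D" "A \<subseteq> D" and B: "rectangulation B A"
    and s: "segment B A ({xmin B..xmax B} \<times> {c})"
  shows "ymin B < c" "c < ymax B" "\<forall>r\<in>A. ymax r \<le> c \<or> c \<le> ymin r"
    "\<And>r r'. r \<in> A \<Longrightarrow> ymax r \<le> c \<Longrightarrow> r' \<in> A \<Longrightarrow> c \<le> ymin r' \<Longrightarrow> below R D r r'"
proof -
  let ?T = transpose_rect
  have s': "segment (?T B) (?T ` A) ({c} \<times> {ymin (?T B)..ymax (?T B)})"
    using segment_transpose[OF s] by (simp add: product_swap)
  note B' = rectangulation_transpose[OF B]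
  have "ymin B < c \<and> c < ymax B \<and> (\<forall>r\<in>A. ymax r \<le> c \<or> c \<le> ymin r)"
    using vertical_cut_position[OF B' s'] by simp
  then show "ymin B < c" "c < ymax B" "\<forall>r\<in>A. ymax r \<le> c \<or> c \<le> ymin r" by blast+
  show "below R D r r'" if "r \<in> A" "ymax r \<le> c" "r' \<in> A" "c \<le> ymin r'" for r r'
    unfolding below_transpose
    using vertical_cut_separates[OF rectangulation_transpose[OF R(1)] image_mono[OF R(2)] B' s', of "?T r" "?T r'"]
      that by simp
qed

lemma horizontal_split:
  assumes B: "rectangulation B A" and c: "ymin B < c" "c < ymax B" "\<forall>r\<in>A. ymax r \<le> c \<or> c \<le> ymin r"
  shows "rectangulation (Rect (xmin B) (ymin B) (xmax B) c) {r\<in>A. ymax r \<le> c}"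
    and "rectangulation (Rect (xmin B) c (xmax B) (ymax B)) {r\<in>A. c \<le> ymin r}"
    and "segment B A ({xmin B..xmax B} \<times> {c})"
proof -
  let ?T = transpose_rect
  note B' = rectangulation_transpose[OF B]
  have c': "xmin (?T B) < c" "c < xmax (?T B)" "\<forall>r\<in>?T ` A. xmax r \<le> c \<or> c \<le> xmin r" using c by auto
  show "rectangulation (Rect (xmin B) (ymin B) (xmax B) c) {r\<in>A. ymax r \<le> c}"
    "rectangulation (Rect (xmin B) c (xmax B) (ymax B)) {r\<in>A. c \<le> ymin r}"
    using vertical_split[OF B' c', THEN rectangulation_transpose]
    by (simp_all add: image_transpose_filter) (simp_all add: transpose_rect_def)
  show "segment B A ({xmin B..xmax B} \<times> {c})"
    using segment_transpose[OF vertical_cutI[OF B' c']] by (simp add: product_swap)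
qed

section \<open>Guillotine rectangulations\<close>

text \<open>The guillotine property with all geometry removed. The relations stay those of the whole
  rectangulation even for its parts, so a bijection that preserves them carries the entire tree of
  cuts.\<close>

inductive separable :: "('a \<Rightarrow> 'a \<Rightarrow> bool) \<Rightarrow> ('a \<Rightarrow> 'a \<Rightarrow> bool) \<Rightarrow> 'a set \<Rightarrow> bool" for L B where
  single: "separable L B {a}"
| left: "separable L B A1 \<Longrightarrow> separable L B A2 \<Longrightarrow> A1 \<inter> A2 = {} \<Longrightarrow> \<forall>a\<in>A1. \<forall>b\<in>A2. L a b
    \<Longrightarrow> separable L B (A1 \<union> A2)"
| below: "separable L B A1 \<Longrightarrow> separable L B A2 \<Longrightarrow> A1 \<inter> A2 = {} \<Longrightarrow> \<forall>a\<in>A1. \<forall>b\<in>A2. B a b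
    \<Longrightarrow> separable L B (A1 \<union> A2)"

lemma separable_nonempty: "separable L B A \<Longrightarrow> A \<noteq> {}"
  by (induction rule: separable.induct) auto

lemma separable_image:
  assumes "separable L B A" "inj_on f A"
    "\<And>a b. a \<in> A \<Longrightarrow> b \<in> A \<Longrightarrow> L a b \<Longrightarrow> L' (f a) (f b)"
    "\<And>a b. a \<in> A \<Longrightarrow> b \<in> A \<Longrightarrow> B a b \<Longrightarrow> B' (f a) (f b)"
  shows "separable L' B' (f ` A)"
  using assms
proof (induction rule: separable.induct)
  case (single a)
  then show ?case by (simp add: separable.single)
next
  case (left A1 A2)
  have "inj_on f A1" "inj_on f A2" using left.prems(1) by (auto intro: inj_on_subset)
  then have "separable L' B' (f ` A1)" "separable L' B' (f ` A2)"
    using left.IH left.prems(2,3) by auto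
  moreover have "f ` A1 \<inter> f ` A2 = {}"
    using left.hyps(3) left.prems(1) by (auto simp: inj_on_def)
  ultimately show ?case unfolding image_Un
    using left.prems(2) left.hyps(4) by (intro separable.left) auto
next
  case (below A1 A2)
  have "inj_on f A1" "inj_on f A2" using below.prems(1) by (auto intro: inj_on_subset)
  then have "separable L' B' (f ` A1)" "separable L' B' (f ` A2)"
    using below.IH below.prems(2,3) by auto
  moreover have "f ` A1 \<inter> f ` A2 = {}"
    using below.hyps(3) below.prems(1) by (auto simp: inj_on_def)
  ultimately show ?case unfolding image_Un
    using below.prems(3) below.hyps(4) by (intro separable.below) auto
qed

lemma separable_bij:
  assumes f: "bij_betw f A A'"
    and L: "\<And>a b. a \<in> A \<Longrightarrow> b \<in> A \<Longrightarrow> L a b \<longleftrightarrow> L' (f a) (f b)"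
    and B: "\<And>a b. a \<in> A \<Longrightarrow> b \<in> A \<Longrightarrow> B a b \<longleftrightarrow> B' (f a) (f b)"
  shows "separable L B A \<longleftrightarrow> separable L' B' A'"
proof
  assume "separable L B A"
  then have "separable L' B' (f ` A)"
    using f L B by (intro separable_image[of L B A]) (auto simp: bij_betw_def)
  then show "separable L' B' A'" using f by (simp add: bij_betw_def)
next
  let ?g = "inv_into A f"
  have g: "?g a \<in> A" "f (?g a) = a" if "a \<in> A'" for a
    using f that by (auto simp: bij_betw_def inv_into_into f_inv_into_f)
  assume "separable L' B' A'"
  moreover have "inj_on ?g A'" "?g ` A' = A" using bij_betw_inv_into[OF f] by (auto simp: bij_betw_def)
  ultimately show "separable L B A"
    using separable_image[of L' B' A' ?g L B] L B g by simp
qed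

text \<open>\<open>B\<close> and \<open>A\<close> vary with the recursion, \<open>R\<close> and
  \<open>D\<close> do not: a cut of a part separates its rectangles also in the relations of
  \<open>D\<close>.\<close>

lemma guillotine_imp_separable:
  assumes R: "rectangulation R D"
  shows "guillotine B A \<Longrightarrow> rectangulation B A \<Longrightarrow> A \<subseteq> D \<Longrightarrow>
    separable (on_the_left R D) (below R D) A"
proof (induction rule: guillotine.induct)
  case (single A B)
  then show ?case by (auto simp: card_1_singleton_iff intro: separable.single)
next
  case (vertical_cut B A c)
  note c = vertical_cut_position[OF vertical_cut.prems(1) vertical_cut.hyps(1)]
  let ?A1 = "{r \<in> A. xmax r \<le> c}" and ?A2 = "{r \<in> A. c \<le> xmin r}"
  have "separable (on_the_left R D) (below R D) (?A1 \<union> ?A2)"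
  proof (rule separable.left)
    show "separable (on_the_left R D) (below R D) ?A1" "separable (on_the_left R D) (below R D) ?A2"
      using vertical_cut.IH vertical_split[OF vertical_cut.prems(1) c] vertical_cut.prems(2) by auto
    show "?A1 \<inter> ?A2 = {}" using rectangulation_bounds(2)[OF vertical_cut.prems(1)] by fastforce
    show "\<forall>a\<in>?A1. \<forall>b\<in>?A2. on_the_left R D a b"
      using vertical_cut_separates[OF R vertical_cut.prems(2,1) vertical_cut.hyps(1)] by blast
  qed
  moreover have "?A1 \<union> ?A2 = A" using c(3) by blast
  ultimately show ?case by simp
next
  case (horizontal_cut B A c)
  note c = horizontal_cut_facts[OF R horizontal_cut.prems(2,1) horizontal_cut.hyps(1)]
  let ?A1 = "{r \<in> A. ymax r \<le> c}" and ?A2 = "{r \<in> A. c \<le> ymin r}"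
  have "separable (on_the_left R D) (below R D) (?A1 \<union> ?A2)"
  proof (rule separable.below)
    show "separable (on_the_left R D) (below R D) ?A1" "separable (on_the_left R D) (below R D) ?A2"
      using horizontal_cut.IH horizontal_split[OF horizontal_cut.prems(1) c(1-3)] horizontal_cut.prems(2) by auto
    show "?A1 \<inter> ?A2 = {}" using rectangulation_bounds(5)[OF horizontal_cut.prems(1)] by fastforce
    show "\<forall>a\<in>?A1. \<forall>b\<in>?A2. below R D a b" using c(4) by blast
  qed
  moreover have "?A1 \<union> ?A2 = A" using c(3) by blast
  ultimately show ?case by simp
qed

text \<open>\<open>c\<close> is the largest right abscissa in \<open>A1\<close>; by
  \<open>lt\<close> no rectangle of \<open>A2\<close> starts before it.\<close>

lemma separating_abscissa:
  fixes A1 A2 :: "rect set"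
  assumes "finite A1" "A1 \<noteq> {}" "A2 \<noteq> {}" and lt: "\<And>r r'. r \<in> A1 \<Longrightarrow> r' \<in> A2 \<Longrightarrow> xmax r \<le> xmin r'"
    and B: "rectangulation B (A1 \<union> A2)"
  obtains c where "xmin B < c" "c < xmax B" "\<forall>r\<in>A1 \<union> A2. xmax r \<le> c \<or> c \<le> xmin r"
    "{r \<in> A1 \<union> A2. xmax r \<le> c} = A1" "{r \<in> A1 \<union> A2. c \<le> xmin r} = A2"
proof -
  note b = rectangulation_bounds[OF B]
  define c where "c = Max (xmax ` A1)"
  have 1: "xmax r \<le> c" if "r \<in> A1" for r using that assms(1) by (simp add: c_def)
  have "c \<in> xmax ` A1" unfolding c_def using assms(1,2) by (intro Max_in) auto
  then obtain r0 where r0: "r0 \<in> A1" "c = xmax r0" by blast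
  have 2: "c \<le> xmin r" if "r \<in> A2" for r using lt[OF r0(1) that] r0(2) by simp
  obtain r1 where r1: "r1 \<in> A2" using assms(3) by blast
  have "xmin B < c" using b[of r0] r0 by auto
  moreover have "c < xmax B" using 2[OF r1] b[of r1] r1 by auto
  moreover have "{r \<in> A1 \<union> A2. xmax r \<le> c} = A1" "{r \<in> A1 \<union> A2. c \<le> xmin r} = A2"
    using 1 2 b(2) by force+
  ultimately show ?thesis using that[of c] 1 2 by blast
qed

lemma separable_imp_guillotine:
  assumes R: "rectangulation R D"
  shows "separable (on_the_left R D) (below R D) A \<Longrightarrow> rectangulation B A \<Longrightarrow> A \<subseteq> D \<Longrightarrow> guillotine B A"
proof (induction arbitrary: B rule: separable.induct)
  case (single a)
  then show ?case by (simp add: guillotine.single)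
next
  case (left A1 A2)
  note ne = separable_nonempty[OF left.hyps(1)] separable_nonempty[OF left.hyps(2)]
  have "finite A1" using rectangulationD(2)[OF left.prems(1)] by simp
  moreover have "xmax r \<le> xmin r'" if "r \<in> A1" "r' \<in> A2" for r r'
  proof -
    \<comment> \<open>The relation is reflexive and gives coordinates only for distinct rectangles;
      disjointness of the parts supplies this.\<close>
    have "on_the_left R D r r'" "r \<noteq> r'" using left.hyps(3,4) that by blast+
    then show ?thesis by (rule on_the_left_less[OF R])
  qed
  ultimately obtain c where c: "xmin B < c" "c < xmax B" "\<forall>r\<in>A1 \<union> A2. xmax r \<le> c \<or> c \<le> xmin r"
    and A: "{r \<in> A1 \<union> A2. xmax r \<le> c} = A1" "{r \<in> A1 \<union> A2. c \<le> xmin r} = A2"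
    using separating_abscissa[OF _ ne _ left.prems(1)] by blast
  note sp = vertical_split[OF left.prems(1) c, unfolded A]
  show ?case
  proof (rule guillotine.vertical_cut[OF vertical_cutI[OF left.prems(1) c]], unfold A)
    show "guillotine (Rect (xmin B) (ymin B) c (ymax B)) A1" "guillotine (Rect c (ymin B) (xmax B) (ymax B)) A2"
      using left.IH sp left.prems(2) by blast+
  qed
next
  case (below A1 A2)
  let ?T = transpose_rect
  note ne = separable_nonempty[OF below.hyps(1)] separable_nonempty[OF below.hyps(2)]
  have fin: "finite (?T ` A1)" using rectangulationD(2)[OF below.prems(1)] by simp
  have le: "ymax r \<le> ymin r'" if "r \<in> A1" "r' \<in> A2" for r r'
  proof -
    have "below R D r r'" "r \<noteq> r'" using below.hyps(3,4) that by blast+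
    then show ?thesis
      using on_the_left_less[OF rectangulation_transpose[OF R], of "?T r" "?T r'"]
      by (simp add: below_transpose)
  qed
  have rect: "rectangulation (?T B) (?T ` A1 \<union> ?T ` A2)"
    using rectangulation_transpose[OF below.prems(1)] by (simp add: image_Un)
  have ne': "?T ` A1 \<noteq> {}" "?T ` A2 \<noteq> {}" using ne by simp_all
  have le': "xmax r \<le> xmin r'" if "r \<in> ?T ` A1" "r' \<in> ?T ` A2" for r r' using le that by auto
  obtain c where c: "xmin (?T B) < c" "c < xmax (?T B)"
    "\<forall>r\<in>?T ` A1 \<union> ?T ` A2. xmax r \<le> c \<or> c \<le> xmin r"
    and A: "{r \<in> ?T ` A1 \<union> ?T ` A2. xmax r \<le> c} = ?T ` A1" "{r \<in> ?T ` A1 \<union> ?T ` A2. c \<le> xmin r} = ?T ` A2"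
    by (rule separating_abscissa[OF fin ne' le' rect])
  have c': "ymin B < c" "c < ymax B" "\<forall>r\<in>A1 \<union> A2. ymax r \<le> c \<or> c \<le> ymin r" using c by (simp_all add: ball_Un)
  have "?T ` {r \<in> A1 \<union> A2. ymax r \<le> c} = ?T ` A1" "?T ` {r \<in> A1 \<union> A2. c \<le> ymin r} = ?T ` A2"
    using A unfolding image_Un[symmetric] image_transpose_filter by simp_all
  then have A': "{r \<in> A1 \<union> A2. ymax r \<le> c} = A1" "{r \<in> A1 \<union> A2. c \<le> ymin r} = A2"
    by (metis transpose_rect_image_image)+
  note sp = horizontal_split[OF below.prems(1) c', unfolded A']
  show ?case
  proof (rule guillotine.horizontal_cut[OF sp(3)], unfold A')
    show "guillotine (Rect (xmin B) (ymin B) (xmax B) c) A1" "guillotine (Rect (xmin B) c (xmax B) (ymax B)) A2"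
      using below.IH sp(1,2) below.prems(2) by blast+
  qed
qed

theorem guillotine_iff_separable:
  assumes "rectangulation R D"
  shows "guillotine R D \<longleftrightarrow> separable (on_the_left R D) (below R D) D"
  using guillotine_imp_separable[OF assms] separable_imp_guillotine[OF assms] assms by blast

section \<open>Line numbers of the sides\<close>

text \<open>The vertical line number \<open>w\<close> lies between the columns \<open>w\<close> and \<open>w + 1\<close>, the horizontal line number \<open>w\<close>
  between the rows \<open>w - 1\<close> and \<open>w\<close>; the values \<open>0\<close>, \<open>n\<close> and \<open>1\<close>, \<open>n + 1\<close> stand for the sides of the square.\<close>

definition left_line :: "(nat \<Rightarrow> int) \<Rightarrow> nat \<Rightarrow> nat" where
  "left_line q j = (GREATEST w. w < j \<and> (w = 0 \<or> q w < q j))"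

definition right_line :: "nat \<Rightarrow> (nat \<Rightarrow> int) \<Rightarrow> nat \<Rightarrow> nat" where
  "right_line n q j = (LEAST w. j \<le> w \<and> (w = n \<or> q j < q (w + 1)))"

text \<open>For rows, earlier and later change roles: the bottom of \<open>r_j\<close> is on the
  line above the first larger label inserted before it, its top on the line below the last smaller
  label inserted after it. The shift by 1 comes from the numbering: row \<open>w\<close> lies below
  horizontal line \<open>w\<close>, whereas column \<open>w\<close> lies to the left of vertical
  line \<open>w\<close>.\<close>

definition bottom_line :: "nat \<Rightarrow> (nat \<Rightarrow> int) \<Rightarrow> nat \<Rightarrow> nat" where
  "bottom_line n q j = right_line n (\<lambda>i. - q i) j + 1"

definition top_line :: "(nat \<Rightarrow> int) \<Rightarrow> nat \<Rightarrow> nat" where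
  "top_line q j = left_line (\<lambda>i. - q i) j + 1"

text \<open>Replaces the greatest element by inequalities that determine \<open>w\<close>;
  injectivity of \<open>q\<close> makes the last clause strict.\<close>

lemma left_line_iff:
  assumes q: "inj_on q {1..n}" and j: "j \<in> {1..n}"
  shows "left_line q j = w \<longleftrightarrow> w < j \<and> (w = 0 \<or> q w < q j) \<and> (\<forall>v. w < v \<and> v < j \<longrightarrow> q j < q v)"
proof
  let ?P = "\<lambda>w. w < j \<and> (w = 0 \<or> q w < q j)"
  assume w: "left_line q j = w"
  have "?P 0" using j by auto
  then have "?P w" unfolding w[symmetric] left_line_def by (rule GreatestI_nat[where b = j]) auto
  moreover have "q j < q v" if "w < v" "v < j" for v
  proof -
    have "\<not> ?P v"
      using Greatest_le_nat[of ?P v j] that(1) unfolding w[symmetric] left_line_def by auto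
    moreover have "q v \<noteq> q j" using inj_onD[OF q, of v j] that j by auto
    ultimately show ?thesis using that by auto
  qed
  ultimately show "w < j \<and> (w = 0 \<or> q w < q j) \<and> (\<forall>v. w < v \<and> v < j \<longrightarrow> q j < q v)" by blast
next
  assume w: "w < j \<and> (w = 0 \<or> q w < q j) \<and> (\<forall>v. w < v \<and> v < j \<longrightarrow> q j < q v)"
  show "left_line q j = w" unfolding left_line_def
  proof (rule Greatest_equality)
    fix y assume y: "y < j \<and> (y = 0 \<or> q y < q j)"
    show "y \<le> w"
    proof (rule ccontr)
      assume "\<not> y \<le> w"
      then have "q j < q y" "y \<noteq> 0" using w y by auto
      then show False using y by auto
    qed
  qed (use w in auto)
qed

lemma right_line_iff:
  assumes q: "inj_on q {1..n}" and j: "j \<in> {1..n}"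
  shows "right_line n q j = w \<longleftrightarrow> j \<le> w \<and> w \<le> n \<and> (w = n \<or> q j < q (w + 1)) \<and> (\<forall>v. j < v \<and> v \<le> w \<longrightarrow> q v < q j)"
proof
  let ?P = "\<lambda>w. j \<le> w \<and> (w = n \<or> q j < q (w + 1))"
  assume w: "right_line n q j = w"
  have P: "?P n" using j by auto
  then have "?P w" unfolding w[symmetric] right_line_def by (rule LeastI)
  moreover have "w \<le> n" unfolding w[symmetric] right_line_def using P by (rule Least_le)
  moreover have "q v < q j" if "j < v" "v \<le> w" for v
  proof -
    have "\<not> ?P (v - 1)"
      using not_less_Least[of "v - 1" ?P] that unfolding w[symmetric] right_line_def by auto
    moreover have "q v \<noteq> q j" using inj_onD[OF q, of v j] that j \<open>w \<le> n\<close> by auto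
    ultimately show ?thesis using that by auto
  qed
  ultimately show "j \<le> w \<and> w \<le> n \<and> (w = n \<or> q j < q (w + 1)) \<and> (\<forall>v. j < v \<and> v \<le> w \<longrightarrow> q v < q j)" by blast
next
  assume w: "j \<le> w \<and> w \<le> n \<and> (w = n \<or> q j < q (w + 1)) \<and> (\<forall>v. j < v \<and> v \<le> w \<longrightarrow> q v < q j)"
  show "right_line n q j = w" unfolding right_line_def
  proof (rule Least_equality)
    fix y assume y: "j \<le> y \<and> (y = n \<or> q j < q (y + 1))"
    show "w \<le> y"
    proof (rule ccontr)
      assume "\<not> w \<le> y"
      then have "q (y + 1) < q j" "y \<noteq> n" using w y by auto
      then show False using y by auto
    qed
  qed (use w in auto)
qed

lemma bottom_line_iff:
  assumes q: "inj_on q {1..n}" and j: "j \<in> {1..n}"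
  shows "bottom_line n q j = w \<longleftrightarrow>
    j < w \<and> w \<le> n + 1 \<and> (w = n + 1 \<or> q w < q j) \<and> (\<forall>v. j < v \<and> v < w \<longrightarrow> q j < q v)"
proof -
  have "inj_on (\<lambda>i. - q i) {1..n}" by (rule inj_onI) (rule inj_onD[OF q], simp_all)
  note R = right_line_iff[OF this j]
  have "bottom_line n q j = w \<longleftrightarrow> 1 \<le> w \<and> right_line n (\<lambda>i. - q i) j = w - 1"
    unfolding bottom_line_def by linarith
  then show ?thesis unfolding R using j by (cases w) (simp_all add: less_Suc_eq_le)
qed

lemma top_line_iff:
  assumes q: "inj_on q {1..n}" and j: "j \<in> {1..n}"
  shows "top_line q j = w \<longleftrightarrow> 1 \<le> w \<and> w \<le> j \<and> (w = 1 \<or> q j < q (w - 1)) \<and> (\<forall>v. w \<le> v \<and> v < j \<longrightarrow> q v < q j)"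
proof -
  have "inj_on (\<lambda>i. - q i) {1..n}" by (rule inj_onI) (rule inj_onD[OF q], simp_all)
  note L = left_line_iff[OF this j]
  have "top_line q j = w \<longleftrightarrow> 1 \<le> w \<and> left_line (\<lambda>i. - q i) j = w - 1"
    unfolding top_line_def by linarith
  then show ?thesis unfolding L by (cases w) (simp_all add: Suc_le_eq)
qed

section \<open>Reflection of the labels\<close>

definition reflect :: "nat \<Rightarrow> (nat \<Rightarrow> 'a) \<Rightarrow> nat \<Rightarrow> 'a" where
  "reflect n f j = f (n + 1 - j)"

lemma inj_on_reflect: "inj_on q {1..n} \<Longrightarrow> inj_on (reflect n q) {1..n}"
  unfolding reflect_def
proof (rule inj_onI)
  fix x y assume "inj_on q {1..n}" "x \<in> {1..n}" "y \<in> {1..n}" "q (n + 1 - x) = q (n + 1 - y)"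
  then have "n + 1 - x = n + 1 - y" by (intro inj_onD[of q "{1..n}"]) auto
  then show "x = y" using \<open>x \<in> {1..n}\<close> \<open>y \<in> {1..n}\<close> by auto
qed

text \<open>Reflection in x = y maps the diagonal cell of \<open>j\<close> to that of
  \<open>n + 1 - j\<close> and keeps the insertion times. Vertical line \<open>w\<close> becomes
  horizontal line \<open>n + 1 - w\<close> and vice versa.\<close>

lemma reflect_lines:
  assumes q: "inj_on q {1..n}" and j: "j \<in> {1..n}"
  shows "left_line (reflect n q) (n + 1 - j) = n + 1 - bottom_line n q j"
    and "right_line n (reflect n q) (n + 1 - j) = n + 1 - top_line q j"
    and "bottom_line n (reflect n q) (n + 1 - j) = n + 1 - left_line q j"
    and "top_line (reflect n q) (n + 1 - j) = n + 1 - right_line n q j"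
proof -
  have j': "n + 1 - j \<in> {1..n}" using j by auto
  note q' = inj_on_reflect[OF q]
  have r: "reflect n q v = q (n + 1 - v)" for v by (simp add: reflect_def)
  have j1: "n + 1 - (n + 1 - j) = j" using j by simp
  define B where "B = bottom_line n q j"
  have B: "j < B" "B \<le> n + 1" "B = n + 1 \<or> q B < q j" "\<And>v. j < v \<Longrightarrow> v < B \<Longrightarrow> q j < q v"
    using bottom_line_iff[OF q j, of B] B_def by auto
  have "q j < q (n + 1 - v)" if "n + 1 - B < v" "v < n + 1 - j" for v by (rule B(4)) (use that in auto)
  moreover have "n + 1 - (n + 1 - B) = B" using B by simp
  ultimately show "left_line (reflect n q) (n + 1 - j) = n + 1 - bottom_line n q j"
    unfolding left_line_iff[OF q' j'] r j1 B_def[symmetric] using B by auto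
  define T where "T = top_line q j"
  have T: "1 \<le> T" "T \<le> j" "T = 1 \<or> q j < q (T - 1)" "\<And>v. T \<le> v \<Longrightarrow> v < j \<Longrightarrow> q v < q j"
    using top_line_iff[OF q j, of T] T_def by auto
  have "q (n + 1 - v) < q j" if "n + 1 - j < v" "v \<le> n + 1 - T" for v by (rule T(4)) (use that in auto)
  moreover have "n + 1 - (n + 1 - T + 1) = T - 1" using T j by simp
  ultimately show "right_line n (reflect n q) (n + 1 - j) = n + 1 - top_line q j"
    unfolding right_line_iff[OF q' j'] r j1 T_def[symmetric] using T j by auto
  define L where "L = left_line q j"
  have L: "L < j" "L = 0 \<or> q L < q j" "\<And>v. L < v \<Longrightarrow> v < j \<Longrightarrow> q j < q v"
    using left_line_iff[OF q j, of L] L_def by auto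
  have "q j < q (n + 1 - v)" if "n + 1 - j < v" "v < n + 1 - L" for v by (rule L(3)) (use that in auto)
  moreover have "n + 1 - (n + 1 - L) = L" using L j by simp
  ultimately show "bottom_line n (reflect n q) (n + 1 - j) = n + 1 - left_line q j"
    unfolding bottom_line_iff[OF q' j'] r j1 L_def[symmetric] using L j by auto
  define R where "R = right_line n q j"
  have R: "j \<le> R" "R \<le> n" "R = n \<or> q j < q (R + 1)" "\<And>v. j < v \<Longrightarrow> v \<le> R \<Longrightarrow> q v < q j"
    using right_line_iff[OF q j, of R] R_def by auto
  have "q (n + 1 - v) < q j" if "n + 1 - R \<le> v" "v < n + 1 - j" for v by (rule R(4)) (use that in auto)
  moreover have "n + 1 - (n + 1 - R - 1) = R + 1" if "R \<noteq> n" using R that by simp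
  ultimately show "top_line (reflect n q) (n + 1 - j) = n + 1 - right_line n q j"
    unfolding top_line_iff[OF q' j'] r j1 R_def[symmetric] using R j by auto
qed

section \<open>Chains of labels and cuts\<close>

definition left_of :: "nat \<Rightarrow> (nat \<Rightarrow> int) \<Rightarrow> nat \<Rightarrow> nat \<Rightarrow> bool" where
  "left_of n q i j \<longleftrightarrow> i \<in> {1..n} \<and> j \<in> {1..n} \<and> right_line n q i = left_line q j"

definition below_of :: "nat \<Rightarrow> (nat \<Rightarrow> int) \<Rightarrow> nat \<Rightarrow> nat \<Rightarrow> bool" where
  "below_of n q i j \<longleftrightarrow> i \<in> {1..n} \<and> j \<in> {1..n} \<and> top_line q i = bottom_line n q j"

lemma below_of_reflect:
  assumes q: "inj_on q {1..n}" and ij: "i \<in> {1..n}" "j \<in> {1..n}"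
  shows "below_of n q i j \<longleftrightarrow> left_of n (reflect n q) (n + 1 - i) (n + 1 - j)"
proof -
  \<comment> \<open>These bounds allow cancelling the truncated subtraction from
    \<open>n + 1\<close>.\<close>
  have "top_line q i \<le> i" "bottom_line n q j \<le> n + 1"
    using top_line_iff[OF q ij(1), of "top_line q i"] bottom_line_iff[OF q ij(2), of "bottom_line n q j"] by simp_all
  moreover have "n + 1 - i \<in> {1..n}" "n + 1 - j \<in> {1..n}" "i \<le> n" using ij by auto
  ultimately show ?thesis
    unfolding below_of_def left_of_def reflect_lines(2)[OF q ij(1)] reflect_lines(1)[OF q ij(2)]
    using ij by (simp del: atLeastAtMost_iff) linarith
qed

lemma rtranclp_below_of_reflect:
  assumes q: "inj_on q {1..n}" and ij: "i \<in> {1..n}" "j \<in> {1..n}"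
  shows "(below_of n q)\<^sup>*\<^sup>* i j \<longleftrightarrow> (left_of n (reflect n q))\<^sup>*\<^sup>* (n + 1 - i) (n + 1 - j)"
proof
  show "(below_of n q)\<^sup>*\<^sup>* i j \<Longrightarrow> (left_of n (reflect n q))\<^sup>*\<^sup>* (n + 1 - i) (n + 1 - j)"
  proof (induction rule: rtranclp_induct)
    case (step y z)
    then have "left_of n (reflect n q) (n + 1 - y) (n + 1 - z)"
      using below_of_reflect[OF q, of y z] unfolding below_of_def by blast
    with step.IH show ?case by (rule rtranclp.rtrancl_into_rtrancl)
  qed simp
next
  have "(left_of n (reflect n q))\<^sup>*\<^sup>* a b \<Longrightarrow> (below_of n q)\<^sup>*\<^sup>* (n + 1 - a) (n + 1 - b)" for a b
  proof (induction rule: rtranclp_induct)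
    case (step y z)
    then have yz: "y \<in> {1..n}" "z \<in> {1..n}" by (auto simp: left_of_def)
    then have "n + 1 - y \<in> {1..n}" "n + 1 - z \<in> {1..n}" by auto
    moreover have "n + 1 - (n + 1 - y) = y" "n + 1 - (n + 1 - z) = z" using yz by auto
    ultimately have "below_of n q (n + 1 - y) (n + 1 - z)"
      using below_of_reflect[OF q, of "n + 1 - y" "n + 1 - z"] step.hyps(2) by (simp only:)
    with step.IH show ?case by (rule rtranclp.rtrancl_into_rtrancl)
  qed simp
  from this[of "n + 1 - i" "n + 1 - j"] ij
  show "(left_of n (reflect n q))\<^sup>*\<^sup>* (n + 1 - i) (n + 1 - j) \<Longrightarrow> (below_of n q)\<^sup>*\<^sup>* i j" by auto
qed

text \<open>A step from \<open>i\<close> to \<open>j\<close> crosses a line \<open>w\<close> with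
  \<open>i \<le> w < j\<close>, so chains increase both the labels and the lines crossed.\<close>

lemma left_of_less:
  assumes q: "inj_on q {1..n}" and "(left_of n q)\<^sup>*\<^sup>* i j" "i \<noteq> j"
  shows "i \<in> {1..n}" "j \<in> {1..n}" "right_line n q i \<le> left_line q j" "i < j"
proof -
  have "i \<noteq> j \<longrightarrow> i \<in> {1..n} \<and> j \<in> {1..n} \<and> right_line n q i \<le> left_line q j"
    using assms(2)
  proof (induction rule: rtranclp_induct)
    case (step y z)
    then have yz: "y \<in> {1..n}" "z \<in> {1..n}" "right_line n q y = left_line q z" by (auto simp: left_of_def)
    have "left_line q y < y" "y \<le> right_line n q y"
      using left_line_iff[OF q yz(1)] right_line_iff[OF q yz(1)] by blast+
    then show ?case using step yz by (cases "i = y") auto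
  qed simp
  then show ij: "i \<in> {1..n}" "j \<in> {1..n}" "right_line n q i \<le> left_line q j" using assms(3) by auto
  have "i \<le> right_line n q i" "left_line q j < j"
    using left_line_iff[OF q ij(2)] right_line_iff[OF q ij(1)] by blast+
  then show "i < j" using ij by simp
qed

text \<open>Negating \<open>q\<close> and reversing the labels both exchange the two conditions of a
  cut; the part \<open>{k+1..u}\<close> becomes the initial one, which turns \<open>k\<close> into
  \<open>n - k\<close>.\<close>

lemma vcut_reflect:
  assumes "1 \<le> l" "u \<le> n"
  shows "vcut (\<lambda>i. - q i) l u k \<longleftrightarrow> k < n \<and> vcut (reflect n q) (n + 1 - u) (n + 1 - l) (n - k)"
proof
  assume c: "vcut (\<lambda>i. - q i) l u k"
  then have k: "l \<le> k" "k < u" by (auto simp: vcut_def)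
  have "reflect n q i < reflect n q (n - k + 1)" if "i \<in> {n + 1 - u..n - k}" for i
  proof -
    have "n + 1 - i \<in> {k+1..u}" using that k assms by auto
    then have "q (n + 1 - i) < q k" using c unfolding vcut_def by auto
    then show ?thesis using k assms by (simp add: reflect_def)
  qed
  moreover have "reflect n q (n - k) < reflect n q j" if "j \<in> {n - k + 1..n + 1 - l}" for j
  proof -
    have "n + 1 - j \<in> {l..k}" using that k assms by auto
    then have "q (k + 1) < q (n + 1 - j)" using c unfolding vcut_def by auto
    then show ?thesis using k assms by (simp add: reflect_def Suc_diff_le)
  qed
  ultimately show "k < n \<and> vcut (reflect n q) (n + 1 - u) (n + 1 - l) (n - k)"
    using k assms by (auto simp: vcut_def)
next
  assume k: "k < n \<and> vcut (reflect n q) (n + 1 - u) (n + 1 - l) (n - k)"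
  have "q (k + 1) < q i" if "l \<le> i" "i \<le> k" for i
  proof -
    have "n + 1 - i \<in> {n - k + 1..n + 1 - l}" using that k assms by auto
    then have "reflect n q (n - k) < reflect n q (n + 1 - i)"
      using k unfolding vcut_def by blast
    then show ?thesis using that k by (simp add: reflect_def Suc_diff_le)
  qed
  moreover have "q i < q k" if "k < i" "i \<le> u" for i
  proof -
    have "n + 1 - i \<in> {n + 1 - u..n - k}" using that k assms by auto
    then have "reflect n q (n + 1 - i) < reflect n q (n - k + 1)"
      using k unfolding vcut_def by blast
    then show ?thesis using that k assms by (simp add: reflect_def Suc_diff_le)
  qed
  ultimately show "vcut (\<lambda>i. - q i) l u k" using k assms by (auto simp: vcut_def)
qed

text \<open>If \<open>w\<close> is the right line of \<open>i\<close> and lies before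
  \<open>k\<close>, the label \<open>w + 1\<close> is one step away, because
  \<open>q w \<le> q i < q (w + 1)\<close>; the cut prevents \<open>w\<close> from exceeding
  \<open>k\<close>. In the other direction, the left line \<open>w > k\<close> of \<open>j\<close>
  yields the predecessor \<open>w\<close>. Both walks end at line \<open>k\<close>.\<close>

lemma vcut_left_of:
  assumes q: "inj_on q {1..n}" and lu: "1 \<le> l" "u \<le> n" and c: "vcut q l u k"
    and i: "i \<in> {l..k}" and j: "j \<in> {k+1..u}"
  shows "(left_of n q)\<^sup>*\<^sup>* i j"
proof -
  have k: "l \<le> k" "k < u" using c by (auto simp: vcut_def)
  have 1: "\<exists>i0\<in>{l..k}. (left_of n q)\<^sup>*\<^sup>* i i0 \<and> right_line n q i0 = k" if "i \<in> {l..k}" for i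
    using that
  proof (induction "k - i" arbitrary: i rule: less_induct)
    case less
    define w where "w = right_line n q i"
    have i: "i \<in> {1..n}" using less.prems lu k by auto
    have w: "i \<le> w" "w \<le> n" "w = n \<or> q i < q (w + 1)" "\<And>v. i < v \<Longrightarrow> v \<le> w \<Longrightarrow> q v < q i"
      using right_line_iff[OF q i, of w] w_def by auto
    have "q i < q (k + 1)" using c less.prems by (auto simp: vcut_def)
    then have "w \<le> k" using w(4)[of "k + 1"] less.prems by force
    show ?case
    proof (cases "w = k")
      case True
      then show ?thesis using less.prems w_def by blast
    next
      case False
      then have wk: "w < k" using \<open>w \<le> k\<close> by simp
      then have "q i < q (w + 1)" using w k lu by auto
      moreover have "q w \<le> q i" using w(4)[of w] w(1) by (cases "i = w") auto
      moreover have w1: "w + 1 \<in> {1..n}" using wk k lu by auto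
      ultimately have "left_line q (w + 1) = w" by (subst left_line_iff[OF q w1]) auto
      then have "left_of n q i (w + 1)" using i w1 w_def by (simp add: left_of_def)
      moreover have "w + 1 \<in> {l..k}" "k - (w + 1) < k - i" using wk w(1) less.prems by auto
      from less.hyps[OF this(2,1)]
      obtain i0 where "i0 \<in> {l..k}" "(left_of n q)\<^sup>*\<^sup>* (w + 1) i0" "right_line n q i0 = k" by blast
      ultimately show ?thesis by (blast intro: converse_rtranclp_into_rtranclp)
    qed
  qed
  have 2: "\<exists>j0\<in>{k+1..u}. (left_of n q)\<^sup>*\<^sup>* j0 j \<and> left_line q j0 = k" if "j \<in> {k+1..u}" for j
    using that
  proof (induction "j - k" arbitrary: j rule: less_induct)
    case less
    define w where "w = left_line q j"
    have j: "j \<in> {1..n}" using less.prems lu k by auto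
    have w: "w < j" "w = 0 \<or> q w < q j" "\<And>v. w < v \<Longrightarrow> v < j \<Longrightarrow> q j < q v"
      using left_line_iff[OF q j, of w] w_def by auto
    have "q k < q j" using c less.prems by (auto simp: vcut_def)
    then have "k \<le> w" using w(3)[of k] less.prems by force
    show ?case
    proof (cases "w = k")
      case True
      then show ?thesis using less.prems w_def by blast
    next
      case False
      then have wk: "k < w" using \<open>k \<le> w\<close> by simp
      then have "q w < q j" using w by auto
      moreover have "q j \<le> q (w + 1)" using w(3)[of "w + 1"] w(1) by (cases "j = w + 1") auto
      moreover have w1: "w \<in> {1..n}" using wk j w by auto
      ultimately have "right_line n q w = w" by (subst right_line_iff[OF q w1]) (use w1 in auto)
      then have "left_of n q w j" using j w1 w_def by (simp add: left_of_def)
      moreover have "w \<in> {k+1..u}" "w - k < j - k" using wk w(1) less.prems by auto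
      from less.hyps[OF this(2,1)]
      obtain j0 where "j0 \<in> {k+1..u}" "(left_of n q)\<^sup>*\<^sup>* j0 w" "left_line q j0 = k" by blast
      ultimately show ?thesis by (blast intro: rtranclp.rtrancl_into_rtrancl)
    qed
  qed
  obtain i0 where i0: "i0 \<in> {l..k}" "(left_of n q)\<^sup>*\<^sup>* i i0" "right_line n q i0 = k" using 1[OF i] by blast
  obtain j0 where j0: "j0 \<in> {k+1..u}" "(left_of n q)\<^sup>*\<^sup>* j0 j" "left_line q j0 = k" using 2[OF j] by blast
  have "left_of n q i0 j0" using i0 j0 lu k by (auto simp: left_of_def)
  then show ?thesis using i0(2) j0(2)
    by (blast intro: rtranclp.rtrancl_into_rtrancl rtranclp_trans)
qed

text \<open>The chain from \<open>i\<close> to \<open>k + 1\<close> bounds the right line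
  \<open>w\<close> of \<open>i\<close> by \<open>k\<close>; then \<open>q i < q (w + 1)\<close>, and
  iterating climbs to \<open>q (k + 1)\<close>. The chain from \<open>k\<close> to \<open>j\<close>
  is used in the same way.\<close>

lemma left_of_vcut:
  assumes q: "inj_on q {1..n}" and lu: "1 \<le> l" "u \<le> n" "l \<le> k" "k < u"
    and L: "\<And>i j. i \<in> {l..k} \<Longrightarrow> j \<in> {k+1..u} \<Longrightarrow> (left_of n q)\<^sup>*\<^sup>* i j"
  shows "vcut q l u k"
proof -
  have "q i < q (k + 1)" if "i \<in> {l..k}" for i
    using that
  proof (induction "k - i" arbitrary: i rule: less_induct)
    case less
    define w where "w = right_line n q i"
    have i: "i \<in> {1..n}" and k1: "k + 1 \<in> {1..n}" using less.prems lu by auto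
    have w: "i \<le> w" "w = n \<or> q i < q (w + 1)"
      using right_line_iff[OF q i, of w] w_def by auto
    have "w \<le> left_line q (k + 1)"
      unfolding w_def using left_of_less(3)[OF q L[of i "k + 1"]] less.prems lu by auto
    moreover have "left_line q (k + 1) < k + 1" using left_line_iff[OF q k1] by blast
    ultimately have "w \<le> k" by simp
    then have iw: "q i < q (w + 1)" using w lu by auto
    show ?case
    proof (cases "w = k")
      case False
      then have "q (w + 1) < q (k + 1)" using less.hyps[of "w + 1"] less.prems w(1) \<open>w \<le> k\<close> by auto
      then show ?thesis using iw by simp
    qed (use iw in simp)
  qed
  moreover have "q k < q j" if "j \<in> {k+1..u}" for j
    using that
  proof (induction "j - k" arbitrary: j rule: less_induct)
    case less
    define w where "w = left_line q j"
    have j: "j \<in> {1..n}" and k1: "k \<in> {1..n}" using less.prems lu by auto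
    have w: "w < j" "w = 0 \<or> q w < q j"
      using left_line_iff[OF q j, of w] w_def by auto
    have "right_line n q k \<le> w"
      unfolding w_def using left_of_less(3)[OF q L[of k j]] less.prems lu by auto
    moreover have "k \<le> right_line n q k" using right_line_iff[OF q k1] by blast
    ultimately have "k \<le> w" by simp
    then have jw: "q w < q j" using w lu by auto
    show ?case
    proof (cases "w = k")
      case False
      then have "q k < q w" using less.hyps[of w] less.prems w(1) \<open>k \<le> w\<close> by auto
      then show ?thesis using jw by simp
    qed (use jw in simp)
  qed
  ultimately show ?thesis using lu by (auto simp: vcut_def)
qed

lemma interval_union_ordered:
  fixes l u :: nat
  assumes "A1 \<union> A2 = {l..u}" "A1 \<noteq> {}" "A2 \<noteq> {}" and lt: "\<And>a b. a \<in> A1 \<Longrightarrow> b \<in> A2 \<Longrightarrow> a < b"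
  obtains k where "l \<le> k" "k < u" "A1 = {l..k}" "A2 = {k+1..u}"
proof -
  have fin: "finite A1" using assms(1) by (metis finite_Un finite_atLeastAtMost)
  define k where "k = Max A1"
  have k: "k \<in> A1" "\<And>a. a \<in> A1 \<Longrightarrow> a \<le> k" using fin assms(2) by (simp_all add: k_def)
  obtain b where b: "b \<in> A2" using assms(3) by blast
  have A: "A1 \<subseteq> {l..u}" "A2 \<subseteq> {l..u}" using assms(1) by auto
  have "A1 = {l..k}"
  proof
    show "{l..k} \<subseteq> A1"
    proof
      fix x assume x: "x \<in> {l..k}"
      then have "x \<in> A1 \<union> A2" using assms(1) k(1) A by auto
      moreover have "x \<notin> A2" using lt[OF k(1), of x] x by auto
      ultimately show "x \<in> A1" by blast
    qed
  qed (use A k in auto)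
  moreover have "A2 = {k+1..u}"
  proof
    show "{k+1..u} \<subseteq> A2"
    proof
      fix x assume x: "x \<in> {k+1..u}"
      then have "x \<in> A1 \<union> A2" using assms(1) k(1) A by auto
      moreover have "x \<notin> A1" using k(2)[of x] x by auto
      ultimately show "x \<in> A2" by blast
    qed
    show "A2 \<subseteq> {k+1..u}" using A lt[OF k(1)] by fastforce
  qed
  moreover have "l \<le> k" "k < u" using k(1) A lt[OF k(1) b] b by auto
  ultimately show ?thesis using that by blast
qed

theorem interval_sep_iff_separable:
  assumes q: "inj_on q {1..n}" and "1 \<le> l" "l \<le> u" "u \<le> n"
  shows "interval_sep q l u \<longleftrightarrow> separable (left_of n q)\<^sup>*\<^sup>* (below_of n q)\<^sup>*\<^sup>* {l..u}"
proof
  assume "interval_sep q l u"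
  then show "separable (left_of n q)\<^sup>*\<^sup>* (below_of n q)\<^sup>*\<^sup>* {l..u}"
    using assms(2,4)
  proof (induction rule: interval_sep.induct)
    case (single l)
    then show ?case by (simp add: separable.single)
  next
    case (cut l u k)
    have k: "l \<le> k" "k < u" using cut.hyps(1) by (auto simp: vcut_def)
    have S: "separable (left_of n q)\<^sup>*\<^sup>* (below_of n q)\<^sup>*\<^sup>* {l..k}"
      "separable (left_of n q)\<^sup>*\<^sup>* (below_of n q)\<^sup>*\<^sup>* {k+1..u}"
      using cut k by auto
    from cut.hyps(1) show ?case
    proof
      assume c: "vcut q l u k"
      have "separable (left_of n q)\<^sup>*\<^sup>* (below_of n q)\<^sup>*\<^sup>* ({l..k} \<union> {k+1..u})"
        using S vcut_left_of[OF q cut.prems c] by (intro separable.left) auto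
      moreover have "{l..k} \<union> {k+1..u} = {l..u}" using k by auto
      ultimately show ?thesis by simp
    next
      assume "vcut (\<lambda>i. - q i) l u k"
      then have c: "vcut (reflect n q) (n + 1 - u) (n + 1 - l) (n - k)" using vcut_reflect cut.prems by blast
      have "(below_of n q)\<^sup>*\<^sup>* a b" if "a \<in> {k+1..u}" "b \<in> {l..k}" for a b
      proof -
        have ab: "a \<in> {1..n}" "b \<in> {1..n}" using that cut.prems k by auto
        show ?thesis unfolding rtranclp_below_of_reflect[OF q ab]
          by (rule vcut_left_of[OF inj_on_reflect[OF q] _ _ c]) (use that cut.prems k in auto)
      qed
      then have "separable (left_of n q)\<^sup>*\<^sup>* (below_of n q)\<^sup>*\<^sup>* ({k+1..u} \<union> {l..k})"
        using S by (intro separable.below) auto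
      moreover have "{k+1..u} \<union> {l..k} = {l..u}" using k by auto
      ultimately show ?thesis by simp
    qed
  qed
next
  assume "separable (left_of n q)\<^sup>*\<^sup>* (below_of n q)\<^sup>*\<^sup>* {l..u}"
  then show "interval_sep q l u"
    using assms(2-4)
  proof (induction "{l..u}" arbitrary: l u rule: separable.induct)
    case (single a)
    then have "l = a" "u = a" by (auto simp: set_eq_iff)
    then show ?case by (simp add: interval_sep.single)
  next
    case (left A1 A2)
    have ne: "A1 \<noteq> {}" "A2 \<noteq> {}" using left.hyps separable_nonempty by blast+
    have "a < b" if "a \<in> A1" "b \<in> A2" for a b
      using left_of_less(4)[OF q] left.hyps that by blast
    then obtain k where k: "l \<le> k" "k < u" "A1 = {l..k}" "A2 = {k+1..u}"
      using interval_union_ordered[OF left.hyps(7) ne] by metis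
    have "vcut q l u k"
      by (rule left_of_vcut[OF q]) (use k left.hyps left.prems in auto)
    then show ?case using left.hyps(2)[of l k] left.hyps(4)[of "k + 1" u] k left.prems
      by (intro interval_sep.cut[of q l u k]) auto
  next
    case (below A1 A2)
    have ne: "A1 \<noteq> {}" "A2 \<noteq> {}" using below.hyps separable_nonempty by blast+
    have "A1 \<union> A2 \<subseteq> {1..n}" unfolding below.hyps(7) using below.prems by auto
    then have sub: "A1 \<subseteq> {1..n}" "A2 \<subseteq> {1..n}" by auto
    have B: "(left_of n (reflect n q))\<^sup>*\<^sup>* (n + 1 - a) (n + 1 - b)" if "a \<in> A1" "b \<in> A2" for a b
      using rtranclp_below_of_reflect[OF q, of a b] below.hyps(6) that sub by blast
    \<comment> \<open>Below runs against the order of the labels, so here \<open>A2\<close> is the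
      initial segment.\<close>
    have "b < a" if "a \<in> A1" "b \<in> A2" for a b
    proof -
      have "a \<in> {1..n}" "b \<in> {1..n}" "a \<noteq> b" using that sub below.hyps(5) by blast+
      then have "n + 1 - a \<noteq> n + 1 - b" by auto
      then show ?thesis using left_of_less(4)[OF inj_on_reflect[OF q] B[OF that]] by linarith
    qed
    then obtain k where k: "l \<le> k" "k < u" "A2 = {l..k}" "A1 = {k+1..u}"
      using interval_union_ordered[of A2 A1 l u] below.hyps(7) ne by (metis Un_commute)
    have "vcut (reflect n q) (n + 1 - u) (n + 1 - l) (n - k)"
    proof (rule left_of_vcut[OF inj_on_reflect[OF q]])
      fix i j assume ij: "i \<in> {n + 1 - u..n - k}" "j \<in> {n - k + 1..n + 1 - l}"
      then have "n + 1 - i \<in> A1" "n + 1 - j \<in> A2" using k below.prems by auto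
      from B[OF this] show "(left_of n (reflect n q))\<^sup>*\<^sup>* i j" using ij below.prems by auto
    qed (use k below.prems in auto)
    then have "vcut (\<lambda>i. - q i) l u k" using vcut_reflect[of l u n q k] k below.prems by auto
    then show ?case using below.hyps(4)[of l k] below.hyps(2)[of "k + 1" u] k below.prems
      by (intro interval_sep.cut[of q l u k]) auto
  qed
qed

section \<open>The staircase\<close>

abbreviation rect_at :: "state \<Rightarrow> nat \<Rightarrow> rect" where
  "rect_at st p \<equiv> the (snd st p)"

text \<open>Left and bottom sides are left out so that the inserted tiles partition the region under
  the staircase exactly, without common boundary points.\<close>

definition half_open :: "rect \<Rightarrow> (real \<times> real) set" where
  "half_open r = {xmin r<..xmax r} \<times> {ymin r<..ymax r}"

definition under_staircase :: "state \<Rightarrow> (real \<times> real) set" where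
  "under_staircase st = {(x, y). 0 < x \<and> 0 < y \<and> (\<exists>p\<in>fst st. x \<le> xmax (rect_at st p) \<and> y \<le> ymax (rect_at st p))}"

text \<open>\<open>T\<close> is the set of labels inserted so far. Each of its maximal runs of consecutive labels
  contains exactly one peak, and \<open>X\<close> and \<open>Y\<close> map the end and the start of the run to the
  coordinates of that peak.\<close>

definition staircase :: "nat \<Rightarrow> (nat \<Rightarrow> real) \<Rightarrow> (nat \<Rightarrow> real) \<Rightarrow> nat set \<Rightarrow> state \<Rightarrow> bool" where
  "staircase n X Y T st \<longleftrightarrow>
     dom (snd st) = T \<and> fst st \<subseteq> T \<and>
     (\<forall>p\<in>fst st. \<forall>p'\<in>fst st. p < p' \<longrightarrow> \<not> {p..p'} \<subseteq> T) \<and>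
     (\<forall>v\<in>T. \<exists>p\<in>fst st. {v..p} \<subseteq> T \<and> {p..v} \<subseteq> T) \<and>
     (\<forall>p\<in>fst st. \<forall>w\<ge>p. {p..w} \<subseteq> T \<and> w + 1 \<notin> T \<longrightarrow> xmax (rect_at st p) = X w) \<and>
     (\<forall>p\<in>fst st. \<forall>u\<le>p. {u..p} \<subseteq> T \<and> (u = 0 \<or> u - 1 \<notin> T) \<longrightarrow> ymax (rect_at st p) = Y u) \<and>
     (\<forall>p\<in>fst st. \<forall>p'\<in>fst st. p < p' \<longrightarrow>
        xmax (rect_at st p) < xmax (rect_at st p') \<and> ymax (rect_at st p') < ymax (rect_at st p)) \<and>
     (\<forall>p\<in>fst st. 0 \<le> xmax (rect_at st p) \<and> xmax (rect_at st p) \<le> n \<and>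
        0 \<le> ymax (rect_at st p) \<and> ymax (rect_at st p) \<le> n)"

lemma staircaseD:
  assumes "staircase n X Y T st"
  shows "dom (snd st) = T" "fst st \<subseteq> T"
    "\<forall>p\<in>fst st. \<forall>p'\<in>fst st. p < p' \<longrightarrow> \<not> {p..p'} \<subseteq> T"
    "\<forall>v\<in>T. \<exists>p\<in>fst st. {v..p} \<subseteq> T \<and> {p..v} \<subseteq> T"
    "\<forall>p\<in>fst st. \<forall>w\<ge>p. {p..w} \<subseteq> T \<and> w + 1 \<notin> T \<longrightarrow> xmax (rect_at st p) = X w"
    "\<forall>p\<in>fst st. \<forall>u\<le>p. {u..p} \<subseteq> T \<and> (u = 0 \<or> u - 1 \<notin> T) \<longrightarrow> ymax (rect_at st p) = Y u"
    "\<forall>p\<in>fst st. \<forall>p'\<in>fst st. p < p' \<longrightarrow>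
        xmax (rect_at st p) < xmax (rect_at st p') \<and> ymax (rect_at st p') < ymax (rect_at st p)"
    "\<forall>p\<in>fst st. 0 \<le> xmax (rect_at st p) \<and> xmax (rect_at st p) \<le> n \<and>
        0 \<le> ymax (rect_at st p) \<and> ymax (rect_at st p) \<le> n"
  by (insert assms[unfolded staircase_def]; elim conjE; assumption)+

section \<open>One insertion step\<close>

locale insertion =
  fixes n j :: nat and X Y :: "nat \<Rightarrow> real" and T :: "nat set" and st :: state
  assumes T: "{0, n + 1} \<subseteq> T" "T \<subseteq> {0..n + 1}" and j: "j \<notin> T" "j \<le> n"
    and staircase: "staircase n X Y T st"
begin

abbreviation "P \<equiv> fst st"
abbreviation "a \<equiv> prev_peak st j"
abbreviation "b \<equiv> next_peak st j"
abbreviation "R \<equiv> rect_at st"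

lemmas dom_st = staircaseD(1)[OF staircase] and PT = staircaseD(2)[OF staircase]

lemma peaks_separated: "p \<in> P \<Longrightarrow> p' \<in> P \<Longrightarrow> p < p' \<Longrightarrow> \<not> {p..p'} \<subseteq> T"
  using staircaseD(3)[OF staircase] by blast

lemma ex_peak: "v \<in> T \<Longrightarrow> \<exists>p\<in>P. {v..p} \<subseteq> T \<and> {p..v} \<subseteq> T"
  using staircaseD(4)[OF staircase] by blast

lemma peak_X: "p \<in> P \<Longrightarrow> p \<le> w \<Longrightarrow> {p..w} \<subseteq> T \<Longrightarrow> w + 1 \<notin> T \<Longrightarrow> xmax (R p) = X w"
  using staircaseD(5)[OF staircase] by blast

lemma peak_Y: "p \<in> P \<Longrightarrow> u \<le> p \<Longrightarrow> {u..p} \<subseteq> T \<Longrightarrow> u = 0 \<or> u - 1 \<notin> T \<Longrightarrow> ymax (R p) = Y u"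
  using staircaseD(6)[OF staircase] by blast

lemma peaks_mono:
  assumes "p \<in> P" "p' \<in> P" "p < p'"
  shows "xmax (R p) < xmax (R p')" "ymax (R p') < ymax (R p)"
  using staircaseD(7)[OF staircase] assms by blast+

lemma peak_bounds:
  assumes "p \<in> P"
  shows "0 \<le> xmax (R p)" "xmax (R p) \<le> n" "0 \<le> ymax (R p)" "ymax (R p) \<le> n"
  using staircaseD(8)[OF staircase] assms by blast+

lemma finite_P: "finite P"
  using PT T(2) by (meson finite_atLeastAtMost finite_subset)

lemma j_pos: "0 < j"
  using j T by (cases j) auto

lemma ex_lower: "\<exists>p\<in>P. p < j \<and> {w..p} \<subseteq> T \<and> {p..w} \<subseteq> T" if w: "w \<in> T" "w < j"
proof -
  obtain p where p: "p \<in> P" "{w..p} \<subseteq> T" "{p..w} \<subseteq> T" using ex_peak[OF w(1)] by blast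
  have "j \<notin> {w..p}" using p(2) j by blast
  then show ?thesis using p w by (intro bexI[of _ p]) auto
qed

lemma ex_upper: "\<exists>p\<in>P. j < p \<and> {u..p} \<subseteq> T \<and> {p..u} \<subseteq> T" if u: "u \<in> T" "j < u"
proof -
  obtain p where p: "p \<in> P" "{u..p} \<subseteq> T" "{p..u} \<subseteq> T" using ex_peak[OF u(1)] by blast
  have "j \<notin> {p..u}" using p(3) j by blast
  then show ?thesis using p u by (intro bexI[of _ p]) auto
qed

lemma a_props: "a \<in> P" "a < j" "\<And>p. p \<in> P \<Longrightarrow> p < j \<Longrightarrow> p \<le> a"
proof -
  let ?A = "{p \<in> P. p < j}"
  have fin: "finite ?A" using finite_P by simp
  have "0 \<in> T" using T by simp
  from ex_lower[OF this j_pos] have "?A \<noteq> {}" by blast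
  then have "a \<in> ?A" unfolding prev_peak_def using fin by (rule Max_in[rotated])
  then show "a \<in> P" "a < j" by auto
  show "p \<le> a" if "p \<in> P" "p < j" for p unfolding prev_peak_def using fin that by (intro Max_ge) auto
qed

lemma b_props: "b \<in> P" "j < b" "\<And>p. p \<in> P \<Longrightarrow> j < p \<Longrightarrow> b \<le> p"
proof -
  let ?A = "{p \<in> P. j < p}"
  have fin: "finite ?A" using finite_P by simp
  have "n + 1 \<in> T" "j < n + 1" using T j by simp_all
  from ex_upper[OF this] have "?A \<noteq> {}" by blast
  then have "b \<in> ?A" unfolding next_peak_def using fin by (rule Min_in[rotated])
  then show "b \<in> P" "j < b" by auto
  show "b \<le> p" if "p \<in> P" "j < p" for p unfolding next_peak_def using fin that by (intro Min_le) auto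
qed

text \<open>\<open>w\<close> is the last inserted label before \<open>j\<close>. The peak of its run
  must be the previous peak, because a run has only one peak; its abscissa is that of the line at
  which the run ends.\<close>

lemma lower_run: assumes "w \<in> T" "w < j" "\<And>v. w < v \<Longrightarrow> v < j \<Longrightarrow> v \<notin> T"
  shows "a \<le> w" "{a..w} \<subseteq> T" "xmax (R a) = X w"
proof -
  have "a \<in> T" using a_props(1) PT by blast
  then show "a \<le> w" using assms(3)[of a] a_props(2) by force
  obtain p where p: "p \<in> P" "p < j" "{p..w} \<subseteq> T" "{w..p} \<subseteq> T" using ex_lower[OF assms(1,2)] by blast
  have "p \<le> a" using a_props(3) p by blast
  moreover have "\<not> p < a"
  proof
    assume "p < a"
    moreover have "{p..a} \<subseteq> T" using p(3) \<open>a \<le> w\<close> by auto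
    ultimately show False using peaks_separated[OF p(1) a_props(1)] by blast
  qed
  ultimately show "{a..w} \<subseteq> T" using p(3) by (metis le_less)
  then show "xmax (R a) = X w"
    using peak_X[OF a_props(1) \<open>a \<le> w\<close>] assms j by (metis Suc_eq_plus1 less_add_one linorder_neqE_nat not_less_eq)
qed

lemma upper_run: assumes "u \<in> T" "j < u" "\<And>v. j < v \<Longrightarrow> v < u \<Longrightarrow> v \<notin> T"
  shows "u \<le> b" "{u..b} \<subseteq> T" "ymax (R b) = Y u"
proof -
  have "b \<in> T" using b_props(1) PT by blast
  then show "u \<le> b" using assms(3)[of b] b_props(2) by force
  obtain p where p: "p \<in> P" "j < p" "{u..p} \<subseteq> T" "{p..u} \<subseteq> T" using ex_upper[OF assms(1,2)] by blast
  have "b \<le> p" using b_props(3) p by blast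
  moreover have "\<not> b < p"
  proof
    assume "b < p"
    moreover have "{b..p} \<subseteq> T" using p(3) \<open>u \<le> b\<close> by auto
    ultimately show False using peaks_separated[OF b_props(1) p(1)] by blast
  qed
  ultimately show "{u..b} \<subseteq> T" using p(3) by (metis le_less)
  moreover have "u - 1 \<notin> T" using assms j by (cases "u - 1 = j") auto
  ultimately show "ymax (R b) = Y u"
    using peak_Y[OF b_props(1) \<open>u \<le> b\<close>] by blast
qed

text \<open>If \<open>j - 1\<close> is inserted, \<open>a\<close> is the peak of the run ending
  there, so no label between \<open>a\<close> and \<open>j\<close> is missing. A single neighbour
  thus decides alignment.\<close>

lemma top_aligned_iff: "top_aligned st j \<longleftrightarrow> j - 1 \<in> T"
proof
  assume "top_aligned st j"
  then have "{a<..<j} \<subseteq> T" by (simp add: top_aligned_def dom_st)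
  then show "j - 1 \<in> T" using a_props(1,2) PT by (cases "a = j - 1") auto
next
  assume "j - 1 \<in> T"
  then have "{a..j - 1} \<subseteq> T" using lower_run[of "j - 1"] j_pos by auto
  moreover have "{a<..<j} \<subseteq> {a..j - 1}" by auto
  ultimately show "top_aligned st j" unfolding top_aligned_def dom_st by (meson subset_trans)
qed

lemma right_aligned_iff: "right_aligned st j \<longleftrightarrow> j + 1 \<in> T"
proof
  assume "right_aligned st j"
  then have "{j<..<b} \<subseteq> T" by (simp add: right_aligned_def dom_st)
  then show "j + 1 \<in> T" using b_props(1,2) PT by (cases "b = j + 1") auto
next
  assume "j + 1 \<in> T"
  then have "{j + 1..b} \<subseteq> T" using upper_run[of "j + 1"] by auto
  moreover have "{j<..<b} \<subseteq> {j + 1..b}" by auto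
  ultimately show "right_aligned st j" unfolding right_aligned_def dom_st by (meson subset_trans)
qed

lemma peaks_ab: "xmax (R a) < xmax (R b)" "ymax (R b) < ymax (R a)"
  using peaks_mono[OF a_props(1) b_props(1)] a_props(2) b_props(2) by auto

lemma ex_lower_run_end: "\<exists>w. w \<in> T \<and> w < j \<and> (\<forall>v. w < v \<longrightarrow> v < j \<longrightarrow> v \<notin> T)"
proof -
  let ?P = "\<lambda>w. w \<in> T \<and> w < j"
  have "?P (GREATEST w. ?P w)" by (rule GreatestI_nat[where k = 0 and b = j]) (use T j_pos in auto)
  moreover have "v \<notin> T" if "(GREATEST w. ?P w) < v" "v < j" for v
    using Greatest_le_nat[of ?P v j] that by auto
  ultimately show ?thesis by blast
qed

lemma ex_upper_run_start: "\<exists>u. u \<in> T \<and> j < u \<and> (\<forall>v. j < v \<longrightarrow> v < u \<longrightarrow> v \<notin> T)"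
proof -
  let ?P = "\<lambda>w. w \<in> T \<and> j < w"
  have "?P (LEAST w. ?P w)" by (rule LeastI[where k = "n + 1"]) (use T j in auto)
  moreover have "v \<notin> T" if "v < (LEAST w. ?P w)" "j < v" for v
    using not_less_Least[OF that(1)] that(2) by auto
  ultimately show ?thesis by blast
qed

text \<open>\<open>s\<close> is the start of the run of \<open>a\<close>. With grid sizes,
  \<open>s < j\<close> places the peak \<open>a\<close> above the line of \<open>j\<close>.\<close>

lemma ymax_a: "\<exists>s<j. ymax (R a) = Y s"
proof -
  have aT: "a \<in> T" using a_props PT by blast
  define s where "s = (LEAST s. {s..a} \<subseteq> T)"
  have s: "{s..a} \<subseteq> T" unfolding s_def by (rule LeastI[where k = a]) (use aT in simp)
  have sa: "s \<le> a" unfolding s_def by (rule Least_le) (use aT in simp)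
  have "s = 0 \<or> s - 1 \<notin> T"
  proof (rule ccontr)
    assume *: "\<not> (s = 0 \<or> s - 1 \<notin> T)"
    then have "{s - 1..a} \<subseteq> insert (s - 1) {s..a}" by auto
    then have "{s - 1..a} \<subseteq> T" using s * by blast
    then show False using not_less_Least[of "s - 1" "\<lambda>s. {s..a} \<subseteq> T"] * unfolding s_def[symmetric] by simp
  qed
  then show ?thesis using peak_Y[OF a_props(1) sa s] sa a_props(2) by (intro exI[of _ s]) auto
qed

lemma xmax_b: "\<exists>e>j. xmax (R b) = X e"
proof -
  have bT: "b \<in> T" using b_props PT by blast
  let ?P = "\<lambda>e. b \<le> e \<and> {b..e} \<subseteq> T"
  define e where "e = (GREATEST e. ?P e)"
  have bd: "\<And>e. ?P e \<Longrightarrow> e \<le> n + 1" using T(2) by fastforce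
  have e: "?P e" unfolding e_def by (rule GreatestI_nat[where k = b and b = "n + 1"]) (use bT bd in auto)
  have "e + 1 \<notin> T"
  proof
    assume *: "e + 1 \<in> T"
    then have "{b..e + 1} \<subseteq> insert (e + 1) {b..e}" by auto
    then have "?P (e + 1)" using e * by auto
    then have "e + 1 \<le> e" unfolding e_def by (rule Greatest_le_nat[where b = "n + 1"]) (use bd in auto)
    then show False by simp
  qed
  then show ?thesis using peak_X[OF b_props(1)] e b_props(2) by (intro exI[of _ e]) auto
qed

end

text \<open>A free side lies strictly between the neighbouring peaks. Grid sizes and T-joint sizes
  have this in common, so both kinds of drawing share the invariants; \<open>X j = xj\<close> and
  \<open>Y j = yj\<close> record that a free side creates the line with index
  \<open>j\<close>.\<close>

locale valid_insertion = insertion +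
  fixes xj yj :: real
  assumes y_valid: "\<not> top_aligned st j \<Longrightarrow> ymax (R b) < yj \<and> yj < ymax (R a) \<and> Y j = yj"
    and x_valid: "\<not> right_aligned st j \<Longrightarrow> xmax (R a) < xj \<and> xj < xmax (R b) \<and> X j = xj"
begin

definition "r = Rect (xmax (R a)) (ymax (R b))
  (if right_aligned st j then xmax (R b) else xj) (if top_aligned st j then ymax (R a) else yj)"

definition "P' = insert j (P - (if top_aligned st j then {a} else {}) - (if right_aligned st j then {b} else {}))"

lemma insert_rect_eq: "insert_rect j xj yj st = (P', (snd st)(j \<mapsto> r))"
  by (simp add: insert_rect_def Let_def r_def P'_def)

lemma rect_at_insert: "rect_at (insert_rect j xj yj st) p = (if p = j then r else R p)"
  by (simp add: insert_rect_eq)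

lemma r_bounds: "xmin r = xmax (R a)" "ymin r = ymax (R b)" "xmin r < xmax r" "ymin r < ymax r"
    "xmax r \<le> xmax (R b)" "ymax r \<le> ymax (R a)"
    "\<not> right_aligned st j \<Longrightarrow> xmax r < xmax (R b)" "\<not> top_aligned st j \<Longrightarrow> ymax r < ymax (R a)"
  using peaks_ab y_valid x_valid by (auto simp: r_def)

lemma old_peak: assumes "p \<in> P'" "p \<noteq> j" shows "p \<in> P" "p \<noteq> j"
  "p < j \<Longrightarrow> p \<le> a \<and> (p = a \<longrightarrow> \<not> top_aligned st j)" "\<not> p < j \<Longrightarrow> b \<le> p \<and> (p = b \<longrightarrow> \<not> right_aligned st j)"
  using assms a_props(3)[of p] b_props(3)[of p] by (auto simp: P'_def split: if_splits)

text \<open>A surviving peak before \<open>j\<close> is either \<open>a\<close> with a free top side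
  of \<open>r\<close>, so that \<open>j - 1\<close> is missing, or lies in an earlier run than
  \<open>a\<close>. In both cases \<open>j\<close> does not join its run.\<close>

lemma gap_below: assumes "p \<in> P'" "p < j" obtains v where "p < v" "v < j" "v \<notin> T"
proof (cases "p = a")
  case True
  then have "\<not> top_aligned st j" using old_peak[OF assms(1)] assms(2) by auto
  then have *: "j - 1 \<notin> T" by (simp add: top_aligned_iff)
  moreover have "a \<in> T" using a_props PT by blast
  ultimately have "a \<noteq> j - 1" by auto
  then show ?thesis using * that[of "j - 1"] True assms(2) by auto
next
  case False
  then have p: "p \<in> P" "p < a" using old_peak[OF assms(1)] assms(2) by auto
  then obtain v where "v \<in> {p..a}" "v \<notin> T" using peaks_separated[OF p(1) a_props(1)] by blast
  moreover from this have "v \<noteq> p" using p PT by auto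
  ultimately show ?thesis using that[of v] a_props(2) by auto
qed

lemma gap_above: assumes "p \<in> P'" "j < p" obtains v where "j < v" "v < p" "v \<notin> T"
proof (cases "p = b")
  case True
  then have "\<not> right_aligned st j" using old_peak[OF assms(1)] assms(2) by auto
  then have *: "j + 1 \<notin> T" by (simp add: right_aligned_iff)
  moreover have "b \<in> T" using b_props PT by blast
  ultimately have "b \<noteq> j + 1" by auto
  then show ?thesis using * that[of "j + 1"] True assms(2) by auto
next
  case False
  then have p: "p \<in> P" "b < p" using old_peak[OF assms(1)] assms(2) by auto
  then obtain v where "v \<in> {b..p}" "v \<notin> T" using peaks_separated[OF b_props(1) p(1)] by blast
  moreover from this have "v \<noteq> p" using p PT by auto
  ultimately show ?thesis using that[of v] b_props(2) by auto
qed

lemma separated': "p \<in> P' \<Longrightarrow> p' \<in> P' \<Longrightarrow> p < p' \<Longrightarrow> \<not> {p..p'} \<subseteq> insert j T"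
proof
  assume p: "p \<in> P'" "p' \<in> P'" "p < p'" "{p..p'} \<subseteq> insert j T"
  have "\<exists>v. p \<le> v \<and> v \<le> p' \<and> v \<noteq> j \<and> v \<notin> T"
  proof (cases "p < j \<and> j \<le> p'")
    case True
    then obtain v where "p < v" "v < j" "v \<notin> T" using gap_below p(1) by blast
    then show ?thesis using True by (intro exI[of _ v]) auto
  next
    case False
    show ?thesis
    proof (cases "p = j")
      case True
      then obtain v where "j < v" "v < p'" "v \<notin> T" using gap_above p by blast
      then show ?thesis using True by (intro exI[of _ v]) auto
    next
      case False
      with \<open>\<not> (p < j \<and> j \<le> p')\<close> p have ne: "p \<noteq> j" "p' \<noteq> j" "j \<notin> {p..p'}" by auto
      then have "\<not> {p..p'} \<subseteq> T" using peaks_separated old_peak(1) p by metis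
      then show ?thesis using ne by force
    qed
  qed
  then show False using p(4) by auto
qed

lemma ex_peak': assumes "v \<in> insert j T" shows "\<exists>p\<in>P'. {v..p} \<subseteq> insert j T \<and> {p..v} \<subseteq> insert j T"
proof (cases "v = j")
  case True
  then show ?thesis by (intro bexI[of _ j]) (auto simp: P'_def)
next
  case False
  then obtain p where p: "p \<in> P" "{v..p} \<subseteq> T" "{p..v} \<subseteq> T" using assms ex_peak by blast
  show ?thesis
  proof (cases "p \<in> P'")
    case True
    then show ?thesis using p by blast
  next
    case False
    have J: "j \<in> P'" by (simp add: P'_def)
    \<comment> \<open>A peak disappears only when its run merges with \<open>j\<close>, which
      becomes the peak of the merged run.\<close>
    have "p = a \<and> top_aligned st j \<or> p = b \<and> right_aligned st j"
      using False p(1) by (auto simp: P'_def split: if_splits)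
    then show ?thesis
    proof
      assume pa: "p = a \<and> top_aligned st j"
      then have "{a<..<j} \<subseteq> T" by (simp add: top_aligned_def dom_st)
      moreover have "j \<notin> {p..v}" using p(3) j(1) by blast
      then have "\<not> j < v" using pa a_props(2) by auto
      moreover have "x \<in> insert j T" if vx: "v \<le> x" "x \<le> j" for x
      proof -
        consider "x \<le> a" | "a < x" "x < j" | "x = j" using vx by linarith
        then show ?thesis
        proof cases
          case 1
          then have "x \<in> {v..p}" using vx pa by auto
          then show ?thesis using p(2) by blast
        next
          case 2
          then show ?thesis using \<open>{a<..<j} \<subseteq> T\<close> by auto
        qed simp
      qed
      then have "{v..j} \<subseteq> insert j T" by (meson atLeastAtMost_iff subsetI)
      moreover have "{j..v} \<subseteq> insert j T" using \<open>\<not> j < v\<close> by auto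
      ultimately show ?thesis using J by blast
    next
      assume pb: "p = b \<and> right_aligned st j"
      then have "{j<..<b} \<subseteq> T" by (simp add: right_aligned_def dom_st)
      moreover have "j \<notin> {v..p}" using p(2) j(1) by blast
      then have "\<not> v < j" using pb b_props(2) by auto
      moreover have "x \<in> insert j T" if vx: "j \<le> x" "x \<le> v" for x
      proof -
        consider "b \<le> x" | "j < x" "x < b" | "x = j" using vx by linarith
        then show ?thesis
        proof cases
          case 1
          then have "x \<in> {p..v}" using vx pb by auto
          then show ?thesis using p(3) by blast
        next
          case 2
          then show ?thesis using \<open>{j<..<b} \<subseteq> T\<close> by auto
        qed simp
      qed
      then have "{j..v} \<subseteq> insert j T" by (meson atLeastAtMost_iff subsetI)
      moreover have "{v..j} \<subseteq> insert j T" using \<open>\<not> v < j\<close> by auto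
      ultimately show ?thesis using J by blast
    qed
  qed
qed

lemma peak_X': assumes p: "p \<in> P'" "p \<le> w" "{p..w} \<subseteq> insert j T" "w + 1 \<notin> insert j T"
  shows "xmax (if p = j then r else R p) = X w"
proof (cases "p = j")
  case True
  show ?thesis
  proof (cases "right_aligned st j")
    \<comment> \<open>The run of \<open>j\<close> merges with that of \<open>b\<close> and ends
      where the latter ended, so the abscissa of \<open>b\<close> is inherited.\<close>
    case ra: True
    then have j1: "j + 1 \<in> T" by (simp add: right_aligned_iff)
    then have b: "j + 1 \<le> b" "{j+1..b} \<subseteq> T" using upper_run[of "j + 1"] by auto
    have "w \<noteq> j" using p(4) j1 by auto
    have "b \<le> w"
    proof (rule ccontr)
      assume "\<not> b \<le> w"
      then have "w + 1 \<in> {j+1..b}" using p(2) True by auto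
      then show False using b p(4) by blast
    qed
    moreover have "{b..w} \<subseteq> {p..w}" "j \<notin> {b..w}" using True b_props(2) by auto
    then have "{b..w} \<subseteq> T" using p(3) by blast
    ultimately have "xmax (R b) = X w" using peak_X[OF b_props(1)] p(4) by blast
    then show ?thesis using True ra by (simp add: r_def)
  next
    case ra: False
    then have "j + 1 \<notin> T" by (simp add: right_aligned_iff)
    then have "w = j" using p True by (metis Suc_eq_plus1 Suc_leI atLeastAtMost_iff insert_iff le_add1 le_neq_implies_less n_not_Suc_n subsetD)
    then show ?thesis using True ra x_valid by (simp add: r_def)
  qed
next
  case False
  have "\<not> (p < j \<and> j \<le> w)"
  proof
    assume *: "p < j \<and> j \<le> w"
    then obtain v where v: "p < v" "v < j" "v \<notin> T" using gap_below p(1) by blast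
    then have "v \<in> {p..w}" using * by auto
    then show False using p(3) v by blast
  qed
  then have "{p..w} \<subseteq> T" using p(3) False by auto
  then show ?thesis using peak_X[OF old_peak(1)[OF p(1) False] p(2)] p(4) False by auto
qed

lemma peak_Y': assumes p: "p \<in> P'" "u \<le> p" "{u..p} \<subseteq> insert j T" "u = 0 \<or> u - 1 \<notin> insert j T"
  shows "ymax (if p = j then r else R p) = Y u"
proof (cases "p = j")
  case True
  show ?thesis
  proof (cases "top_aligned st j")
    case ta: True
    then have j1: "j - 1 \<in> T" by (simp add: top_aligned_iff)
    then have a: "a \<le> j - 1" "{a..j - 1} \<subseteq> T" using lower_run[of "j - 1"] j_pos by auto
    have "u \<noteq> j" using p(4) j1 j_pos by auto
    have "u \<le> a"
    proof (rule ccontr)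
      assume "\<not> u \<le> a"
      then have "u - 1 \<in> {a..j - 1}" "u \<noteq> 0" using p(2) True by auto
      then show False using a p(4) by blast
    qed
    moreover have "{u..a} \<subseteq> {u..p}" "j \<notin> {u..a}" using True a_props(2) by auto
    then have "{u..a} \<subseteq> T" using p(3) by blast
    ultimately have "ymax (R a) = Y u" using peak_Y[OF a_props(1)] p(4) by blast
    then show ?thesis using True ta by (simp add: r_def)
  next
    case ta: False
    then have j1: "j - 1 \<notin> T" by (simp add: top_aligned_iff)
    have "u = j"
    proof (rule ccontr)
      assume "u \<noteq> j"
      then have "j - 1 \<in> {u..p}" using p(2) True by auto
      then show False using p(3) j1 j_pos by auto
    qed
    then show ?thesis using True ta y_valid by (simp add: r_def)
  qed
next
  case False
  have "\<not> (u \<le> j \<and> j < p)"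
  proof
    assume *: "u \<le> j \<and> j < p"
    then obtain v where v: "j < v" "v < p" "v \<notin> T" using gap_above p(1) by blast
    then have "v \<in> {u..p}" using * by auto
    then show False using p(3) v by blast
  qed
  then have "{u..p} \<subseteq> T" using p(3) False by auto
  then show ?thesis using peak_Y[OF old_peak(1)[OF p(1) False] p(2)] p(4) False by auto
qed

lemma peaks_mono': assumes p: "p \<in> P'" "p' \<in> P'" "p < p'"
  shows "xmax (if p = j then r else R p) < xmax (if p' = j then r else R p') \<and>
    ymax (if p' = j then r else R p') < ymax (if p = j then r else R p)"
proof -
  have below: "xmax (R s) < xmax r \<and> ymax r < ymax (R s)" if s: "s \<in> P'" "s < j" for s
  proof -
    have s': "s \<in> P" "s \<le> a" "s = a \<longrightarrow> \<not> top_aligned st j" using old_peak[OF s(1)] s(2) by auto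
    show ?thesis
    proof (cases "s = a")
      case False
      then show ?thesis using peaks_mono[OF s'(1) a_props(1)] s'(2) r_bounds by fastforce
    qed (use r_bounds s' in auto)
  qed
  have above: "xmax r < xmax (R s) \<and> ymax (R s) < ymax r" if s: "s \<in> P'" "j < s" for s
  proof -
    have s': "s \<in> P" "b \<le> s" "s = b \<longrightarrow> \<not> right_aligned st j" using old_peak[OF s(1)] s(2) by auto
    show ?thesis
    proof (cases "s = b")
      case False
      then show ?thesis using peaks_mono[OF b_props(1) s'(1)] s'(2) r_bounds by fastforce
    qed (use r_bounds s' in auto)
  qed
  show ?thesis
    using below[OF p(1)] above[OF p(2)] peaks_mono[of p p'] old_peak(1)[OF p(1)] old_peak(1)[OF p(2)] p(3)
    by (cases "p = j"; cases "p' = j") auto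
qed

lemma peak_bounds':
  assumes "p \<in> P'"
  shows "0 \<le> xmax (if p = j then r else R p) \<and> xmax (if p = j then r else R p) \<le> n \<and>
    0 \<le> ymax (if p = j then r else R p) \<and> ymax (if p = j then r else R p) \<le> n"
proof (cases "p = j")
  case True
  then show ?thesis using r_bounds peak_bounds[OF a_props(1)] peak_bounds[OF b_props(1)] by auto
next
  case False
  then show ?thesis using peak_bounds[OF old_peak(1)[OF assms]] by simp
qed

lemma staircase_insert: "staircase n X Y (insert j T) (insert_rect j xj yj st)"
proof -
  have "P' \<subseteq> insert j T" using PT by (auto simp: P'_def)
  moreover have "dom ((snd st)(j \<mapsto> r)) = insert j T" by (simp add: dom_st)
  moreover have "\<forall>p\<in>P'. \<forall>p'\<in>P'. p < p' \<longrightarrow> \<not> {p..p'} \<subseteq> insert j T"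
    using separated' by blast
  moreover have "\<forall>v\<in>insert j T. \<exists>p\<in>P'. {v..p} \<subseteq> insert j T \<and> {p..v} \<subseteq> insert j T"
    using ex_peak' by blast
  moreover have "\<forall>p\<in>P'. \<forall>w\<ge>p. {p..w} \<subseteq> insert j T \<and> w + 1 \<notin> insert j T \<longrightarrow>
      xmax (if p = j then r else R p) = X w" using peak_X' by blast
  moreover have "\<forall>p\<in>P'. \<forall>u\<le>p. {u..p} \<subseteq> insert j T \<and> (u = 0 \<or> u - 1 \<notin> insert j T) \<longrightarrow>
      ymax (if p = j then r else R p) = Y u" using peak_Y' by blast
  moreover have "\<forall>p\<in>P'. \<forall>p'\<in>P'. p < p' \<longrightarrow>
      xmax (if p = j then r else R p) < xmax (if p' = j then r else R p') \<and>
      ymax (if p' = j then r else R p') < ymax (if p = j then r else R p)" using peaks_mono' by blast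
  moreover have "\<forall>p\<in>P'. 0 \<le> xmax (if p = j then r else R p) \<and> xmax (if p = j then r else R p) \<le> n \<and>
      0 \<le> ymax (if p = j then r else R p) \<and> ymax (if p = j then r else R p) \<le> n"
    using peak_bounds' by blast
  ultimately show ?thesis
    unfolding staircase_def rect_at_insert unfolding insert_rect_eq fst_conv snd_conv by (intro conjI)
qed

text \<open>The valley is the lower left corner of the tile: peaks before \<open>j\<close> do not
  reach beyond its abscissa, later ones not above its ordinate. So the old region avoids the
  half-open tile, and only the tile is gained.\<close>

lemma under_insert:
  "under_staircase (insert_rect j xj yj st) = under_staircase st \<union> half_open r"
  "under_staircase st \<inter> half_open r = {}"
proof -
  have ab: "0 \<le> xmax (R a)" "0 \<le> ymax (R b)" using peak_bounds a_props b_props by auto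
  have U: "under_staircase (insert_rect j xj yj st) =
    {(x, y). 0 < x \<and> 0 < y \<and> (\<exists>p\<in>P'. x \<le> xmax (if p = j then r else R p) \<and> y \<le> ymax (if p = j then r else R p))}"
    unfolding under_staircase_def rect_at_insert by (simp add: insert_rect_eq)
  have disj: "\<not> (x \<le> xmax (R p) \<and> y \<le> ymax (R p))" if "(x, y) \<in> half_open r" "p \<in> P" for x y p
  proof -
    have "x > xmax (R a)" "y > ymax (R b)" using that by (auto simp: half_open_def r_bounds)
    moreover have "p \<noteq> j" using that(2) PT j by blast
    moreover have "p < j \<Longrightarrow> xmax (R p) \<le> xmax (R a)"
      using a_props(3)[OF that(2)] peaks_mono(1)[OF that(2) a_props(1)] by force
    moreover have "j < p \<Longrightarrow> ymax (R p) \<le> ymax (R b)"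
      using b_props(3)[OF that(2)] peaks_mono(2)[OF b_props(1) that(2)] by force
    ultimately show ?thesis by force
  qed
  then show "under_staircase st \<inter> half_open r = {}" unfolding under_staircase_def by blast
  show "under_staircase (insert_rect j xj yj st) = under_staircase st \<union> half_open r"
  proof (rule set_eqI, clarify)
    fix x y
    show "(x, y) \<in> under_staircase (insert_rect j xj yj st) \<longleftrightarrow> (x, y) \<in> under_staircase st \<union> half_open r"
    proof
      assume "(x, y) \<in> under_staircase (insert_rect j xj yj st)"
      then obtain p where p: "0 < x" "0 < y" "p \<in> P'" "x \<le> xmax (if p = j then r else R p)"
        "y \<le> ymax (if p = j then r else R p)" unfolding U by auto
      show "(x, y) \<in> under_staircase st \<union> half_open r"
      proof (cases "p = j")
        case False
        then show ?thesis using p old_peak(1)[OF p(3)] by (auto simp: under_staircase_def)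
      next
        case True
        show ?thesis
        \<comment> \<open>Outside the tile, the quadrant of the new peak is already covered by those
          of \<open>a\<close> and \<open>b\<close>.\<close>
        proof (cases "x \<le> xmax (R a) \<or> y \<le> ymax (R b)")
          case le: True
          then have "(x \<le> xmax (R a) \<and> y \<le> ymax (R a)) \<or> (x \<le> xmax (R b) \<and> y \<le> ymax (R b))"
            using p True r_bounds(5,6) by auto
          then show ?thesis using p(1,2) a_props(1) b_props(1) by (auto simp: under_staircase_def)
        next
          case False
          then show ?thesis using p True by (auto simp: half_open_def r_bounds)
        qed
      qed
    next
      have J: "j \<in> P'" by (simp add: P'_def)
      assume "(x, y) \<in> under_staircase st \<union> half_open r"
      then show "(x, y) \<in> under_staircase (insert_rect j xj yj st)"
      proof
        assume "(x, y) \<in> half_open r"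
        then have "0 < x" "0 < y" "x \<le> xmax r" "y \<le> ymax r" using ab by (auto simp: half_open_def r_bounds)
        then show ?thesis unfolding U using J by auto
      next
        assume "(x, y) \<in> under_staircase st"
        then obtain p where p: "0 < x" "0 < y" "p \<in> P" "x \<le> xmax (R p)" "y \<le> ymax (R p)"
          by (auto simp: under_staircase_def)
        show ?thesis
        proof (cases "p \<in> P'")
          case True
          moreover have "p \<noteq> j" using p(3) PT j by blast
          ultimately show ?thesis unfolding U using p by auto
        next
          case False
          \<comment> \<open>The quadrant of a dropped peak is contained in that of the new peak,
            which shares the aligned coordinate and exceeds the other one.\<close>
          have "p = a \<and> top_aligned st j \<or> p = b \<and> right_aligned st j"
            using False p(3) by (auto simp: P'_def split: if_splits)
          then have "x \<le> xmax r \<and> y \<le> ymax r"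
          proof
            assume "p = a \<and> top_aligned st j"
            moreover from this have "ymax r = ymax (R a)" by (simp add: r_def)
            ultimately show ?thesis using p r_bounds(1,3) by auto
          next
            assume "p = b \<and> right_aligned st j"
            moreover from this have "xmax r = xmax (R b)" by (simp add: r_def)
            ultimately show ?thesis using p r_bounds(2,4) by auto
          qed
          then show ?thesis unfolding U using p(1,2) J by auto
        qed
      qed
    qed
  qed
qed

end

section \<open>The insertion procedure along a permutation\<close>

definition xline :: "nat \<Rightarrow> (nat \<Rightarrow> real) \<Rightarrow> nat \<Rightarrow> real" where
  "xline n x w = (if w = 0 then 0 else if n \<le> w then real n else x w)"

text \<open>Horizontal line \<open>u\<close> is created by the free top of \<open>r_u\<close>, as
  vertical line \<open>w\<close> is by the free right side of \<open>r_w\<close>; hence the size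
  functions are used at the index of the line. The index \<open>0\<close> here, like
  \<open>n + 1\<close> in \<open>xline\<close>, serves runs that contain an auxiliary label.\<close>

definition yline :: "nat \<Rightarrow> (nat \<Rightarrow> real) \<Rightarrow> nat \<Rightarrow> real" where
  "yline n y u = (if u \<le> 1 then real n else if n < u then 0 else y u)"

definition tile :: "nat \<Rightarrow> (nat \<Rightarrow> int) \<Rightarrow> (nat \<Rightarrow> real) \<Rightarrow> (nat \<Rightarrow> real) \<Rightarrow> nat \<Rightarrow> rect" where
  "tile n q X Y j = Rect (X (left_line q j)) (Y (bottom_line n q j)) (X (right_line n q j)) (Y (top_line q j))"

text \<open>The betweenness part of \<open>T_joint_choice\<close>, for the first \<open>k\<close>
  insertions only: the admissible range of a size depends on the state produced by the earlier
  ones.\<close>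

definition valid_choice ::
    "nat \<Rightarrow> (nat \<Rightarrow> nat) \<Rightarrow> (nat \<Rightarrow> real) \<Rightarrow> (nat \<Rightarrow> real) \<Rightarrow> nat \<Rightarrow> bool" where
  "valid_choice n \<pi> x y k \<longleftrightarrow>
     (\<forall>i<k. let st = run n \<pi> x y i; j = \<pi> (Suc i);
                ra = the (snd st (prev_peak st j)); rb = the (snd st (next_peak st j))
            in (\<not> top_aligned st j \<longrightarrow> ymax rb < y j \<and> y j < ymax ra) \<and>
               (\<not> right_aligned st j \<longrightarrow> xmax ra < x j \<and> x j < xmax rb))"

definition inserted :: "nat \<Rightarrow> (nat \<Rightarrow> nat) \<Rightarrow> nat \<Rightarrow> nat set" where
  "inserted n \<pi> i = {0, n + 1} \<union> \<pi> ` {1..i}"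

definition position :: "(nat \<Rightarrow> nat) \<Rightarrow> nat \<Rightarrow> int" where
  "position \<pi> v = int (inv \<pi> v)"

lemma position_inj:
  assumes "\<pi> permutes {1..n}"
  shows "inj_on (position \<pi>) {1..n}"
  unfolding position_def by (rule inj_onI) (metis assms of_nat_eq_iff permutes_inverses(1))

lemma mem_image_iff_position:
  assumes p: "\<pi> permutes {1..n}" and i: "i \<le> n"
  shows "v \<in> \<pi> ` {1..i} \<longleftrightarrow> v \<in> {1..n} \<and> position \<pi> v \<le> int i"
proof
  assume "v \<in> \<pi> ` {1..i}"
  then obtain k where k: "k \<in> {1..i}" "v = \<pi> k" by blast
  then have "k \<in> {1..n}" using i by auto
  then have "v \<in> {1..n}" using permutes_in_image[OF p] k(2) by simp
  moreover have "inv \<pi> v = k" using k(2) permutes_inverses(2)[OF p] by simp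
  ultimately show "v \<in> {1..n} \<and> position \<pi> v \<le> int i" using k by (simp add: position_def)
next
  assume v: "v \<in> {1..n} \<and> position \<pi> v \<le> int i"
  then have "inv \<pi> v \<in> {1..n}" using permutes_in_image[OF permutes_inv[OF p]] by blast
  then have "inv \<pi> v \<in> {1..i}" using v by (simp add: position_def)
  moreover have "v = \<pi> (inv \<pi> v)" using permutes_inverses(1)[OF p] by simp
  ultimately show "v \<in> \<pi> ` {1..i}" by (rule rev_image_eqI)
qed

lemma mem_inserted:
  assumes "\<pi> permutes {1..n}" "i \<le> n"
  shows "v \<in> inserted n \<pi> i \<longleftrightarrow> v = 0 \<or> v = n + 1 \<or> v \<in> {1..n} \<and> position \<pi> v \<le> int i"
  using mem_image_iff_position[OF assms, of v] by (auto simp: inserted_def)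

lemma position_image:
  assumes "\<pi> permutes {1..n}"
  shows "position \<pi> (\<pi> i) = int i"
  using permutes_inverses(2)[OF assms] by (simp add: position_def)

lemma staircase_initial:
  assumes "1 \<le> n"
  shows "staircase n (xline n x) (yline n y) {0, n + 1} (initial n)"
proof -
  have 1: "dom (snd (initial n)) = {0, n + 1}" "fst (initial n) = {0, n + 1}"
    by (auto simp: initial_def)
  have r: "rect_at (initial n) 0 = Rect (-1) 0 0 (real n)" "rect_at (initial n) (n + 1) = Rect 0 (-1) (real n) 0"
    by (auto simp: initial_def)
  have sep: "\<not> {p..p'} \<subseteq> {0, n + 1}" if "p \<in> {0, n + 1}" "p' \<in> {0, n + 1}" "p < p'" for p p'
  proof -
    have "1 \<in> {p..p'}" using that assms by auto
    then show ?thesis using assms by auto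
  qed
  have X: "xmax (rect_at (initial n) p) = xline n x w"
    if "p \<in> {0, n + 1}" "p \<le> w" "{p..w} \<subseteq> {0, n + 1}" "w + 1 \<notin> {0, n + 1}" for p w
  proof -
    have "w \<in> {p..w}" using that(2) by simp
    then have "w \<in> {0, n + 1}" using that(3) by blast
    moreover have "\<not> (p = 0 \<and> w = n + 1)" using sep[of p w] that by auto
    ultimately show ?thesis using that(1,2) r assms by (auto simp: xline_def)
  qed
  have Y: "ymax (rect_at (initial n) p) = yline n y u"
    if "p \<in> {0, n + 1}" "u \<le> p" "{u..p} \<subseteq> {0, n + 1}" for p u
  proof -
    have "u \<in> {u..p}" using that(2) by simp
    then have "u \<in> {0, n + 1}" using that(3) by blast
    moreover have "\<not> (u = 0 \<and> p = n + 1)" using sep[of u p] that by auto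
    ultimately show ?thesis using that(1,2) r assms by (auto simp: yline_def)
  qed
  have ep: "\<exists>p\<in>{0, n + 1}. {v..p} \<subseteq> {0, n + 1} \<and> {p..v} \<subseteq> {0, n + 1}" if "v \<in> {0, n + 1}" for v
    using that by (intro bexI[of _ v]) auto
  show ?thesis
    unfolding staircase_def 1
  proof (intro conjI ballI allI impI)
  qed (use sep X Y ep r assms in auto)
qed

lemma under_initial: "under_staircase (initial n) = {}"
  by (auto simp: under_staircase_def initial_def split: if_splits)

context
  fixes n :: nat and \<pi> :: "nat \<Rightarrow> nat" and x y :: "nat \<Rightarrow> real"
  assumes n: "1 \<le> n" and \<pi>: "\<pi> permutes {1..n}"
begin

abbreviation "Xl \<equiv> xline n x"
abbreviation "Yl \<equiv> yline n y"
abbreviation "rtile \<equiv> tile n (position \<pi>) Xl Yl"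

definition run_invariant :: "nat \<Rightarrow> bool" where
  "run_invariant i \<longleftrightarrow>
    staircase n Xl Yl (inserted n \<pi> i) (run n \<pi> x y i) \<and>
    rect_at (run n \<pi> x y i) 0 = Rect (-1) 0 0 (real n) \<and>
    rect_at (run n \<pi> x y i) (n + 1) = Rect 0 (-1) (real n) 0 \<and>
    (\<forall>v\<in>\<pi> ` {1..i}. rect_at (run n \<pi> x y i) v = rtile v \<and> proper (rtile v)) \<and>
    under_staircase (run n \<pi> x y i) = (\<Union>v\<in>\<pi> ` {1..i}. half_open (rtile v)) \<and>
    (\<forall>v\<in>\<pi> ` {1..i}. \<forall>v'\<in>\<pi> ` {1..i}. v \<noteq> v' \<longrightarrow> half_open (rtile v) \<inter> half_open (rtile v') = {})"

lemma run_invariantD: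
  assumes "run_invariant i"
  shows "staircase n Xl Yl (inserted n \<pi> i) (run n \<pi> x y i)"
    "rect_at (run n \<pi> x y i) 0 = Rect (-1) 0 0 (real n)"
    "rect_at (run n \<pi> x y i) (n + 1) = Rect 0 (-1) (real n) 0"
    "\<forall>v\<in>\<pi> ` {1..i}. rect_at (run n \<pi> x y i) v = rtile v \<and> proper (rtile v)"
    "under_staircase (run n \<pi> x y i) = (\<Union>v\<in>\<pi> ` {1..i}. half_open (rtile v))"
    "\<forall>v\<in>\<pi> ` {1..i}. \<forall>v'\<in>\<pi> ` {1..i}. v \<noteq> v' \<longrightarrow> half_open (rtile v) \<inter> half_open (rtile v') = {}"
  by (insert assms[unfolded run_invariant_def]; elim conjE; assumption)+

lemma run_insertion:
  assumes i: "i < n" and inv: "run_invariant i"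
  shows "insertion n (\<pi> (Suc i)) Xl Yl (inserted n \<pi> i) (run n \<pi> x y i)"
proof
  have i': "i \<le> n" using i by simp
  note mem = mem_inserted[OF \<pi> i']
  have "Suc i \<in> {1..n}" using i by simp
  then have j: "\<pi> (Suc i) \<in> {1..n}" using permutes_in_image[OF \<pi>] by simp
  then show "\<pi> (Suc i) \<le> n" by simp
  show "\<pi> (Suc i) \<notin> inserted n \<pi> i" using j position_image[OF \<pi>, of "Suc i"] by (auto simp: mem)
  show "{0, n + 1} \<subseteq> inserted n \<pi> i" "inserted n \<pi> i \<subseteq> {0..n + 1}" by (auto simp: mem)
  show "staircase n Xl Yl (inserted n \<pi> i) (run n \<pi> x y i)" using run_invariantD(1)[OF inv] .
qed

text \<open>The lines that bound the tile of \<open>j\<close> only compare \<open>q j\<close> with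
  other positions, so they ask which labels precede \<open>j\<close>. These are the labels in
  \<open>inserted n \<pi> i\<close>; therefore the rectangle inserted now agrees with the tile
  computed from the whole permutation.\<close>

lemma run_step:
  assumes i: "i < n" and inv: "run_invariant i" and val: "valid_choice n \<pi> x y (Suc i)"
  defines "st \<equiv> run n \<pi> x y i" and "j \<equiv> \<pi> (Suc i)"
  shows "valid_insertion n j Xl Yl (inserted n \<pi> i) st (x j) (y j)"
    and "valid_insertion.r j st (x j) (y j) = rtile j"
    and "inserted n \<pi> (Suc i) = insert j (inserted n \<pi> i)" "j \<in> {1..n}"
    and "run n \<pi> x y (Suc i) = insert_rect j (x j) (y j) st"
proof -
  let ?q = "position \<pi>" and ?T = "inserted n \<pi> i"
  have i': "i \<le> n" using i by simp
  note mem = mem_inserted[OF \<pi> i']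
  have "Suc i \<in> {1..n}" using i by simp
  then show j: "j \<in> {1..n}" using permutes_in_image[OF \<pi>] unfolding j_def by simp
  have qj: "?q j = int i + 1" using position_image[OF \<pi>] by (simp add: j_def)
  interpret I: insertion n j Xl Yl ?T st
    unfolding j_def st_def by (rule run_insertion[OF i inv])
  show V: "valid_insertion n j Xl Yl ?T st (x j) (y j)"
  proof unfold_locales
    assume na: "\<not> top_aligned st j"
    then have "j - 1 \<noteq> 0" using I.top_aligned_iff I.T by auto
    then have "Yl j = y j" using j by (auto simp: yline_def)
    then show "ymax (I.R I.b) < y j \<and> y j < ymax (I.R I.a) \<and> Yl j = y j"
      using val na by (simp add: valid_choice_def Let_def st_def j_def)
  next
    assume na: "\<not> right_aligned st j"
    then have "j + 1 \<noteq> n + 1" using I.right_aligned_iff I.T by auto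
    then have "Xl j = x j" using j by (auto simp: xline_def)
    then show "xmax (I.R I.a) < x j \<and> x j < xmax (I.R I.b) \<and> Xl j = x j"
      using val na by (simp add: valid_choice_def Let_def st_def j_def)
  qed
  then interpret V: valid_insertion n j Xl Yl ?T st "x j" "y j" .
  show "inserted n \<pi> (Suc i) = insert j ?T" by (auto simp: inserted_def j_def atLeastAtMostSuc_conv)
  show "run n \<pi> x y (Suc i) = insert_rect j (x j) (y j) st" by (simp add: st_def j_def Let_def)
  have J: "j \<in> V.P'" by (simp add: V.P'_def)
  note q = position_inj[OF \<pi>]
  define w where "w = left_line ?q j"
  have w: "w < j" "w = 0 \<or> ?q w < ?q j" "\<And>v. w < v \<Longrightarrow> v < j \<Longrightarrow> ?q j < ?q v"
    using left_line_iff[OF q j, of w] w_def by auto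
  have "w \<in> ?T" using w(1,2) j qj by (auto simp: mem)
  moreover have "v \<notin> ?T" if "w < v" "v < j" for v using w(3)[OF that] that j qj by (auto simp: mem)
  ultimately have 1: "xmin V.r = Xl w" using I.lower_run(3)[of w] w(1) V.r_bounds(1) by simp
  define u where "u = bottom_line n ?q j"
  have u: "j < u" "u \<le> n + 1" "u = n + 1 \<or> ?q u < ?q j" "\<And>v. j < v \<Longrightarrow> v < u \<Longrightarrow> ?q j < ?q v"
    using bottom_line_iff[OF q j, of u] u_def by auto
  have "u \<in> ?T" using u(1-3) j qj by (auto simp: mem)
  moreover have "v \<notin> ?T" if "j < v" "v < u" for v using u(4)[OF that] that u(2) qj by (auto simp: mem)
  ultimately have 2: "ymin V.r = Yl u" using I.upper_run(3)[of u] u(1) V.r_bounds(2) by simp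
  define R where "R = right_line n ?q j"
  have R: "j \<le> R" "R \<le> n" "R = n \<or> ?q j < ?q (R + 1)" "\<And>v. j < v \<Longrightarrow> v \<le> R \<Longrightarrow> ?q v < ?q j"
    using right_line_iff[OF q j, of R] R_def by auto
  \<comment> \<open>If all larger labels precede \<open>j\<close>, its run also contains the
    auxiliary label \<open>n + 1\<close>; \<open>Xl\<close> gives the right side of the square at
    \<open>n\<close> and at \<open>n + 1\<close>.\<close>
  define e where "e = (if R = n then n + 1 else R)"
  have "{j..e} \<subseteq> insert j ?T"
  proof
    fix v assume v: "v \<in> {j..e}"
    show "v \<in> insert j ?T"
      using R(2) R(4)[of v] v qj j by (cases "v = j"; cases "v \<le> R") (auto simp: mem e_def split: if_splits)
  qed
  moreover have "e + 1 \<notin> insert j ?T" using R j qj by (auto simp: mem e_def)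
  moreover have "j \<le> e" using R by (auto simp: e_def)
  ultimately have "xmax V.r = Xl e" using V.peak_X'[OF J, of e] by simp
  moreover have "Xl e = Xl R" using n by (simp add: e_def xline_def)
  ultimately have 3: "xmax V.r = Xl R" by simp
  define S where "S = top_line ?q j"
  have S: "1 \<le> S" "S \<le> j" "S = 1 \<or> ?q j < ?q (S - 1)" "\<And>v. S \<le> v \<Longrightarrow> v < j \<Longrightarrow> ?q v < ?q j"
    using top_line_iff[OF q j, of S] S_def by auto
  \<comment> \<open>Likewise the run may reach down to the auxiliary label \<open>0\<close>, and
    \<open>Yl\<close> gives the top of the square at \<open>0\<close> and at
    \<open>1\<close>.\<close>
  define s where "s = (if S = 1 then 0 else S)"
  have "{s..j} \<subseteq> insert j ?T"
  proof
    fix v assume v: "v \<in> {s..j}"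
    show "v \<in> insert j ?T"
      using S(1) S(4)[of v] v qj j by (cases "v = j"; cases "S \<le> v") (auto simp: mem s_def split: if_splits)
  qed
  moreover have "s = 0 \<or> s - 1 \<notin> insert j ?T" using S j qj by (auto simp: mem s_def)
  moreover have "s \<le> j" using S by (auto simp: s_def)
  ultimately have "ymax V.r = Yl s" using V.peak_Y'[OF J, of s] by simp
  moreover have "Yl s = Yl S" using n by (simp add: s_def yline_def)
  ultimately have 4: "ymax V.r = Yl S" by simp
  show "V.r = rtile j"
    by (rule rect.expand) (simp add: tile_def 1 2 3 4 w_def[symmetric] u_def[symmetric] R_def[symmetric] S_def[symmetric])
qed

lemma run_invariant:
  "i \<le> n \<Longrightarrow> valid_choice n \<pi> x y i \<Longrightarrow> run_invariant i"
proof (induction i)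
  case 0
  then show ?case using staircase_initial[OF n] under_initial
    by (simp add: run_invariant_def inserted_def) (simp add: initial_def)
next
  case (Suc i)
  have "valid_choice n \<pi> x y i" using Suc.prems(2) by (auto simp: valid_choice_def)
  then have inv: "run_invariant i" using Suc by simp
  define st j where "st = run n \<pi> x y i" and "j = \<pi> (Suc i)"
  have i: "i < n" using Suc.prems by simp
  note S = run_step[OF i inv Suc.prems(2), folded st_def j_def]
  interpret V: valid_insertion n j Xl Yl "inserted n \<pi> i" st "x j" "y j" by (rule S(1))
  have r: "V.r = rtile j" by (rule S(2))
  have "j \<notin> \<pi> ` {1..i}" using V.j by (auto simp: inserted_def)
  have im: "\<pi> ` {1..Suc i} = insert j (\<pi> ` {1..i})" by (auto simp: j_def atLeastAtMostSuc_conv)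
  have pr: "proper (rtile j)" using V.r_bounds(3,4) unfolding r by (simp add: proper_def)
  note D = run_invariantD[OF inv, folded st_def]
  have disj: "half_open (rtile v) \<inter> half_open (rtile j) = {}" if "v \<in> \<pi> ` {1..i}" for v
  proof -
    have "half_open (rtile v) \<subseteq> under_staircase st" unfolding D(5) using that by (rule UN_upper)
    then show ?thesis using V.under_insert(2) unfolding r by blast
  qed
  have "half_open (rtile v) \<inter> half_open (rtile v') = {}"
    if v: "v \<in> \<pi> ` {1..Suc i}" "v' \<in> \<pi> ` {1..Suc i}" "v \<noteq> v'" for v v'
  proof -
    consider "v = j" "v' \<in> \<pi> ` {1..i}" | "v \<in> \<pi> ` {1..i}" "v' = j" | "v \<in> \<pi> ` {1..i}" "v' \<in> \<pi> ` {1..i}"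
      using v unfolding im by blast
    then show ?thesis
    proof cases
      case 1
      then show ?thesis using disj[of v'] by (simp add: Int_commute)
    next
      case 2
      then show ?thesis using disj[of v] by simp
    next
      case 3
      then show ?thesis using D(6) v(3) by blast
    qed
  qed
  then have "\<forall>v\<in>\<pi> ` {1..Suc i}. \<forall>v'\<in>\<pi> ` {1..Suc i}. v \<noteq> v' \<longrightarrow>
      half_open (rtile v) \<inter> half_open (rtile v') = {}" by blast
  moreover have "under_staircase (run n \<pi> x y (Suc i)) = (\<Union>v\<in>\<pi> ` {1..Suc i}. half_open (rtile v))"
    unfolding S(5) V.under_insert(1) im r D(5) by (simp only: UN_insert Un_commute)
  moreover have "rect_at (run n \<pi> x y (Suc i)) v = rtile v \<and> proper (rtile v)" if "v \<in> \<pi> ` {1..Suc i}" for v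
  proof (cases "v = j")
    case True
    show ?thesis unfolding S(5) V.rect_at_insert using True r pr by simp
  next
    case False
    then have "v \<in> \<pi> ` {1..i}" using that unfolding im by blast
    from bspec[OF D(4) this] False show ?thesis unfolding S(5) V.rect_at_insert by simp
  qed
  then have "\<forall>v\<in>\<pi> ` {1..Suc i}. rect_at (run n \<pi> x y (Suc i)) v = rtile v \<and> proper (rtile v)" by blast
  moreover have "rect_at (run n \<pi> x y (Suc i)) 0 = Rect (-1) 0 0 (real n)"
    "rect_at (run n \<pi> x y (Suc i)) (n + 1) = Rect 0 (-1) (real n) 0"
    using D(2,3) S(4) unfolding S(5) V.rect_at_insert by auto
  moreover have "staircase n Xl Yl (inserted n \<pi> (Suc i)) (run n \<pi> x y (Suc i))"
    unfolding S(3,5) by (rule V.staircase_insert)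
  ultimately show ?case unfolding run_invariant_def by (intro conjI)
qed

lemma drawing_eq:
  assumes "valid_choice n \<pi> x y n"
  shows "drawing n \<pi> x y = rtile ` {1..n}"
proof -
  have "run_invariant n" using run_invariant assms by simp
  from run_invariantD(4)[OF this, unfolded permutes_image[OF \<pi>]]
  show ?thesis unfolding drawing_def by (intro image_cong) auto
qed

lemma tiles_half_open:
  assumes "valid_choice n \<pi> x y n"
  shows "\<And>v. v \<in> {1..n} \<Longrightarrow> proper (rtile v)"
    and "\<And>v v'. v \<in> {1..n} \<Longrightarrow> v' \<in> {1..n} \<Longrightarrow> v \<noteq> v' \<Longrightarrow> half_open (rtile v) \<inter> half_open (rtile v') = {}"
    and "(\<Union>v\<in>{1..n}. half_open (rtile v)) = {0<..real n} \<times> {0<..real n}"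
proof -
  have inv: "run_invariant n" using run_invariant assms by simp
  note inv' = run_invariantD[OF inv, unfolded permutes_image[OF \<pi>]]
  show "\<And>v. v \<in> {1..n} \<Longrightarrow> proper (rtile v)" using inv'(4) by blast
  show "\<And>v v'. v \<in> {1..n} \<Longrightarrow> v' \<in> {1..n} \<Longrightarrow> v \<noteq> v' \<Longrightarrow> half_open (rtile v) \<inter> half_open (rtile v') = {}"
    using inv'(6) by blast
  let ?st = "run n \<pi> x y n"
  have T: "inserted n \<pi> n = {0..n + 1}" using permutes_image[OF \<pi>] by (auto simp: inserted_def)
  have st: "staircase n Xl Yl {0..n + 1} ?st" using inv'(1) T by simp
  obtain p where p: "p \<in> fst ?st" using staircaseD(4)[OF st] by fastforce
  then have pn: "p \<le> n + 1" using staircaseD(2)[OF st] by auto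
  have "{p..n + 1} \<subseteq> {0..n + 1}" "n + 1 + 1 \<notin> {0..n + 1}" "{0..p} \<subseteq> {0..n + 1}" using pn by auto
  then have "xmax (rect_at ?st p) = Xl (n + 1)" "ymax (rect_at ?st p) = Yl 0"
    using staircaseD(5,6)[OF st] p pn by blast+
  then have "xmax (rect_at ?st p) = n" "ymax (rect_at ?st p) = n" by (simp_all add: xline_def yline_def)
  \<comment> \<open>All labels now form one run, so there is a single peak, at the upper right
    corner of the square.\<close>
  moreover have "p' = p" if p': "p' \<in> fst ?st" for p'
  proof (rule ccontr)
    assume "p' \<noteq> p"
    have "p' \<le> n + 1" using p' staircaseD(2)[OF st] by auto
    then have "{p..p'} \<subseteq> {0..n + 1}" "{p'..p} \<subseteq> {0..n + 1}" using pn by auto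
    then show False using staircaseD(3)[OF st] p p' \<open>p' \<noteq> p\<close> by (metis linorder_neqE_nat)
  qed
  then have "fst ?st = {p}" using p by blast
  ultimately have "under_staircase ?st = {0<..real n} \<times> {0<..real n}"
    by (auto simp: under_staircase_def)
  then show "(\<Union>v\<in>{1..n}. half_open (rtile v)) = {0<..real n} \<times> {0<..real n}" using inv'(5) by simp
qed

text \<open>The rectangles are the closures of the half-open tiles. Labels with equal tiles would
  share the upper right corner, which belongs to the half-open tile.\<close>

lemma tiles_rectangulation:
  assumes "valid_choice n \<pi> x y n"
  shows "rectangulation (grid_square n) (rtile ` {1..n})" and "inj_on rtile {1..n}"
proof -
  note H = tiles_half_open[OF assms]
  have int: "interior (region r) \<subseteq> half_open r" for r by (auto simp: interior_region half_open_def)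
  have cl: "region (rtile v) = closure (half_open (rtile v))" if "v \<in> {1..n}" for v
    using H(1)[OF that] by (simp add: region_def half_open_def closure_Times proper_def)
  have sq: "region (grid_square n) = closure ({0<..real n} \<times> {0<..real n})"
    using n by (simp add: region_def grid_square_def closure_Times)
  have "region (grid_square n) \<subseteq> (\<Union>v\<in>{1..n}. region (rtile v))"
    unfolding sq H(3)[symmetric]
  proof (rule closure_minimal)
    show "(\<Union>v\<in>{1..n}. half_open (rtile v)) \<subseteq> (\<Union>v\<in>{1..n}. region (rtile v))"
      by (rule UN_mono) (auto simp: half_open_def region_def)
    show "closed (\<Union>v\<in>{1..n}. region (rtile v))"
      by (intro closed_UN) (auto simp: region_def closed_Times)
  qed
  moreover have "region (rtile v) \<subseteq> region (grid_square n)" if "v \<in> {1..n}" for v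
    unfolding sq cl[OF that] H(3)[symmetric] using that by (intro closure_mono UN_upper)
  ultimately have "(\<Union>v\<in>{1..n}. region (rtile v)) = region (grid_square n)" by blast
  then have "(\<Union>r\<in>rtile ` {1..n}. region r) = region (grid_square n)" by (simp only: image_image)
  moreover have "proper (grid_square n)" using n by (simp add: proper_def grid_square_def)
  moreover have "interior (region r) \<inter> interior (region r') = {}"
    if r: "r \<in> rtile ` {1..n}" "r' \<in> rtile ` {1..n}" "r \<noteq> r'" for r r'
  proof -
    obtain v v' where "v \<in> {1..n}" "r = rtile v" "v' \<in> {1..n}" "r' = rtile v'" using r by blast
    moreover from this r have "v \<noteq> v'" by blast
    ultimately have "half_open r \<inter> half_open r' = {}" using H(2) by blast
    then show ?thesis using int by blast
  qed
  ultimately show "rectangulation (grid_square n) (rtile ` {1..n})"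
    using H(1) unfolding rectangulation_def by auto
  show "inj_on rtile {1..n}"
  proof (rule inj_onI, rule ccontr)
    fix v v' assume v: "v \<in> {1..n}" "v' \<in> {1..n}" "rtile v = rtile v'" "v \<noteq> v'"
    have "(xmax (rtile v), ymax (rtile v)) \<in> half_open (rtile v)"
      using H(1)[OF v(1)] by (simp add: half_open_def proper_def)
    then show False using H(2)[OF v(1,2,4)] v(3) by auto
  qed
qed

text \<open>When \<open>r_w\<close> is inserted, \<open>w + 1\<close> is still missing, so its right
  side is free. It rises from the top of \<open>r_b\<close>, and the joint condition puts
  \<open>x w\<close> strictly between the sides of \<open>r_b\<close>; for \<open>b = n + 1\<close>
  it stands on the bottom of the square. Free tops are treated alike.\<close>

lemma tile_joints:
  assumes val: "valid_choice n \<pi> x y n" and tj: "T_joint_choice n \<pi> x y"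
  shows "\<And>w. w \<in> {1..<n} \<Longrightarrow> position \<pi> w < position \<pi> (w + 1) \<Longrightarrow> ymin (rtile w) = 0 \<or>
      (\<exists>b\<in>{1..n}. ymax (rtile b) = ymin (rtile w) \<and> xmin (rtile b) < Xl w \<and> Xl w < xmax (rtile b))"
    and "\<And>u. u \<in> {2..n} \<Longrightarrow> position \<pi> u < position \<pi> (u - 1) \<Longrightarrow> xmin (rtile u) = 0 \<or>
      (\<exists>a\<in>{1..n}. xmax (rtile a) = xmin (rtile u) \<and> ymin (rtile a) < Yl u \<and> Yl u < ymax (rtile a))"
proof -
  let ?q = "position \<pi>"
  have step: "\<exists>st i. valid_insertion n w Xl Yl (inserted n \<pi> i) st (x w) (y w) \<and>
      valid_insertion.r w st (x w) (y w) = rtile w \<and> i < n \<and> ?q w = int i + 1 \<and>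
      st = run n \<pi> x y i \<and> w = \<pi> (Suc i) \<and> run_invariant i" if "w \<in> {1..n}" for w
  proof -
    have k: "inv \<pi> w \<in> {1..n}" using that permutes_in_image[OF permutes_inv[OF \<pi>]] by blast
    define i where "i = inv \<pi> w - 1"
    have i: "Suc i = inv \<pi> w" "i < n" using k by (auto simp: i_def)
    have w: "w = \<pi> (Suc i)" using permutes_inverses(1)[OF \<pi>] i by simp
    have "valid_choice n \<pi> x y (Suc i)" "valid_choice n \<pi> x y i"
      using val i(2) by (auto simp: valid_choice_def)
    moreover from this(2) have inv: "run_invariant i" using run_invariant i(2) by simp
    ultimately have V: "valid_insertion n w Xl Yl (inserted n \<pi> i) (run n \<pi> x y i) (x w) (y w)"
      "valid_insertion.r w (run n \<pi> x y i) (x w) (y w) = rtile w"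
      using run_step(1,2)[OF i(2) inv, folded w] by blast+
    have "?q w = int i + 1" using i(1) by (simp add: position_def)
    then show ?thesis using V i(2) w inv by blast
  qed
  show "ymin (rtile w) = 0 \<or> (\<exists>b\<in>{1..n}. ymax (rtile b) = ymin (rtile w) \<and> xmin (rtile b) < Xl w \<and> Xl w < xmax (rtile b))"
    if w: "w \<in> {1..<n}" "?q w < ?q (w + 1)" for w
  proof -
    have w1: "w \<in> {1..n}" using w(1) by auto
    obtain st i where V: "valid_insertion n w Xl Yl (inserted n \<pi> i) st (x w) (y w)"
      "valid_insertion.r w st (x w) (y w) = rtile w" "i < n" "?q w = int i + 1"
      "st = run n \<pi> x y i" "w = \<pi> (Suc i)" "run_invariant i"
      using step[OF w1] by blast
    interpret V: valid_insertion n w Xl Yl "inserted n \<pi> i" st "x w" "y w" by (rule V(1))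
    have i: "i \<le> n" using V(3) by simp
    have "w + 1 \<notin> inserted n \<pi> i" using w V(4) by (auto simp: mem_inserted[OF \<pi> i])
    then have na: "\<not> right_aligned st w" by (simp add: V.right_aligned_iff)
    have y: "ymin (rtile w) = ymax (V.R V.b)" using V.r_bounds(2) V(2) by simp
    have bT: "V.b \<in> inserted n \<pi> i" "w < V.b" using V.b_props V.PT by auto
    show ?thesis
    proof (cases "V.b = n + 1")
      case True
      then show ?thesis using run_invariantD(2,3)[OF V(7)] y by (simp add: V(5))
    next
      case False
      then have "V.b \<in> {1..n} \<and> ?q V.b \<le> int i" using bT by (auto simp: mem_inserted[OF \<pi> i])
      then have b: "V.b \<in> \<pi> ` {1..i}" "V.b \<in> {1..n}" by (simp_all only: mem_image_iff_position[OF \<pi> i])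
      then have R: "V.R V.b = rtile V.b" using bspec[OF run_invariantD(4)[OF V(7)] b(1)] by (simp add: V(5))
      note J = tj[unfolded T_joint_choice_def Let_def, rule_format, OF V(3), folded V(6), folded V(5)]
      have "max (xmin (V.R V.b)) (xmax (V.R V.a)) < x w \<and> x w < xmax (V.R V.b)"
        using conjunct2[OF J] na by blast
      moreover have "Xl w = x w" using w by (simp add: xline_def)
      ultimately show ?thesis using b(2) y R by auto
    qed
  qed
  show "xmin (rtile u) = 0 \<or> (\<exists>a\<in>{1..n}. xmax (rtile a) = xmin (rtile u) \<and> ymin (rtile a) < Yl u \<and> Yl u < ymax (rtile a))"
    if u: "u \<in> {2..n}" "?q u < ?q (u - 1)" for u
  proof -
    have u1: "u \<in> {1..n}" using u(1) by auto
    obtain st i where V: "valid_insertion n u Xl Yl (inserted n \<pi> i) st (x u) (y u)"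
      "valid_insertion.r u st (x u) (y u) = rtile u" "i < n" "?q u = int i + 1"
      "st = run n \<pi> x y i" "u = \<pi> (Suc i)" "run_invariant i"
      using step[OF u1] by blast
    interpret V: valid_insertion n u Xl Yl "inserted n \<pi> i" st "x u" "y u" by (rule V(1))
    have i: "i \<le> n" using V(3) by simp
    have "u - 1 \<notin> inserted n \<pi> i" using u V(4) by (auto simp: mem_inserted[OF \<pi> i])
    then have na: "\<not> top_aligned st u" by (simp add: V.top_aligned_iff)
    have y: "xmin (rtile u) = xmax (V.R V.a)" using V.r_bounds(1) V(2) by simp
    have aT: "V.a \<in> inserted n \<pi> i" "V.a < u" using V.a_props V.PT by auto
    show ?thesis
    proof (cases "V.a = 0")
      case True
      then show ?thesis using run_invariantD(2,3)[OF V(7)] y by (simp add: V(5))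
    next
      case False
      then have "V.a \<in> {1..n} \<and> ?q V.a \<le> int i" using aT u(1) by (auto simp: mem_inserted[OF \<pi> i])
      then have a: "V.a \<in> \<pi> ` {1..i}" "V.a \<in> {1..n}" by (simp_all only: mem_image_iff_position[OF \<pi> i])
      then have R: "V.R V.a = rtile V.a" using bspec[OF run_invariantD(4)[OF V(7)] a(1)] by (simp add: V(5))
      note J = tj[unfolded T_joint_choice_def Let_def, rule_format, OF V(3), folded V(6), folded V(5)]
      have "max (ymin (V.R V.a)) (ymax (V.R V.b)) < y u \<and> y u < ymax (V.R V.a)"
        using conjunct1[OF J] na by blast
      moreover have "Yl u = y u" using u by (simp add: yline_def)
      ultimately show ?thesis using a(2) y R by auto
    qed
  qed
qed

text \<open>On the grid, coordinates are monotone in the line index, and the neighbouring peaks have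
  coordinates of lines with indices on either side of \<open>j\<close>.\<close>

lemma weak_valid_step:
  assumes k: "k < n" and inv: "run_invariant k"
    and xy: "\<And>v. x v = real v" "\<And>v. y v = real n - real v + 1"
  defines "st \<equiv> run n \<pi> x y k" and "j \<equiv> \<pi> (Suc k)"
  shows "\<not> top_aligned st j \<Longrightarrow> ymax (rect_at st (next_peak st j)) < y j \<and> y j < ymax (rect_at st (prev_peak st j))"
    and "\<not> right_aligned st j \<Longrightarrow> xmax (rect_at st (prev_peak st j)) < x j \<and> x j < xmax (rect_at st (next_peak st j))"
proof -
  let ?T = "inserted n \<pi> k"
  interpret I: insertion n j Xl Yl ?T st
    unfolding j_def st_def by (rule run_insertion[OF k inv])
  obtain w where w: "w \<in> ?T" "w < j" "\<And>v. w < v \<Longrightarrow> v < j \<Longrightarrow> v \<notin> ?T" using I.ex_lower_run_end by blast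
  obtain u where u: "u \<in> ?T" "j < u" "\<And>v. j < v \<Longrightarrow> v < u \<Longrightarrow> v \<notin> ?T" using I.ex_upper_run_start by blast
  obtain s where s: "s < j" "ymax (I.R I.a) = Yl s" using I.ymax_a by blast
  obtain e where e: "j < e" "xmax (I.R I.b) = Xl e" using I.xmax_b by blast
  have b: "ymax (I.R I.b) = Yl u" "xmax (I.R I.a) = Xl w" using I.upper_run(3)[OF u] I.lower_run(3)[OF w] by simp_all
  have un: "u \<le> n + 1" using u(1) I.T by auto
  show "ymax (I.R I.b) < y j \<and> y j < ymax (I.R I.a)" if "\<not> top_aligned st j"
  proof -
    have "j - 1 \<noteq> 0" using that I.T(1) by (auto simp: I.top_aligned_iff)
    then show ?thesis unfolding b(1) s(2) using u(2) un s(1) I.j(2) by (auto simp: yline_def xy)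
  qed
  show "xmax (I.R I.a) < x j \<and> x j < xmax (I.R I.b)" if "\<not> right_aligned st j"
  proof -
    have "j + 1 \<noteq> n + 1" using that I.T(1) by (auto simp: I.right_aligned_iff)
    then show ?thesis unfolding b(2) e(2) using w(2) e(1) I.j(2) by (auto simp: xline_def xy)
  qed
qed

text \<open>The interval for a free side is nonempty: the staircase is strictly monotone, and the
  rectangle on which the side ends has positive extent, also when it is auxiliary.\<close>

lemma joint_room:
  assumes k: "k < n" and inv: "run_invariant k"
  defines "st \<equiv> run n \<pi> x y k" and "j \<equiv> \<pi> (Suc k)"
  shows "max (ymin (rect_at st (prev_peak st j))) (ymax (rect_at st (next_peak st j))) < ymax (rect_at st (prev_peak st j))"
    and "max (xmin (rect_at st (next_peak st j))) (xmax (rect_at st (prev_peak st j))) < xmax (rect_at st (next_peak st j))"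
proof -
  let ?T = "inserted n \<pi> k"
  interpret I: insertion n j Xl Yl ?T st
    unfolding j_def st_def by (rule run_insertion[OF k inv])
  note D = run_invariantD[OF inv, folded st_def]
  have pr: "xmin (I.R p) < xmax (I.R p) \<or> p = 0" "ymin (I.R p) < ymax (I.R p) \<or> p = n + 1" if pT: "p \<in> ?T" for p
  proof -
    consider "p = 0" | "p = n + 1" | "p \<in> \<pi> ` {1..k}" using pT unfolding inserted_def by blast
    then have "(xmin (I.R p) < xmax (I.R p) \<or> p = 0) \<and> (ymin (I.R p) < ymax (I.R p) \<or> p = n + 1)"
    proof cases
      case 3
      from bspec[OF D(4) this] show ?thesis by (simp add: proper_def)
    qed (use D(2,3) n in auto)
    then show "xmin (I.R p) < xmax (I.R p) \<or> p = 0" "ymin (I.R p) < ymax (I.R p) \<or> p = n + 1" by auto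
  qed
  have "I.a \<in> ?T" "I.b \<in> ?T" using I.a_props I.b_props I.PT by auto
  from pr(2)[OF this(1)] pr(1)[OF this(2)]
  have "ymin (I.R I.a) < ymax (I.R I.a)" "xmin (I.R I.b) < xmax (I.R I.b)"
    using I.a_props(2) I.b_props(2) I.j(2) by auto
  then show "max (ymin (I.R I.a)) (ymax (I.R I.b)) < ymax (I.R I.a)"
    "max (xmin (I.R I.b)) (xmax (I.R I.a)) < xmax (I.R I.b)"
    using I.peaks_ab by auto
qed

end

section \<open>Existence of admissible sizes\<close>

lemma weak_valid_choice:
  assumes "1 \<le> n" "\<pi> permutes {1..n}"
  shows "k \<le> n \<Longrightarrow> valid_choice n \<pi> (\<lambda>j. real j) (\<lambda>j. real n - real j + 1) k"
proof (induction k)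
  case (Suc k)
  let ?x = "\<lambda>j. real j" and ?y = "\<lambda>j. real n - real j + 1"
  have val: "valid_choice n \<pi> ?x ?y k" using Suc by simp
  then have inv: "run_invariant n \<pi> ?x ?y k" using run_invariant[OF assms] Suc.prems by simp
  have k: "k < n" using Suc.prems by simp
  show ?case unfolding valid_choice_def Let_def
  proof (intro allI impI)
    fix i assume "i < Suc k"
    then consider "i < k" | "i = k" by linarith
    then show "(\<not> top_aligned (run n \<pi> ?x ?y i) (\<pi> (Suc i)) \<longrightarrow>
      ymax (rect_at (run n \<pi> ?x ?y i) (next_peak (run n \<pi> ?x ?y i) (\<pi> (Suc i)))) < ?y (\<pi> (Suc i)) \<and>
      ?y (\<pi> (Suc i)) < ymax (rect_at (run n \<pi> ?x ?y i) (prev_peak (run n \<pi> ?x ?y i) (\<pi> (Suc i))))) \<and>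
      (\<not> right_aligned (run n \<pi> ?x ?y i) (\<pi> (Suc i)) \<longrightarrow>
      xmax (rect_at (run n \<pi> ?x ?y i) (prev_peak (run n \<pi> ?x ?y i) (\<pi> (Suc i)))) < ?x (\<pi> (Suc i)) \<and>
      ?x (\<pi> (Suc i)) < xmax (rect_at (run n \<pi> ?x ?y i) (next_peak (run n \<pi> ?x ?y i) (\<pi> (Suc i)))))"
    proof cases
      case 1
      then show ?thesis using val[unfolded valid_choice_def Let_def] by blast
    next
      case 2
      show ?thesis unfolding 2
        using weak_valid_step[OF assms k inv] by blast
    qed
  qed
qed (simp add: valid_choice_def)

text \<open>A state depends only on the sizes of the labels inserted so far; the others can be fixed
  afterwards.\<close>

lemma run_cong:
  "(\<And>i'. i' \<in> {1..i} \<Longrightarrow> x (\<pi> i') = x' (\<pi> i') \<and> y (\<pi> i') = y' (\<pi> i')) \<Longrightarrow> run n \<pi> x y i = run n \<pi> x' y' i"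
  by (induction i) (auto simp: Let_def)

definition joints_upto :: "nat \<Rightarrow> (nat \<Rightarrow> nat) \<Rightarrow> (nat \<Rightarrow> real) \<Rightarrow> (nat \<Rightarrow> real) \<Rightarrow> nat \<Rightarrow> bool" where
  "joints_upto n \<pi> x y k \<longleftrightarrow>
     (\<forall>i<k. let st = run n \<pi> x y i; j = \<pi> (Suc i);
                ra = the (snd st (prev_peak st j)); rb = the (snd st (next_peak st j))
            in (\<not> top_aligned st j \<longrightarrow> max (ymin ra) (ymax rb) < y j \<and> y j < ymax ra) \<and>
               (\<not> right_aligned st j \<longrightarrow> max (xmin rb) (xmax ra) < x j \<and> x j < xmax rb))"

lemma joints_upto_n: "joints_upto n \<pi> x y n \<longleftrightarrow> T_joint_choice n \<pi> x y"
  unfolding joints_upto_def T_joint_choice_def ..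

lemma joints_valid: "joints_upto n \<pi> x y k \<Longrightarrow> valid_choice n \<pi> x y k"
  unfolding joints_upto_def valid_choice_def Let_def by simp

text \<open>Sizes are chosen one label at a time: the state reached after \<open>k\<close> steps
  determines the interval for the next size, and changing the functions at the next label leaves the
  earlier states unchanged. This makes \<open>gamma_s\<close> nonempty.\<close>

lemma ex_joints:
  assumes "1 \<le> n" "\<pi> permutes {1..n}"
  shows "k \<le> n \<Longrightarrow> \<exists>x y. joints_upto n \<pi> x y k"
proof (induction k)
  case (Suc k)
  then obtain x y where J: "joints_upto n \<pi> x y k" by auto
  have inv: "run_invariant n \<pi> x y k" using run_invariant[OF assms] joints_valid[OF J] Suc.prems by simp
  have k: "k < n" using Suc.prems by simp
  let ?j = "\<pi> (Suc k)"
  define ra rb where "ra = rect_at (run n \<pi> x y k) (prev_peak (run n \<pi> x y k) ?j)"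
    and "rb = rect_at (run n \<pi> x y k) (next_peak (run n \<pi> x y k) ?j)"
  note room = joint_room[OF assms k inv, folded ra_def rb_def]
  obtain yj where yj: "max (ymin ra) (ymax rb) < yj" "yj < ymax ra" using dense[OF room(1)] by blast
  obtain xj where xj: "max (xmin rb) (xmax ra) < xj" "xj < xmax rb" using dense[OF room(2)] by blast
  let ?x = "x(?j := xj)" and ?y = "y(?j := yj)"
  have ne: "\<pi> i \<noteq> ?j" if "i \<noteq> Suc k" for i
    using permutes_inj[OF assms(2)] that by (auto dest: injD)
  have run: "run n \<pi> ?x ?y i = run n \<pi> x y i" if "i \<le> k" for i
    by (rule run_cong) (use ne that in auto)
  have "joints_upto n \<pi> ?x ?y (Suc k)"
    unfolding joints_upto_def
  proof (intro allI impI)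
    fix i assume i: "i < Suc k"
    then have r: "run n \<pi> ?x ?y i = run n \<pi> x y i" using run by simp
    show "let st = run n \<pi> ?x ?y i; j = \<pi> (Suc i);
                ra = the (snd st (prev_peak st j)); rb = the (snd st (next_peak st j))
            in (\<not> top_aligned st j \<longrightarrow> max (ymin ra) (ymax rb) < ?y j \<and> ?y j < ymax ra) \<and>
               (\<not> right_aligned st j \<longrightarrow> max (xmin rb) (xmax ra) < ?x j \<and> ?x j < xmax rb)"
    proof (cases "i = k")
      case True
      note r' = r[unfolded True]
      show ?thesis
        unfolding True Let_def r' unfolding ra_def[symmetric] rb_def[symmetric] using xj yj by simp
    next
      case False
      then have "i < k" using i by simp
      then have "?y (\<pi> (Suc i)) = y (\<pi> (Suc i))" "?x (\<pi> (Suc i)) = x (\<pi> (Suc i))" using ne by auto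
      then show ?thesis using J \<open>i < k\<close> unfolding r joints_upto_def Let_def by presburger
    qed
  qed
  then show ?case by blast
qed (simp add: joints_upto_def)

section \<open>Tilings given by line numbers\<close>

text \<open>Collects sides by index alone; that they are connected has to be proved, and is so for
  the lines inside the square.\<close>

definition lineset :: "nat \<Rightarrow> (nat \<Rightarrow> int) \<Rightarrow> (nat \<Rightarrow> real) \<Rightarrow> (nat \<Rightarrow> real) \<Rightarrow> nat \<Rightarrow> (real \<times> real) set" where
  "lineset n q X Y w = (\<Union>i\<in>{i\<in>{1..n}. right_line n q i = w}. right_side (tile n q X Y i)) \<union>
     (\<Union>j\<in>{j\<in>{1..n}. left_line q j = w}. left_side (tile n q X Y j))"

text \<open>If two lines touched, their union could form one segment and relate tiles that the
  indices keep apart.\<close>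

definition disjoint_lines :: "nat \<Rightarrow> (nat \<Rightarrow> int) \<Rightarrow> (nat \<Rightarrow> real) \<Rightarrow> (nat \<Rightarrow> real) \<Rightarrow> bool" where
  "disjoint_lines n q X Y \<longleftrightarrow> (\<forall>w w'. lineset n q X Y w \<inter> lineset n q X Y w' \<noteq> {} \<longrightarrow> w = w')"

lemma ex_maximum:
  fixes f :: "'a \<Rightarrow> int"
  assumes "finite A" "A \<noteq> {}"
  obtains a where "a \<in> A" "\<And>v. v \<in> A \<Longrightarrow> f v \<le> f a"
proof -
  have "Max (f ` A) \<in> f ` A" using assms by (intro Max_in) auto
  then obtain a where "a \<in> A" "f a = Max (f ` A)" by auto
  then show ?thesis using that[of a] assms(1) by simp
qed

text \<open>Abstract in \<open>q\<close>, \<open>X\<close> and \<open>Y\<close>, so that the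
  reflected data form another instance and supply the horizontal half of the results.\<close>

locale tiling =
  fixes n :: nat and q :: "nat \<Rightarrow> int" and X Y :: "nat \<Rightarrow> real"
  assumes n: "1 \<le> n" and q: "inj_on q {1..n}"
    and X0: "X 0 = 0" and Xn: "X n = real n" and Y1: "Y 1 = real n" and Yn: "Y (n + 1) = 0"
    and rectangulation: "rectangulation (grid_square n) (tile n q X Y ` {1..n})"
    and inj_cell: "inj_on (tile n q X Y) {1..n}"
begin

abbreviation "cell \<equiv> tile n q X Y"
abbreviation "RL \<equiv> right_line n q"
abbreviation "LL \<equiv> left_line q"
abbreviation "BL \<equiv> bottom_line n q"
abbreviation "TL \<equiv> top_line q"
abbreviation "line \<equiv> lineset n q X Y"

lemma cell_simps [simp]: "xmin (cell j) = X (LL j)" "ymin (cell j) = Y (BL j)"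
    "xmax (cell j) = X (RL j)" "ymax (cell j) = Y (TL j)"
  by (simp_all add: tile_def)

lemma cell_bounds:
  assumes "j \<in> {1..n}"
  shows "0 \<le> X (LL j)" "X (LL j) < X (RL j)" "X (RL j) \<le> n" "0 \<le> Y (BL j)" "Y (BL j) < Y (TL j)" "Y (TL j) \<le> n"
  using rectangulation_bounds[OF rectangulation imageI[OF assms]] by (simp_all add: grid_square_def)

lemmas RL_iff = right_line_iff[OF q] and LL_iff = left_line_iff[OF q]
  and BL_iff = bottom_line_iff[OF q] and TL_iff = top_line_iff[OF q]

section \<open>Sides along one line\<close>

lemma RLD:
  assumes "j \<in> {1..n}" "RL j = w"
  shows "j \<le> w" "w \<le> n" "w = n \<or> q j < q (w + 1)" "\<And>v. j < v \<Longrightarrow> v \<le> w \<Longrightarrow> q v < q j"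
  using RL_iff[OF assms(1), THEN iffD1, OF assms(2)] by simp_all

lemma LLD:
  assumes "j \<in> {1..n}" "LL j = w"
  shows "w < j" "w = 0 \<or> q w < q j" "\<And>v. w < v \<Longrightarrow> v < j \<Longrightarrow> q j < q v"
  using LL_iff[OF assms(1), THEN iffD1, OF assms(2)] by simp_all

lemma BLD:
  assumes "j \<in> {1..n}" "BL j = w"
  shows "j < w" "w \<le> n + 1" "w = n + 1 \<or> q w < q j" "\<And>v. j < v \<Longrightarrow> v < w \<Longrightarrow> q j < q v"
  using BL_iff[OF assms(1), THEN iffD1, OF assms(2)] by simp_all

lemma TLD:
  assumes "j \<in> {1..n}" "TL j = w"
  shows "1 \<le> w" "w \<le> j" "w = 1 \<or> q j < q (w - 1)" "\<And>v. w \<le> v \<Longrightarrow> v < j \<Longrightarrow> q v < q j"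
  using TL_iff[OF assms(1), THEN iffD1, OF assms(2)] by simp_all

lemma mem_line: "(c, t) \<in> line w \<longleftrightarrow> c = X w \<and>
    ((\<exists>i\<in>{1..n}. RL i = w \<and> Y (BL i) \<le> t \<and> t \<le> Y (TL i)) \<or>
     (\<exists>j\<in>{1..n}. LL j = w \<and> Y (BL j) \<le> t \<and> t \<le> Y (TL j)))"
  unfolding lineset_def by (auto simp: mem_right_side mem_left_side)

text \<open>Lines inside the square occur exactly at the ascents of \<open>q\<close>: there tile
  \<open>w\<close> has its right side and tile \<open>w + 1\<close> its left side on the
  line.\<close>

definition inner_line :: "nat \<Rightarrow> bool" where
  "inner_line w \<longleftrightarrow> 1 \<le> w \<and> w < n \<and> q w < q (w + 1)"

lemma RL_inner: assumes i: "i \<in> {1..n}" and w: "RL i = w" "w < n" shows "inner_line w"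
proof -
  have R: "i \<le> w" "q i < q (w + 1)" "\<And>v. i < v \<Longrightarrow> v \<le> w \<Longrightarrow> q v < q i"
    using RLD[OF i w(1)] w(2) by auto
  have "q w \<le> q i" using R(3)[of w] R(1) by (cases "i = w") auto
  then show ?thesis using R i w by (auto simp: inner_line_def)
qed

lemma LL_inner: assumes j: "j \<in> {1..n}" and w: "LL j = w" "0 < w" shows "inner_line w"
proof -
  have L: "w < j" "q w < q j" "\<And>v. w < v \<Longrightarrow> v < j \<Longrightarrow> q j < q v"
    using LLD[OF j w(1)] w(2) by auto
  have "q j \<le> q (w + 1)" using L(3)[of "w + 1"] L(1) by (cases "j = w + 1") auto
  then show ?thesis using L j w by (auto simp: inner_line_def)
qed

lemma inner_lineD:
  assumes "inner_line w"
  shows "w \<in> {1..n}" "w + 1 \<in> {1..n}" "RL w = w" "LL (w + 1) = w" "0 < X w" "X w < n"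
proof -
  show w: "w \<in> {1..n}" "w + 1 \<in> {1..n}" using assms by (auto simp: inner_line_def)
  show R: "RL w = w" by (subst RL_iff[OF w(1)]) (use assms in \<open>auto simp: inner_line_def\<close>)
  show L: "LL (w + 1) = w" by (subst LL_iff[OF w(2)]) (use assms in \<open>auto simp: inner_line_def\<close>)
  show "0 < X w" "X w < n" using cell_bounds(1,2)[OF w(1)] cell_bounds(2,3)[OF w(2)] unfolding R L by auto
qed

lemma line_cases:
  assumes "line w \<noteq> {}"
  obtains "w = 0" | "w = n" | "inner_line w"
proof -
  obtain c t where "(c, t) \<in> line w" using assms by auto
  then consider i where "i \<in> {1..n}" "RL i = w" | j where "j \<in> {1..n}" "LL j = w" unfolding mem_line by blast
  then show ?thesis
  proof cases
    case 1
    then show ?thesis using that RL_inner[OF 1] RLD(2)[OF 1] by (metis le_neq_implies_less)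
  next
    case 2
    then show ?thesis using that LL_inner[OF 2] by (metis neq0_conv)
  qed
qed

text \<open>The tile directly below \<open>i\<close> on the line is the last one inserted among
  \<open>i + 1\<close>, ..., \<open>w\<close>. All of these precede \<open>i\<close>, so its top is
  on horizontal line \<open>i + 1\<close>, which is also the bottom of \<open>i\<close>.\<close>

lemma right_sides_touch:
  assumes i: "i \<in> {1..n}" "RL i = w" "i \<noteq> w"
  obtains i' where "i < i'" "i' \<in> {1..n}" "RL i' = w" "TL i' = BL i"
proof -
  have R: "i \<le> w" "w \<le> n" "w = n \<or> q i < q (w + 1)" "\<And>v. i < v \<Longrightarrow> v \<le> w \<Longrightarrow> q v < q i"
    using RLD[OF i(1,2)] by auto
  have ne: "{i+1..w} \<noteq> {}" using R(1) i(3) by auto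
  obtain i' where i': "i' \<in> {i+1..w}" "\<And>v. v \<in> {i+1..w} \<Longrightarrow> q v \<le> q i'"
    using ex_maximum[OF _ ne, of q] by blast
  have lt: "q v < q i'" if "v \<in> {i+1..w}" "v \<noteq> i'" for v
  proof -
    have "v \<in> {1..n}" "i' \<in> {1..n}" using that(1) i'(1) R(2) by auto
    then have "q v \<noteq> q i'" using inj_on_eq_iff[OF q] that(2) by blast
    then show ?thesis using i'(2)[OF that(1)] by simp
  qed
  have n': "i' \<in> {1..n}" using i'(1) R(2) by auto
  have qi: "q i' < q i" using R(4)[of i'] i'(1) by auto
  have "RL i' = w" unfolding RL_iff[OF n'] using i'(1) R(2,3) lt qi by auto
  moreover have "TL i' = i + 1" unfolding TL_iff[OF n'] using i'(1) lt qi by auto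
  moreover have "BL i = i + 1" unfolding BL_iff[OF i(1)] using R(4)[of "i + 1"] i'(1) R(2) by auto
  ultimately show ?thesis using that[of i'] i'(1) n' by auto
qed

text \<open>Dually, the tile directly above \<open>j\<close> is the first one inserted among
  \<open>w + 1\<close>, ..., \<open>j - 1\<close>, all of which come after \<open>j\<close>.\<close>

lemma left_sides_touch:
  assumes j: "j \<in> {1..n}" "LL j = w" "j \<noteq> w + 1"
  obtains j' where "j' < j" "w < j'" "j' \<in> {1..n}" "LL j' = w" "BL j' = TL j"
proof -
  have L: "w < j" "w = 0 \<or> q w < q j" "\<And>v. w < v \<Longrightarrow> v < j \<Longrightarrow> q j < q v"
    using LLD[OF j(1,2)] by auto
  have ne: "{w+1..j-1} \<noteq> {}" using L(1) j(3) by auto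
  obtain j' where j': "j' \<in> {w+1..j-1}" "\<And>v. v \<in> {w+1..j-1} \<Longrightarrow> - q v \<le> - q j'"
    using ex_maximum[OF _ ne, of "\<lambda>v. - q v"] by blast
  have lt: "q j' < q v" if "v \<in> {w+1..j-1}" "v \<noteq> j'" for v
  proof -
    have "v \<in> {1..n}" "j' \<in> {1..n}" using that(1) j'(1) j(1) by auto
    then have "q v \<noteq> q j'" using inj_on_eq_iff[OF q] that(2) by blast
    then show ?thesis using j'(2)[OF that(1)] by simp
  qed
  have n': "j' \<in> {1..n}" "j' < j" using j'(1) j(1) by auto
  have qj: "q j < q j'" using L(3)[of j'] j'(1) by auto
  have "LL j' = w" unfolding LL_iff[OF n'(1)] using j'(1) L(2) lt qj by auto
  moreover have "BL j' = j" unfolding BL_iff[OF n'(1)] using j'(1) lt qj j(1) by auto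
  moreover have "TL j = j" unfolding TL_iff[OF j(1)] using L(3)[of "j - 1"] j'(1) by auto
  ultimately show ?thesis using that[of j'] j'(1) n' by auto
qed

text \<open>The two halves of the line have to be joined once. Among the labels from the top line of
  \<open>w + 1\<close> up to \<open>w\<close>, the last one inserted has its top at the same height
  as \<open>w + 1\<close>.\<close>

lemma sides_meet:
  assumes "inner_line w"
  obtains a where "a \<in> {1..n}" "RL a = w" "TL a = TL (w + 1)"
proof -
  note w = inner_lineD[OF assms]
  define s where "s = TL (w + 1)"
  have S: "1 \<le> s" "s \<le> w + 1" "s = 1 \<or> q (w + 1) < q (s - 1)" "\<And>v. s \<le> v \<Longrightarrow> v < w + 1 \<Longrightarrow> q v < q (w + 1)"
    using TLD[OF w(2) s_def[symmetric]] by auto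
  have "s \<noteq> w + 1" using S(3) assms by (auto simp: inner_line_def)
  then have ne: "{s..w} \<noteq> {}" using S(2) by auto
  obtain a where a: "a \<in> {s..w}" "\<And>v. v \<in> {s..w} \<Longrightarrow> q v \<le> q a"
    using ex_maximum[OF _ ne, of q] by blast
  have lt: "q v < q a" if "v \<in> {s..w}" "v \<noteq> a" for v
  proof -
    have "v \<in> {1..n}" "a \<in> {1..n}" using that(1) a(1) w(1) S(1) by auto
    then have "q v \<noteq> q a" using inj_on_eq_iff[OF q] that(2) by blast
    then show ?thesis using a(2)[OF that(1)] by simp
  qed
  have an: "a \<in> {1..n}" using a(1) w(1) S(1) by auto
  have qa: "q a < q (w + 1)" using S(4)[of a] a(1) by auto
  have "RL a = w" unfolding RL_iff[OF an] using a(1) lt qa w(1) by auto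
  moreover have "TL a = s" unfolding TL_iff[OF an] using a(1) lt qa S(1,3) by auto
  ultimately show ?thesis using that an s_def by blast
qed

text \<open>The reference point is the lower right corner of tile \<open>w\<close>, the lower end of
  the line; connecting every side to it makes the line connected.\<close>

definition linked :: "nat \<Rightarrow> (real \<times> real) set \<Rightarrow> bool" where
  "linked w V \<longleftrightarrow> (\<exists>C. connected C \<and> V \<subseteq> C \<and> (X w, Y (BL w)) \<in> C \<and> C \<subseteq> line w)"

lemma linkedI:
  assumes "linked w V" "z \<in> V" "z \<in> V'" "connected V'" "V' \<subseteq> line w"
  shows "linked w V'"
proof -
  obtain C where C: "connected C" "V \<subseteq> C" "(X w, Y (BL w)) \<in> C" "C \<subseteq> line w"
    using assms(1) unfolding linked_def by blast
  have "connected (C \<union> V')" using connected_Un[OF C(1) assms(4)] assms(2,3) C(2) by blast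
  then show ?thesis unfolding linked_def using C assms(5) by (intro exI[of _ "C \<union> V'"]) auto
qed

lemma right_side_line: "i \<in> {1..n} \<Longrightarrow> right_side (cell i) \<subseteq> line (RL i)"
  and left_side_line: "i \<in> {1..n} \<Longrightarrow> left_side (cell i) \<subseteq> line (LL i)"
  unfolding lineset_def by blast+

lemma connected_side: "connected (right_side r)" "connected (left_side r)"
  using compact_connected_sides by (auto simp: sides_def)

lemma right_linked:
  assumes "inner_line w"
  shows "i \<in> {1..n} \<Longrightarrow> RL i = w \<Longrightarrow> linked w (right_side (cell i)) \<and> Y (BL w) \<le> Y (BL i)"
proof (induction "n - i" arbitrary: i rule: less_induct)
  case less
  note w = inner_lineD[OF assms]
  show ?case
  proof (cases "i = w")
    case True
    have "linked w (right_side (cell w))"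
      unfolding linked_def using right_side_line[OF w(1)] connected_side cell_bounds(5)[OF w(1)] w(3)
      by (intro exI[of _ "right_side (cell w)"]) (auto simp: mem_right_side)
    then show ?thesis using True by simp
  next
    case False
    then obtain i' where i': "i < i'" "i' \<in> {1..n}" "RL i' = w" "TL i' = BL i"
      using right_sides_touch less.prems by blast
    then have l: "linked w (right_side (cell i'))" "Y (BL w) \<le> Y (BL i')" using less.hyps[of i'] by auto
    have "linked w (right_side (cell i))"
    proof (rule linkedI[OF l(1), of "(X w, Y (BL i))"])
      show "right_side (cell i) \<subseteq> line w" using right_side_line[OF less.prems(1)] less.prems(2) by simp
    qed (use cell_bounds(5)[OF i'(2)] cell_bounds(5)[OF less.prems(1)] i' less.prems connected_side
        in \<open>auto simp: mem_right_side\<close>)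
    then show ?thesis using l(2) cell_bounds(5)[OF i'(2)] i'(4) by auto
  qed
qed

lemma left_linked:
  assumes "inner_line w"
  shows "j \<in> {1..n} \<Longrightarrow> LL j = w \<Longrightarrow> linked w (left_side (cell j))"
proof (induction "j" rule: less_induct)
  case (less j)
  note w = inner_lineD[OF assms]
  have sub: "left_side (cell j) \<subseteq> line w" using left_side_line[OF less.prems(1)] less.prems(2) by simp
  show ?case
  proof (cases "j = w + 1")
    case True
    obtain a where a: "a \<in> {1..n}" "RL a = w" "TL a = TL (w + 1)" using sides_meet[OF assms] .
    show ?thesis
      by (rule linkedI[OF conjunct1[OF right_linked[OF assms a(1,2)]], of "(X w, Y (TL a))"])
        (use cell_bounds(5)[OF a(1)] cell_bounds(5)[OF w(2)] a True less.prems connected_side sub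
          in \<open>auto simp: mem_right_side mem_left_side\<close>)
  next
    case False
    then obtain j' where j': "j' < j" "j' \<in> {1..n}" "LL j' = w" "BL j' = TL j"
      using left_sides_touch less.prems by blast
    show ?thesis
      by (rule linkedI[OF less.IH[OF j'(1-3)], of "(X w, Y (TL j))"])
        (use cell_bounds(5)[OF j'(2)] cell_bounds(5)[OF less.prems(1)] j' less.prems connected_side sub
          in \<open>auto simp: mem_left_side\<close>)
  qed
qed

text \<open>Descending along the left sides: the label \<open>b\<close> of the bottom line of
  \<open>j\<close> has its own left side on line \<open>w\<close> and its top at the bottom of
  \<open>j\<close>, until \<open>b\<close> is the bottom line of \<open>w\<close> itself.\<close>

lemma left_above_bottom:
  assumes "inner_line w"
  shows "j \<in> {1..n} \<Longrightarrow> LL j = w \<Longrightarrow> Y (BL w) \<le> Y (BL j)"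
proof (induction "n - j" arbitrary: j rule: less_induct)
  case less
  note w = inner_lineD[OF assms]
  note j = less.prems
  have L: "w < j" "q w < q j" "\<And>v. w < v \<Longrightarrow> v < j \<Longrightarrow> q j < q v"
    using LLD[OF j] w(1) by auto
  define u where "u = BL w"
  have u: "w < u" "u \<le> n + 1" "u = n + 1 \<or> q u < q w" "\<And>v. w < v \<Longrightarrow> v < u \<Longrightarrow> q w < q v"
    using BLD[OF w(1) u_def[symmetric]] by auto
  define b where "b = BL j"
  have b: "j < b" "b \<le> n + 1" "b = n + 1 \<or> q b < q j" "\<And>v. j < v \<Longrightarrow> v < b \<Longrightarrow> q j < q v"
    using BLD[OF j(1) b_def[symmetric]] by auto
  have "j < u"
  proof (rule ccontr)
    assume "\<not> j < u"
    then show False using u L(3)[of u] L(2) j(1) by (cases "u = j") auto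
  qed
  have "b \<le> u"
  proof (rule ccontr)
    assume "\<not> b \<le> u"
    then have "q j < q u" "u \<noteq> n + 1" using b(2,4) \<open>j < u\<close> by auto
    then show False using u(3) L(2) by auto
  qed
  show ?case
  proof (cases "b = u")
    case True
    then show ?thesis by (simp add: b_def u_def)
  next
    case False
    then have bu: "b < u" "b \<in> {1..n}" using \<open>b \<le> u\<close> u(2) b(1) by auto
    then have qb: "q w < q b" "q b < q j" using u(4)[of b] b(1,3) L(1) by auto
    have lt: "q b < q v" if "w < v" "v < b" for v
      using L(3)[of v] b(4)[of v] qb(2) that by (cases "v = j"; cases "v < j") auto
    have "LL b = w" by (subst LL_iff[OF bu(2)]) (use lt qb L(1) b(1) in auto)
    then have "Y (BL w) \<le> Y (BL b)" using less.hyps[of b] bu(2) b(1) by auto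
    moreover have "TL b = b"
      by (subst TL_iff[OF bu(2)]) (use lt[of "b - 1"] L(1) b(1) bu(2) in auto)
    ultimately show ?thesis using cell_bounds(5)[OF bu(2)] b_def by simp
  qed
qed

lemma line_connected:
  assumes w: "inner_line w"
  shows "connected (line w)" "(X w, Y (BL w)) \<in> line w" "\<And>z. z \<in> line w \<Longrightarrow> Y (BL w) \<le> snd z"
proof -
  note d = inner_lineD[OF w]
  have l: "linked w V" if "V \<in> {right_side (cell i) |i. i \<in> {1..n} \<and> RL i = w} \<union> {left_side (cell j) |j. j \<in> {1..n} \<and> LL j = w}" for V
    using that right_linked[OF w] left_linked[OF w] by blast
  have "\<exists>C. connected C \<and> z \<in> C \<and> (X w, Y (BL w)) \<in> C \<and> C \<subseteq> line w" if z: "z \<in> line w" for z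
  proof -
    obtain V where "V \<in> {right_side (cell i) |i. i \<in> {1..n} \<and> RL i = w} \<union> {left_side (cell j) |j. j \<in> {1..n} \<and> LL j = w}" "z \<in> V"
      using z unfolding lineset_def by blast
    from l[OF this(1)] this(2) show ?thesis unfolding linked_def by blast
  qed
  then obtain C where C: "\<And>z. z \<in> line w \<Longrightarrow> connected (C z) \<and> z \<in> C z \<and> (X w, Y (BL w)) \<in> C z \<and> C z \<subseteq> line w"
    by metis
  have "(X w, Y (BL w)) \<in> \<Inter>(C ` line w)" using C by blast
  then have "connected (\<Union>(C ` line w))"
    using C by (intro connected_Union) blast+
  moreover have "\<Union>(C ` line w) = line w" using C by blast
  ultimately show "connected (line w)" by simp
  show "(X w, Y (BL w)) \<in> line w"
    unfolding mem_line using d(1,3) cell_bounds(5)[OF d(1)] by (auto intro!: bexI[of _ w])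
  show "Y (BL w) \<le> snd z" if z: "z \<in> line w" for z
  proof -
    obtain c t where ct: "z = (c, t)" by (cases z)
    from z[unfolded ct mem_line] show ?thesis
      using right_linked[OF w] left_above_bottom[OF w] unfolding ct by fastforce
  qed
qed

lemma line_interval:
  assumes w: "inner_line w" and z: "z \<in> line w" and t: "Y (BL w) \<le> t" "t \<le> snd z"
  shows "(X w, t) \<in> line w"
proof -
  note c = line_connected[OF w]
  have "connected (snd ` line w)" using c(1) by (intro connected_continuous_image continuous_on_snd continuous_on_id)
  moreover have "Y (BL w) \<in> snd ` line w" using c(2) by force
  moreover have "snd z \<in> snd ` line w" using z by blast
  ultimately have "t \<in> snd ` line w" using t by (rule connectedD_interval)
  then obtain p where "p \<in> line w" "snd p = t" by blast
  then show ?thesis using mem_line by (cases p) auto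
qed

lemma line_subset_sides:
  assumes "z \<in> line w"
  obtains e r where "z \<in> e" "r \<in> cell ` {1..n}" "e \<in> sides r" "e \<subseteq> line w"
proof -
  obtain c t where ct: "z = (c, t)" by (cases z)
  consider i where "i \<in> {1..n}" "RL i = w" "z \<in> right_side (cell i)"
    | j where "j \<in> {1..n}" "LL j = w" "z \<in> left_side (cell j)"
    using assms unfolding lineset_def by blast
  then show ?thesis
  proof cases
    case 1
    then show ?thesis using that[of "right_side (cell i)" "cell i"] right_side_line[OF 1(1)] by (auto simp: sides_def)
  next
    case 2
    then show ?thesis using that[of "left_side (cell j)" "cell j"] left_side_line[OF 2(1)] by (auto simp: sides_def)
  qed
qed

section \<open>Distinct lines do not touch\<close>

lemma overlap_eq:
  assumes "i \<in> {1..n}" "j \<in> {1..n}"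
    and "max (X (LL i)) (X (LL j)) < min (X (RL i)) (X (RL j))"
    and "max (Y (BL i)) (Y (BL j)) < min (Y (TL i)) (Y (TL j))"
  shows "i = j"
proof -
  obtain x where x: "max (X (LL i)) (X (LL j)) < x" "x < min (X (RL i)) (X (RL j))" using dense[OF assms(3)] by blast
  obtain y where y: "max (Y (BL i)) (Y (BL j)) < y" "y < min (Y (TL i)) (Y (TL j))" using dense[OF assms(4)] by blast
  have "(x, y) \<in> interior (region (cell i))" "(x, y) \<in> region (cell j)"
    using x y by (simp_all add: mem_interior_region mem_region)
  then have "cell i = cell j"
    using interior_region_disjoint[OF rectangulation imageI[OF assms(1)] imageI[OF assms(2)]] by blast
  then show ?thesis using inj_onD[OF inj_cell] assms(1,2) by blast
qed

text \<open>The lower end of a line lies inside a top side, which keeps every other line at the same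
  abscissa from reaching it from below.\<close>

lemma joints_disjoint_lines:
  assumes joints: "\<And>w. w \<in> {1..<n} \<Longrightarrow> q w < q (w + 1) \<Longrightarrow> Y (BL w) = 0 \<or>
      (\<exists>b\<in>{1..n}. Y (TL b) = Y (BL w) \<and> X (LL b) < X w \<and> X w < X (RL b))"
  shows "disjoint_lines n q X Y"
proof -
  have le: "w = w'" if w: "inner_line w" "inner_line w'" and z: "z \<in> line w" "z \<in> line w'"
    and le: "Y (BL w) \<le> Y (BL w')" for w w' z
  proof -
    note d = inner_lineD[OF w(1)] and d' = inner_lineD[OF w(2)]
    have X: "X w = X w'" using z mem_line by (cases z) auto
    show ?thesis
    proof (cases "Y (BL w) = Y (BL w')")
      \<comment> \<open>The tiles \<open>w\<close> and \<open>w'\<close> would have the same lower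
        right corner and therefore overlap.\<close>
      case True
      show ?thesis
        by (rule overlap_eq[OF d(1) d'(1)])
          (use d d' X True cell_bounds(2,5)[OF d(1)] cell_bounds(2,5)[OF d'(1)] in auto)
    next
      case False
      then have lt: "Y (BL w) < Y (BL w')" using le by simp
      then have "Y (BL w') \<noteq> 0" using cell_bounds(4)[OF d(1)] by simp
      then obtain b where b: "b \<in> {1..n}" "Y (TL b) = Y (BL w')" "X (LL b) < X w'" "X w' < X (RL b)"
        using joints[of w'] w(2) by (auto simp: inner_line_def)
      \<comment> \<open>A height just below the lower end of line \<open>w'\<close>, inside tile
        \<open>b\<close>. Line \<open>w\<close> starts lower and reaches up to \<open>z\<close>, so
        it would pass through the interior of this tile.\<close>
      obtain t where t: "max (Y (BL w)) (Y (BL b)) < t" "t < Y (BL w')"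
        using dense[of "max (Y (BL w)) (Y (BL b))" "Y (BL w')"] lt cell_bounds(5)[OF b(1)] b(2) by auto
      have "Y (BL w') \<le> snd z" using line_connected(3)[OF w(2) z(2)] .
      then have "(X w, t) \<in> line w" using line_interval[OF w(1) z(1), of t] t by simp
      then obtain e r where e: "(X w, t) \<in> e" "r \<in> cell ` {1..n}" "e \<in> sides r" by (rule line_subset_sides)
      moreover have "(X w, t) \<in> interior (region (cell b))" using b t X by (simp add: mem_interior_region)
      ultimately show ?thesis
        using interior_region_sides_disjoint[OF rectangulation imageI[OF b(1)] e(2,3)] by blast
    qed
  qed
  show ?thesis unfolding disjoint_lines_def
  proof (intro allI impI)
    fix w w' assume "line w \<inter> line w' \<noteq> {}"
    then obtain z where z: "z \<in> line w" "z \<in> line w'" by blast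
    have X: "X w = X w'" using z mem_line by (cases z) auto
    have c: "w = 0 \<or> w = n \<or> inner_line w" "w' = 0 \<or> w' = n \<or> inner_line w'"
      using z line_cases by (metis empty_iff)+
    show "w = w'"
    proof (cases "inner_line w \<and> inner_line w'")
      case True
      then show ?thesis using le[of w w' z] le[of w' w z] z by (metis linear)
    next
      \<comment> \<open>Inner lines have abscissae strictly between \<open>0\<close> and
        \<open>n\<close>, so none of them meets a vertical side of the square.\<close>
      case False
      then show ?thesis using c X inner_lineD(5,6)[of w] inner_lineD(5,6)[of w'] n X0 Xn by auto
    qed
  qed
qed

lemma injective_disjoint_lines:
  assumes "inj_on X {0..n}"
  shows "disjoint_lines n q X Y"
  unfolding disjoint_lines_def
proof (intro allI impI)
  fix w w' assume "line w \<inter> line w' \<noteq> {}"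
  then obtain z where z: "z \<in> line w" "z \<in> line w'" by blast
  have X: "X w = X w'" using z mem_line by (cases z) auto
  have "w = 0 \<or> w = n \<or> inner_line w" "w' = 0 \<or> w' = n \<or> inner_line w'"
    using z line_cases by (metis empty_iff)+
  then have "w \<in> {0..n}" "w' \<in> {0..n}" by (auto simp: inner_line_def)
  then show "w = w'" using X assms by (auto dest: inj_onD)
qed

lemma line_straight_union:
  assumes w: "inner_line w"
  shows "straight_union_of_sides (cell ` {1..n}) (line w)"
proof -
  note d = inner_lineD[OF w]
  let ?Q = "right_side ` cell ` {i\<in>{1..n}. RL i = w} \<union> left_side ` cell ` {j\<in>{1..n}. LL j = w}"
  have Q: "line w = \<Union>?Q" unfolding lineset_def by blast
  show ?thesis unfolding Q
  proof (rule vertical_straight_union[of _ _ "X w" "Y (BL w)" "Y (TL w)"])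
    show "finite ?Q" by simp
    show "?Q \<subseteq> (\<Union>r\<in>cell ` {1..n}. sides r)" by (auto simp: sides_def)
    show "\<Union>?Q \<subseteq> {X w} \<times> UNIV" unfolding Q[symmetric] using mem_line by auto
    show "connected (\<Union>?Q)" unfolding Q[symmetric] by (rule line_connected(1)[OF w])
    have "(X w, Y (BL w)) \<in> line w" "(X w, Y (TL w)) \<in> line w"
      unfolding mem_line using d(1,3) cell_bounds(5)[OF d(1)] by (auto intro!: bexI[of _ w])
    then show "(X w, Y (BL w)) \<in> \<Union>?Q" "(X w, Y (TL w)) \<in> \<Union>?Q" unfolding Q[symmetric] .
    show "Y (BL w) \<noteq> Y (TL w)" using cell_bounds(5)[OF d(1)] by simp
  qed
qed

section \<open>On-the-left in terms of line indices\<close>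

lemma left_of_left_step:
  assumes "left_of n q i j"
  shows "left_step (grid_square n) (cell ` {1..n}) (cell i) (cell j)"
proof -
  have i: "i \<in> {1..n}" and j: "j \<in> {1..n}" and e: "RL i = LL j" using assms by (auto simp: left_of_def)
  have "RL i < n" using LLD(1)[OF j refl] j e by auto
  then have w: "inner_line (RL i)" using RL_inner[OF i refl] by simp
  show ?thesis
    by (rule left_stepI[OF rectangulation imageI[OF i] imageI[OF j] line_straight_union[OF w]])
      (use right_side_line[OF i] left_side_line[OF j] e in auto)
qed

lemma closed_line: "closed (line w)"
proof -
  have "closed (right_side r)" "closed (left_side r)" for r
    using compact_connected_sides[of _ r] compact_imp_closed by (auto simp: sides_def)
  then show ?thesis unfolding lineset_def by (intro closed_Un closed_UN) auto
qed

text \<open>A segment through the right side of \<open>i\<close> is covered by finitely many closed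
  lines that are pairwise disjoint. Being connected, it stays within the line of \<open>i\<close>,
  and so the left side of \<open>j\<close> meets that line.\<close>

lemma left_step_left_of:
  assumes dis: "disjoint_lines n q X Y" and i: "i \<in> {1..n}" and j: "j \<in> {1..n}"
    and st: "left_step (grid_square n) (cell ` {1..n}) (cell i) (cell j)"
  shows "left_of n q i j"
proof -
  let ?D = "cell ` {1..n}" and ?w = "RL i"
  obtain s where s: "segment (grid_square n) ?D s" "right_side (cell i) \<subseteq> s" "left_side (cell j) \<subseteq> s"
    using st unfolding left_step_def by blast
  obtain p p' where pq: "s = closed_segment p p'" using segment_closed_segment[OF s(1)] .
  have pts: "(X ?w, Y (BL i)) \<in> s" "(X ?w, Y (TL i)) \<in> s"
    by (rule subsetD[OF s(2)], use cell_bounds(5)[OF i] in \<open>simp add: mem_right_side\<close>)+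
  have fst: "fst z = X ?w" if "z \<in> s" for z
    using closed_segment_vertical[OF pts[unfolded pq], of z] that cell_bounds(5)[OF i] unfolding pq by simp
  obtain Q where Q: "Q \<subseteq> (\<Union>r\<in>?D. sides r)" "s = \<Union>Q"
    using s(1) unfolding segment_def straight_union_of_sides_def by blast
  have cover: "\<exists>w\<in>{0..n}. z \<in> line w" if z: "z \<in> s" for z
  proof -
    obtain e where e: "e \<in> Q" "z \<in> e" using z Q(2) by blast
    obtain r where "r \<in> ?D" "e \<in> sides r" using e(1) Q(1) by blast
    then obtain k where k: "k \<in> {1..n}" "e \<in> sides (cell k)" by blast
    have es: "e \<subseteq> s" using e(1) Q(2) by blast
    note b = cell_bounds(2)[OF k(1)]
    \<comment> \<open>A horizontal side contains two different abscissae and cannot be part of the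
      vertical segment.\<close>
    have horizontal: False if "(X (LL k), t) \<in> e" "(X (RL k), t) \<in> e" for t
      using fst[of "(X (LL k), t)"] fst[of "(X (RL k), t)"] subsetD[OF es that(1)] subsetD[OF es that(2)] b by simp
    consider "e = left_side (cell k)" | "e = right_side (cell k)" | "e = bottom_side (cell k)" | "e = top_side (cell k)"
      using k(2) by (auto simp: sides_def)
    then show ?thesis
    proof cases
      case 1
      have "LL k \<in> {0..n}" using LLD(1)[OF k(1) refl] k(1) by auto
      then show ?thesis using 1 e(2) left_side_line[OF k(1)] by blast
    next
      case 2
      have "RL k \<in> {0..n}" using RLD(2)[OF k(1) refl] by auto
      then show ?thesis using 2 e(2) right_side_line[OF k(1)] by blast
    next
      case 3
      then show ?thesis using horizontal[of "Y (BL k)"] b by (auto simp: bottom_side_def)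
    next
      case 4
      then show ?thesis using horizontal[of "Y (TL k)"] b by (auto simp: top_side_def)
    qed
  qed
  define U where "U = (\<Union>w\<in>{0..n} - {?w}. line w)"
  have U: "closed U" unfolding U_def using closed_line by (intro closed_UN) auto
  have disj: "line ?w \<inter> U = {}" using dis unfolding U_def disjoint_lines_def by blast
  have "s \<subseteq> line ?w \<union> U" using cover unfolding U_def by blast
  moreover have "connected s" unfolding pq by simp
  moreover have "(X ?w, Y (BL i)) \<in> line ?w"
    by (rule subsetD[OF right_side_line[OF i]]) (use cell_bounds(5)[OF i] in \<open>simp add: mem_right_side\<close>)
  then have "line ?w \<inter> s \<noteq> {}" using pts(1) by blast
  ultimately have "U \<inter> s = {}"
    using connected_closedD[of s "line ?w" U] closed_line[of ?w] U disj by blast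
  then have "s \<subseteq> line ?w" using \<open>s \<subseteq> line ?w \<union> U\<close> by blast
  moreover have "(X (LL j), Y (BL j)) \<in> left_side (cell j)" using cell_bounds(5)[OF j] by (simp add: mem_left_side)
  ultimately have "line ?w \<inter> line (LL j) \<noteq> {}" using s(3) left_side_line[OF j] by blast
  then have "?w = LL j" using dis unfolding disjoint_lines_def by blast
  then show ?thesis using i j by (simp add: left_of_def)
qed

lemma on_the_left_iff:
  assumes dis: "disjoint_lines n q X Y" and i: "i \<in> {1..n}" and j: "j \<in> {1..n}"
  shows "on_the_left (grid_square n) (cell ` {1..n}) (cell i) (cell j) \<longleftrightarrow> (left_of n q)\<^sup>*\<^sup>* i j"
proof
  have "(left_step (grid_square n) (cell ` {1..n}))\<^sup>*\<^sup>* (cell i) r \<Longrightarrow>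
    \<exists>k\<in>{1..n}. r = cell k \<and> (left_of n q)\<^sup>*\<^sup>* i k" for r
  proof (induction rule: rtranclp_induct)
    case base
    then show ?case using i by blast
  next
    case (step r r')
    then obtain k where k: "k \<in> {1..n}" "r = cell k" "(left_of n q)\<^sup>*\<^sup>* i k" by blast
    have "r' \<in> cell ` {1..n}" using step.hyps(2) by (simp add: left_step_def)
    then obtain k' where k': "k' \<in> {1..n}" "r' = cell k'" by blast
    have "left_of n q k k'" using left_step_left_of[OF dis k(1) k'(1)] step.hyps(2) k(2) k'(2) by simp
    then have "(left_of n q)\<^sup>*\<^sup>* i k'" using k(3) by (rule rtranclp.rtrancl_into_rtrancl[rotated])
    then show ?case using k' by blast
  qed
  moreover assume "on_the_left (grid_square n) (cell ` {1..n}) (cell i) (cell j)"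
  ultimately obtain k where "k \<in> {1..n}" "cell j = cell k" "(left_of n q)\<^sup>*\<^sup>* i k"
    unfolding on_the_left_eq by blast
  then show "(left_of n q)\<^sup>*\<^sup>* i j" using inj_onD[OF inj_cell] j by metis
next
  assume "(left_of n q)\<^sup>*\<^sup>* i j"
  then show "on_the_left (grid_square n) (cell ` {1..n}) (cell i) (cell j)"
    unfolding on_the_left_eq
  proof (induction rule: rtranclp_induct)
    case (step k k')
    then show ?case using left_of_left_step by (meson rtranclp.rtrancl_into_rtrancl)
  qed simp
qed

section \<open>Reflected tilings, below and genericity\<close>

lemma reflect_tile:
  assumes "j \<in> {1..n}"
  shows "tile n (reflect n q) (reflect n Y) (reflect n X) (n + 1 - j) = transpose_rect (tile n q X Y j)"
proof -
  have "BL j \<le> n + 1" "TL j \<le> n + 1" "LL j \<le> n + 1" "RL j \<le> n + 1"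
    using BLD(2)[OF assms refl] TLD(2)[OF assms refl] LLD(1)[OF assms refl] RLD(2)[OF assms refl] assms by auto
  then show ?thesis
    unfolding tile_def transpose_rect_def reflect_lines[OF q assms] by (simp add: reflect_def)
qed

lemma reflect_image: "(\<lambda>j. n + 1 - j) ` {1..n} = {1..n}"
proof
  show "{1..n} \<subseteq> (\<lambda>j. n + 1 - j) ` {1..n}"
  proof
    fix j assume "j \<in> {1..n}"
    then have "n + 1 - j \<in> {1..n}" "j = n + 1 - (n + 1 - j)" by auto
    then show "j \<in> (\<lambda>j. n + 1 - j) ` {1..n}" by blast
  qed
qed auto

lemma reflect_tiles:
  "tile n (reflect n q) (reflect n Y) (reflect n X) ` {1..n} = transpose_rect ` tile n q X Y ` {1..n}"
proof -
  have "tile n (reflect n q) (reflect n Y) (reflect n X) ` {1..n} =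
    (\<lambda>j. tile n (reflect n q) (reflect n Y) (reflect n X) (n + 1 - j)) ` {1..n}"
    using reflect_image by (metis image_image)
  also have "\<dots> = (\<lambda>j. transpose_rect (tile n q X Y j)) ` {1..n}"
    by (rule image_cong) (use reflect_tile in auto)
  finally show ?thesis by (simp only: image_image)
qed

lemma transpose_grid: "transpose_rect (grid_square n) = grid_square n"
  by (simp add: transpose_rect_def grid_square_def)

lemma reflect_tiling: "tiling n (reflect n q) (reflect n Y) (reflect n X)"
proof
  show "inj_on (reflect n q) {1..n}" by (rule inj_on_reflect[OF q])
  show "rectangulation (grid_square n) (tile n (reflect n q) (reflect n Y) (reflect n X) ` {1..n})"
    using rectangulation_transpose[OF rectangulation] unfolding reflect_tiles transpose_grid .
  show "inj_on (tile n (reflect n q) (reflect n Y) (reflect n X)) {1..n}"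
  proof (rule inj_onI)
    fix i j assume ij: "i \<in> {1..n}" "j \<in> {1..n}"
      "tile n (reflect n q) (reflect n Y) (reflect n X) i = tile n (reflect n q) (reflect n Y) (reflect n X) j"
    then have m: "n + 1 - i \<in> {1..n}" "n + 1 - j \<in> {1..n}" and e: "n + 1 - (n + 1 - i) = i" "n + 1 - (n + 1 - j) = j" by auto
    have "cell (n + 1 - i) = cell (n + 1 - j)"
      using reflect_tile[OF m(1)] reflect_tile[OF m(2)] ij(3) unfolding e by simp
    then have "n + 1 - i = n + 1 - j" using inj_onD[OF inj_cell] m by blast
    then show "i = j" using e by metis
  qed
qed (use n X0 Xn Y1 Yn in \<open>simp_all add: reflect_def\<close>)

lemma below_iff:
  assumes dis: "disjoint_lines n (reflect n q) (reflect n Y) (reflect n X)" and i: "i \<in> {1..n}" and j: "j \<in> {1..n}"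
  shows "below (grid_square n) (cell ` {1..n}) (cell i) (cell j) \<longleftrightarrow> (below_of n q)\<^sup>*\<^sup>* i j"
proof -
  have m: "n + 1 - i \<in> {1..n}" "n + 1 - j \<in> {1..n}" using i j by auto
  show ?thesis
    unfolding below_transpose rtranclp_below_of_reflect[OF q i j]
    using tiling.on_the_left_iff[OF reflect_tiling dis m]
    unfolding reflect_tiles transpose_grid reflect_tile[OF i] reflect_tile[OF j] .
qed

lemma touching_left_right:
  assumes dis: "disjoint_lines n q X Y" and "i \<in> {1..n}" "j \<in> {1..n}"
    and "z \<in> right_side (cell i)" "z \<in> left_side (cell j)"
  shows "RL i = LL j"
  using assms right_side_line[of i] left_side_line[of j] unfolding disjoint_lines_def by blast

lemma touching_top_bottom:
  assumes dis: "disjoint_lines n (reflect n q) (reflect n Y) (reflect n X)" and i: "i \<in> {1..n}" and j: "j \<in> {1..n}"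
    and "z \<in> top_side (cell i)" "z \<in> bottom_side (cell j)"
  shows "TL i = BL j"
proof -
  have m: "n + 1 - i \<in> {1..n}" "n + 1 - j \<in> {1..n}" using i j by auto
  have "prod.swap z \<in> prod.swap ` top_side (cell i)" "prod.swap z \<in> prod.swap ` bottom_side (cell j)"
    using assms(4,5) by blast+
  then have "right_line n (reflect n q) (n + 1 - i) = left_line (reflect n q) (n + 1 - j)"
    using tiling.touching_left_right[OF reflect_tiling dis m, of "prod.swap z"]
    unfolding reflect_tile[OF i] reflect_tile[OF j] transpose_rect_sides by blast
  then have "n + 1 - TL i = n + 1 - BL j" unfolding reflect_lines[OF q i] reflect_lines[OF q j] .
  moreover have "TL i \<le> n + 1" "BL j \<le> n + 1" using TLD(2)[OF i refl] BLD(2)[OF j refl] i by auto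
  ultimately show ?thesis by linarith
qed

text \<open>Of the four kinds of corners, each occurs at most once at a point, since two tiles with
  the same kind of corner there would overlap. A lower left corner of \<open>j\<close> and an upper
  right corner of \<open>k\<close> exclude each other: the common vertical line gives
  \<open>k < j\<close>, the common horizontal line \<open>j < k\<close>.\<close>

lemma tiling_generic:
  assumes disX: "disjoint_lines n q X Y" and disY: "disjoint_lines n (reflect n q) (reflect n Y) (reflect n X)"
  shows "generic (cell ` {1..n})"
  unfolding generic_def
proof
  fix p :: "real \<times> real"
  obtain c d where p: "p = (c, d)" by (cases p)
  define A where "A f g = {r \<in> cell ` {1..n}. f r = c \<and> g r = d}" for f g :: "rect \<Rightarrow> real"
  have fin: "finite (A f g)" for f g by (simp add: A_def)
  have one: "card (A f g) \<le> 1" if "f = xmin \<or> f = xmax" "g = ymin \<or> g = ymax" for f g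
  proof -
    have "r = r'" if r: "r \<in> A f g" "r' \<in> A f g" for r r'
    proof -
      obtain i j where ij: "i \<in> {1..n}" "r = cell i" "j \<in> {1..n}" "r' = cell j" using r unfolding A_def by blast
      have "i = j"
        by (rule overlap_eq[OF ij(1,3)])
          (use r ij \<open>f = xmin \<or> f = xmax\<close> \<open>g = ymin \<or> g = ymax\<close> cell_bounds(2,5)[OF ij(1)] cell_bounds(2,5)[OF ij(3)]
            in \<open>auto simp: A_def\<close>)
      then show ?thesis using ij by simp
    qed
    then have "\<forall>r\<in>A f g. \<forall>r'\<in>A f g. r = r'" by blast
    then show ?thesis using card_le_Suc0_iff_eq[OF fin, of f g] by simp
  qed
  have C: "{r \<in> cell ` {1..n}. p \<in> corners r} \<subseteq> (A xmin ymin \<union> A xmax ymax) \<union> (A xmin ymax \<union> A xmax ymin)"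
    by (auto simp: corners_def A_def p)
  have "A xmin ymin = {} \<or> A xmax ymax = {}"
  proof (rule ccontr)
    assume "\<not> (A xmin ymin = {} \<or> A xmax ymax = {})"
    then obtain r r' where "r \<in> A xmin ymin" "r' \<in> A xmax ymax" by blast
    then obtain j k where j: "j \<in> {1..n}" "X (LL j) = c" "Y (BL j) = d" and k: "k \<in> {1..n}" "X (RL k) = c" "Y (TL k) = d"
      unfolding A_def by auto
    have "RL k = LL j"
      by (rule touching_left_right[OF disX k(1) j(1), of p])
        (use j k cell_bounds(5)[OF j(1)] cell_bounds(5)[OF k(1)] in \<open>auto simp: p mem_right_side mem_left_side\<close>)
    moreover have "TL k = BL j"
      by (rule touching_top_bottom[OF disY k(1) j(1), of p])
        (use j k cell_bounds(2)[OF j(1)] cell_bounds(2)[OF k(1)] in \<open>auto simp: p top_side_def bottom_side_def\<close>)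
    ultimately show False
      using RLD(1)[OF k(1) refl] LLD(1)[OF j(1) refl] TLD(2)[OF k(1) refl] BLD(1)[OF j(1) refl] by simp
  qed
  then have "card (A xmin ymin \<union> A xmax ymax) \<le> 1" using one by auto
  moreover have "card (A xmin ymax \<union> A xmax ymin) \<le> 2"
    using card_Un_le[of "A xmin ymax" "A xmax ymin"] one[of xmin ymax] one[of xmax ymin] by simp
  ultimately have "card ((A xmin ymin \<union> A xmax ymax) \<union> (A xmin ymax \<union> A xmax ymin)) \<le> 3"
    using card_Un_le[of "A xmin ymin \<union> A xmax ymax" "A xmin ymax \<union> A xmax ymin"] by linarith
  moreover have "card {r \<in> cell ` {1..n}. p \<in> corners r} \<le> card ((A xmin ymin \<union> A xmax ymax) \<union> (A xmin ymax \<union> A xmax ymin))"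
    using C fin by (intro card_mono) auto
  ultimately show "card {r \<in> cell ` {1..n}. p \<in> corners r} < 4" by linarith
qed

text \<open>The T-joints of free tops become, after reflection, T-joints of free right
  sides.\<close>

lemma joints_disjoint_lines_reflect:
  assumes joints: "\<And>u. u \<in> {2..n} \<Longrightarrow> q u < q (u - 1) \<Longrightarrow> X (LL u) = 0 \<or>
      (\<exists>a\<in>{1..n}. X (RL a) = X (LL u) \<and> Y (BL a) < Y u \<and> Y u < Y (TL a))"
  shows "disjoint_lines n (reflect n q) (reflect n Y) (reflect n X)"
proof (rule tiling.joints_disjoint_lines[OF reflect_tiling])
  let ?tile' = "tile n (reflect n q) (reflect n Y) (reflect n X)"
  fix w assume w: "w \<in> {1..<n}" "reflect n q w < reflect n q (w + 1)"
  define u where "u = n + 1 - w"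
  have u: "u \<in> {2..n}" "u \<in> {1..n}" "w = n + 1 - u" using w(1) by (auto simp: u_def)
  have "q u < q (u - 1)" using w(2) by (simp add: reflect_def u_def)
  note tw = reflect_tile[OF u(2), folded u(3)]
  have ymin: "reflect n X (bottom_line n (reflect n q) w) = X (LL u)"
    using arg_cong[OF tw, of ymin] by (simp add: tile_def)
  from joints[OF u(1) \<open>q u < q (u - 1)\<close>]
  show "reflect n X (bottom_line n (reflect n q) w) = 0 \<or>
    (\<exists>b\<in>{1..n}. reflect n X (top_line (reflect n q) b) = reflect n X (bottom_line n (reflect n q) w) \<and>
      reflect n Y (left_line (reflect n q) b) < reflect n Y w \<and>
      reflect n Y w < reflect n Y (right_line n (reflect n q) b))"
  proof
    assume "X (LL u) = 0"
    then show ?thesis using ymin by simp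
  next
    assume "\<exists>a\<in>{1..n}. X (RL a) = X (LL u) \<and> Y (BL a) < Y u \<and> Y u < Y (TL a)"
    then obtain a where a: "a \<in> {1..n}" "X (RL a) = X (LL u)" "Y (BL a) < Y u" "Y u < Y (TL a)" by blast
    note ta = reflect_tile[OF a(1)]
    have "reflect n X (top_line (reflect n q) (n + 1 - a)) = X (RL a)"
      "reflect n Y (left_line (reflect n q) (n + 1 - a)) = Y (BL a)"
      "reflect n Y (right_line n (reflect n q) (n + 1 - a)) = Y (TL a)"
      using arg_cong[OF ta, of ymax] arg_cong[OF ta, of xmin] arg_cong[OF ta, of xmax] by (simp_all add: tile_def)
    moreover have "reflect n Y w = Y u" by (simp add: reflect_def u_def)
    moreover have "n + 1 - a \<in> {1..n}" using a(1) by auto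
    ultimately show ?thesis using a ymin by (intro disjI2 bexI[of _ "n + 1 - a"]) simp_all
  qed
qed

end

section \<open>Drawings and mesh patterns\<close>

lemma weak_iso_id: "weak_iso R D R D id"
  unfolding weak_iso_def by simp

lemma strong_iso_id: "strong_iso R D R D id"
  unfolding strong_iso_def using weak_iso_id by simp

text \<open>Separability sees only the two relations that \<open>weak_iso\<close> preserves. This
  invariance lets one representative decide for the whole class.\<close>

lemma weak_iso_guillotine_iff:
  assumes "rectangulation R D" "rectangulation R' D'" "weak_iso R D R' D' f"
  shows "guillotine R D \<longleftrightarrow> guillotine R' D'"
proof -
  have f: "bij_betw f D D'"
    and L: "\<And>r r'. r \<in> D \<Longrightarrow> r' \<in> D \<Longrightarrow> on_the_left R D r r' \<longleftrightarrow> on_the_left R' D' (f r) (f r')"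
    and B: "\<And>r r'. r \<in> D \<Longrightarrow> r' \<in> D \<Longrightarrow> below R D r r' \<longleftrightarrow> below R' D' (f r) (f r')"
    using assms(3) unfolding weak_iso_def by blast+
  show ?thesis
    unfolding guillotine_iff_separable[OF assms(1)] guillotine_iff_separable[OF assms(2)]
    using f L B by (rule separable_bij)
qed

lemma (in tiling) guillotine_tiles_iff:
  assumes "disjoint_lines n q X Y" and "disjoint_lines n (reflect n q) (reflect n Y) (reflect n X)"
  shows "guillotine (grid_square n) (cell ` {1..n}) \<longleftrightarrow> interval_sep q 1 n"
proof -
  have "separable (left_of n q)\<^sup>*\<^sup>* (below_of n q)\<^sup>*\<^sup>* {1..n} \<longleftrightarrow>
    separable (on_the_left (grid_square n) (cell ` {1..n})) (below (grid_square n) (cell ` {1..n})) (cell ` {1..n})"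
    by (rule separable_bij[of cell])
      (use inj_cell on_the_left_iff[OF assms(1)] below_iff[OF assms(2)] in \<open>auto simp: bij_betw_def\<close>)
  then show ?thesis
    using guillotine_iff_separable[OF rectangulation] interval_sep_iff_separable[OF q, of 1 n] n by simp
qed

lemma tiling_drawing:
  assumes "1 \<le> n" "\<pi> permutes {1..n}" "valid_choice n \<pi> x y n"
  shows "tiling n (position \<pi>) (xline n x) (yline n y)"
    and "drawing n \<pi> x y = tile n (position \<pi>) (xline n x) (yline n y) ` {1..n}"
proof -
  show "drawing n \<pi> x y = tile n (position \<pi>) (xline n x) (yline n y) ` {1..n}"
    by (rule drawing_eq[OF assms])
  show "tiling n (position \<pi>) (xline n x) (yline n y)"
    using position_inj[OF assms(2)] tiles_rectangulation[OF assms] assms(1)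
    by unfold_locales (auto simp: xline_def yline_def)
qed

lemma weak_drawing:
  assumes "1 \<le> n" "\<pi> permutes {1..n}"
  defines "D \<equiv> drawing n \<pi> (\<lambda>j. real j) (\<lambda>j. real n - real j + 1)"
  shows "rectangulation (grid_square n) D" "generic D"
    "guillotine (grid_square n) D \<longleftrightarrow> interval_sep (position \<pi>) 1 n"
proof -
  let ?x = "\<lambda>j. real j" and ?y = "\<lambda>j. real n - real j + 1"
  have val: "valid_choice n \<pi> ?x ?y n" by (rule weak_valid_choice[OF assms(1,2)]) simp
  interpret tiling n "position \<pi>" "xline n ?x" "yline n ?y" by (rule tiling_drawing(1)[OF assms(1,2) val])
  have D: "D = cell ` {1..n}" unfolding D_def by (rule tiling_drawing(2)[OF assms(1,2) val])
  \<comment> \<open>With grid sizes the abscissa of each line is its index, and so are the reflected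
    ordinates.\<close>
  have X: "disjoint_lines n (position \<pi>) (xline n ?x) (yline n ?y)"
    by (rule injective_disjoint_lines) (auto simp: inj_on_def xline_def split: if_splits)
  have "reflect n (yline n ?y) v = real v" if "v \<in> {0..n}" for v
    using that n by (auto simp: reflect_def yline_def)
  then have "inj_on (reflect n (yline n ?y)) {0..n}" by (auto simp: inj_on_def)
  then have Y: "disjoint_lines n (reflect n (position \<pi>)) (reflect n (yline n ?y)) (reflect n (xline n ?x))"
    by (rule tiling.injective_disjoint_lines[OF reflect_tiling])
  show "rectangulation (grid_square n) D" "generic D"
    "guillotine (grid_square n) D \<longleftrightarrow> interval_sep (position \<pi>) 1 n"
    unfolding D using rectangulation tiling_generic[OF X Y] guillotine_tiles_iff[OF X Y] by blast+
qed

lemma strong_drawing: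
  assumes "1 \<le> n" "\<pi> permutes {1..n}" and tj: "T_joint_choice n \<pi> x y"
  defines "D \<equiv> drawing n \<pi> x y"
  shows "rectangulation (grid_square n) D" "generic D"
    "guillotine (grid_square n) D \<longleftrightarrow> interval_sep (position \<pi>) 1 n"
proof -
  have val: "valid_choice n \<pi> x y n" using tj joints_valid joints_upto_n by blast
  interpret tiling n "position \<pi>" "xline n x" "yline n y" by (rule tiling_drawing(1)[OF assms(1,2) val])
  have D: "D = cell ` {1..n}" unfolding D_def by (rule tiling_drawing(2)[OF assms(1,2) val])
  note J = tile_joints[OF assms(1,2) val tj, unfolded cell_simps]
  have X: "disjoint_lines n (position \<pi>) (xline n x) (yline n y)"
    by (rule joints_disjoint_lines) (rule J(1))
  have Y: "disjoint_lines n (reflect n (position \<pi>)) (reflect n (yline n y)) (reflect n (xline n x))"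
    by (rule joints_disjoint_lines_reflect) (rule J(2))
  show "rectangulation (grid_square n) D" "generic D"
    "guillotine (grid_square n) D \<longleftrightarrow> interval_sep (position \<pi>) 1 n"
    unfolding D using rectangulation tiling_generic[OF X Y] guillotine_tiles_iff[OF X Y] by blast+
qed

section \<open>Unfolding the mesh patterns\<close>

lemma list_of_five: "length xs = 5 \<Longrightarrow> \<exists>a b c d e. xs = [a, b, c, d, e]"
  by (auto simp: numeral_eq_Suc length_Suc_conv)

lemma sorted_list_five:
  fixes S :: "nat set"
  assumes "card S = 5"
  obtains s1 s2 s3 s4 s5 where "sorted_list_of_set S = [s1, s2, s3, s4, s5]"
    "s1 < s2" "s2 < s3" "s3 < s4" "s4 < s5" "S = {s1, s2, s3, s4, s5}"
proof -
  have fin: "finite S" using assms card.infinite by fastforce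
  have "length (sorted_list_of_set S) = 5" using assms by simp
  then obtain s1 s2 s3 s4 s5 where xs: "sorted_list_of_set S = [s1, s2, s3, s4, s5]"
    using list_of_five by blast
  have "sorted_wrt (<) (sorted_list_of_set S)" by (rule strict_sorted_list_of_set)
  then have "s1 < s2" "s2 < s3" "s3 < s4" "s4 < s5" unfolding xs by auto
  moreover have "S = {s1, s2, s3, s4, s5}" using set_sorted_list_of_set[OF fin] unfolding xs by simp
  ultimately show ?thesis using that xs by blast
qed

lemma sorted_list_of_five:
  fixes s1 s2 s3 s4 s5 :: nat
  assumes "s1 < s2" "s2 < s3" "s3 < s4" "s4 < s5"
  shows "sorted_list_of_set {s1, s2, s3, s4, s5} = [s1, s2, s3, s4, s5]"
  using sorted_list_of_set.idem_if_sorted_distinct[of "[s1, s2, s3, s4, s5]"] assms by auto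

lemma ball_five: "(\<forall>i\<in>{1..5::nat}. P i) \<longleftrightarrow> P 1 \<and> P 2 \<and> P 3 \<and> P 4 \<and> P 5"
proof -
  have "{1..5::nat} = {1, 2, 3, 4, 5}" by auto
  then show ?thesis by simp
qed

lemma mesh_swap:
  "(\<forall>(i, j)\<in>\<mu>. \<not> (\<exists>l\<in>A. Q i j l)) \<longleftrightarrow> (\<forall>l\<in>A. \<forall>(i, j)\<in>\<mu>. \<not> Q i j l)"
  by blast

lemma mesh_occurrence_five:
  assumes S: "sorted_list_of_set S = [s1, s2, s3, s4, s5]" "sorted_list_of_set (\<pi> ` S) = t"
    and len: "length \<tau> = 5"
  shows "mesh_occurrence n \<pi> (\<tau>, \<mu>) S \<longleftrightarrow> S \<subseteq> {1..n} \<and> card S = 5 \<and>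
    (\<forall>i\<in>{1..5}. \<forall>j\<in>{1..5}. \<pi> ([0, s1, s2, s3, s4, s5, n + 1] ! i) < \<pi> ([0, s1, s2, s3, s4, s5, n + 1] ! j)
      \<longleftrightarrow> \<tau> ! (i - 1) < \<tau> ! (j - 1)) \<and>
    (\<forall>l\<in>{1..n}. \<forall>(i, j)\<in>\<mu>. \<not> ([0, s1, s2, s3, s4, s5, n + 1] ! i < l \<and> l < [0, s1, s2, s3, s4, s5, n + 1] ! (i + 1) \<and>
       (0 # t @ [n + 1]) ! j < \<pi> l \<and> \<pi> l < (0 # t @ [n + 1]) ! (j + 1)))"
  unfolding mesh_occurrence_def Let_def fst_conv snd_conv S len append.simps mesh_swap conj_assoc ..

text \<open>\<open>A\<close> says that the value lies in the row in question. No entry of that row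
  sits at a dividing position, so emptiness of the one or two outermost cells amounts to a single
  bound on \<open>l\<close>.\<close>

lemma empty_cells:
  fixes l :: nat
  shows "(A \<Longrightarrow> l \<noteq> s1 \<and> l \<noteq> s2) \<Longrightarrow> 0 < l \<Longrightarrow> s1 < s2 \<Longrightarrow>
      (\<not> (0 < l \<and> l < s1 \<and> A) \<and> \<not> (s1 < l \<and> l < s2 \<and> A)) = (A \<longrightarrow> s2 < l)"
    and "(A \<Longrightarrow> l \<noteq> s1) \<Longrightarrow> 0 < l \<Longrightarrow> (\<not> (0 < l \<and> l < s1 \<and> A)) = (A \<longrightarrow> s1 < l)"
    and "(A \<Longrightarrow> l \<noteq> s1 \<and> l \<noteq> s2) \<Longrightarrow> l < n \<Longrightarrow> s1 < s2 \<Longrightarrow>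
      (\<not> (s1 < l \<and> l < s2 \<and> A) \<and> \<not> (s2 < l \<and> l < n \<and> A)) = (A \<longrightarrow> l < s1)"
    and "(A \<Longrightarrow> l \<noteq> s1) \<Longrightarrow> l < n \<Longrightarrow> (\<not> (s1 < l \<and> l < n \<and> A)) = (A \<longrightarrow> l < s1)"
  by (cases A; auto)+

text \<open>Row 3 is shaded in columns 0 and 1, row 4 in column 0, row 2 in columns 4 and 5, row 1
  in column 5. Each row gives one condition, with the bound on \<open>l\<close> at the inner edge of
  its shaded cells.\<close>

lemma mesh_occurrence_p1_iff:
  assumes sl: "sorted_list_of_set S = [s1, s2, s3, s4, s5]" and card: "card S = 5"
    and S: "S = {s1, s2, s3, s4, s5}" and s: "s1 < s2" "s2 < s3" "s3 < s4" "s4 < s5"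
  shows "mesh_occurrence n \<pi> p1 S \<longleftrightarrow>
    S \<subseteq> {1..n} \<and> \<pi> s4 < \<pi> s1 \<and> \<pi> s1 < \<pi> s3 \<and> \<pi> s3 < \<pi> s5 \<and> \<pi> s5 < \<pi> s2 \<and>
    (\<forall>l\<in>{1..n}. (\<pi> s3 < \<pi> l \<and> \<pi> l < \<pi> s5 \<longrightarrow> s2 < l) \<and> (\<pi> s5 < \<pi> l \<and> \<pi> l < \<pi> s2 \<longrightarrow> s1 < l) \<and>
      (\<pi> s1 < \<pi> l \<and> \<pi> l < \<pi> s3 \<longrightarrow> l < s4) \<and> (\<pi> s4 < \<pi> l \<and> \<pi> l < \<pi> s1 \<longrightarrow> l < s5))"
    (is "?M \<longleftrightarrow> ?R")
proof -
  let ?o = "\<pi> s4 < \<pi> s1 \<and> \<pi> s1 < \<pi> s3 \<and> \<pi> s3 < \<pi> s5 \<and> \<pi> s5 < \<pi> s2"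
  let ?s = "[0, s1, s2, s3, s4, s5, n + 1]"
  have iso: "(\<forall>i\<in>{1..5}. \<forall>j\<in>{1..5}. \<pi> (?s ! i) < \<pi> (?s ! j)
      \<longleftrightarrow> [2::nat, 5, 3, 1, 4] ! (i - 1) < [2, 5, 3, 1, 4] ! (j - 1)) \<longleftrightarrow> ?o"
    unfolding ball_five by simp linarith
  have len: "length [2::nat, 5, 3, 1, 4] = 5" by simp
  show ?thesis
  \<comment> \<open>The sorted list of values is known only if the entries are ordered as in the
    pattern; otherwise both sides fail.\<close>
  proof (cases ?o)
    case False
    then show ?thesis unfolding p1_def mesh_occurrence_five[OF sl refl len] iso by blast
  next
    case o: True
    have "\<pi> ` S = {\<pi> s4, \<pi> s1, \<pi> s3, \<pi> s5, \<pi> s2}" unfolding S by auto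
    then have tl: "sorted_list_of_set (\<pi> ` S) = [\<pi> s4, \<pi> s1, \<pi> s3, \<pi> s5, \<pi> s2]"
      using sorted_list_of_five[of "\<pi> s4" "\<pi> s1" "\<pi> s3" "\<pi> s5" "\<pi> s2"] o by simp
    have cells: "(\<forall>(i, j)\<in>{(0,3), (0,4), (1,3), (4,2), (5,1), (5,2)}.
        \<not> (?s ! i < l \<and> l < ?s ! (i + 1) \<and>
          (0 # [\<pi> s4, \<pi> s1, \<pi> s3, \<pi> s5, \<pi> s2] @ [n + 1]) ! j < \<pi> l \<and>
          \<pi> l < (0 # [\<pi> s4, \<pi> s1, \<pi> s3, \<pi> s5, \<pi> s2] @ [n + 1]) ! (j + 1)))
        \<longleftrightarrow> (\<pi> s3 < \<pi> l \<and> \<pi> l < \<pi> s5 \<longrightarrow> s2 < l) \<and> (\<pi> s5 < \<pi> l \<and> \<pi> l < \<pi> s2 \<longrightarrow> s1 < l) \<and>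
      (\<pi> s1 < \<pi> l \<and> \<pi> l < \<pi> s3 \<longrightarrow> l < s4) \<and> (\<pi> s4 < \<pi> l \<and> \<pi> l < \<pi> s1 \<longrightarrow> l < s5)" (is "?L \<longleftrightarrow> _")
      if l: "l \<in> {1..n}" for l
    proof -
      let ?A = "\<pi> s3 < \<pi> l \<and> \<pi> l < \<pi> s5" and ?B = "\<pi> s5 < \<pi> l \<and> \<pi> l < \<pi> s2" and ?C = "\<pi> s1 < \<pi> l \<and> \<pi> l < \<pi> s3" and ?D = "\<pi> s4 < \<pi> l \<and> \<pi> l < \<pi> s1"
      have l': "0 < l" "l < n + 1" using l by auto
      have "?L = ((\<not> (0 < l \<and> l < s1 \<and> ?A)) \<and> (\<not> (0 < l \<and> l < s1 \<and> ?B)) \<and> (\<not> (s1 < l \<and> l < s2 \<and> ?A)) \<and> (\<not> (s4 < l \<and> l < s5 \<and> ?C)) \<and> (\<not> (s5 < l \<and> l < n + 1 \<and> ?D)) \<and> (\<not> (s5 < l \<and> l < n + 1 \<and> ?C)))"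
        using l' by simp
      also have "\<dots> = ((\<not> (0 < l \<and> l < s1 \<and> ?A) \<and> \<not> (s1 < l \<and> l < s2 \<and> ?A)) \<and> \<not> (0 < l \<and> l < s1 \<and> ?B) \<and>
          (\<not> (s4 < l \<and> l < s5 \<and> ?C) \<and> \<not> (s5 < l \<and> l < n + 1 \<and> ?C)) \<and> \<not> (s5 < l \<and> l < n + 1 \<and> ?D))"
        by (rule iffI; elim conjE; intro conjI; assumption)
      also have "(\<not> (0 < l \<and> l < s1 \<and> ?A) \<and> \<not> (s1 < l \<and> l < s2 \<and> ?A)) = (?A \<longrightarrow> s2 < l)"
        by (rule empty_cells(1)) (use l' s o in auto)
      also have "(\<not> (0 < l \<and> l < s1 \<and> ?B)) = (?B \<longrightarrow> s1 < l)"
        by (rule empty_cells(2)) (use l' s o in auto)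
      also have "(\<not> (s4 < l \<and> l < s5 \<and> ?C) \<and> \<not> (s5 < l \<and> l < n + 1 \<and> ?C)) = (?C \<longrightarrow> l < s4)"
        by (rule empty_cells(3)) (use l' s o in auto)
      also have "(\<not> (s5 < l \<and> l < n + 1 \<and> ?D)) = (?D \<longrightarrow> l < s5)"
        by (rule empty_cells(4)) (use l' s o in auto)
      finally show ?thesis by (rule trans) (rule iffI; elim conjE; intro conjI; assumption)
    qed
    show ?thesis
      unfolding p1_def mesh_occurrence_five[OF sl tl len] iso
      by (simp only: card o conj_assoc simp_thms cells cong: ball_cong)
  qed
qed

text \<open>\<open>p2\<close> is \<open>p1\<close> with the positions reversed, cell
  \<open>(i, j)\<close> going to \<open>(5 - i, j)\<close>, so the bounds on \<open>l\<close> change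
  direction.\<close>

lemma mesh_occurrence_p2_iff:
  assumes sl: "sorted_list_of_set S = [s1, s2, s3, s4, s5]" and card: "card S = 5"
    and S: "S = {s1, s2, s3, s4, s5}" and s: "s1 < s2" "s2 < s3" "s3 < s4" "s4 < s5"
  shows "mesh_occurrence n \<pi> p2 S \<longleftrightarrow>
    S \<subseteq> {1..n} \<and> \<pi> s2 < \<pi> s5 \<and> \<pi> s5 < \<pi> s3 \<and> \<pi> s3 < \<pi> s1 \<and> \<pi> s1 < \<pi> s4 \<and>
    (\<forall>l\<in>{1..n}. (\<pi> s3 < \<pi> l \<and> \<pi> l < \<pi> s1 \<longrightarrow> l < s4) \<and> (\<pi> s1 < \<pi> l \<and> \<pi> l < \<pi> s4 \<longrightarrow> l < s5) \<and>
      (\<pi> s5 < \<pi> l \<and> \<pi> l < \<pi> s3 \<longrightarrow> s2 < l) \<and> (\<pi> s2 < \<pi> l \<and> \<pi> l < \<pi> s5 \<longrightarrow> s1 < l))"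
    (is "?M \<longleftrightarrow> ?R")
proof -
  let ?o = "\<pi> s2 < \<pi> s5 \<and> \<pi> s5 < \<pi> s3 \<and> \<pi> s3 < \<pi> s1 \<and> \<pi> s1 < \<pi> s4"
  let ?s = "[0, s1, s2, s3, s4, s5, n + 1]"
  have iso: "(\<forall>i\<in>{1..5}. \<forall>j\<in>{1..5}. \<pi> (?s ! i) < \<pi> (?s ! j)
      \<longleftrightarrow> [4::nat, 1, 3, 5, 2] ! (i - 1) < [4, 1, 3, 5, 2] ! (j - 1)) \<longleftrightarrow> ?o"
    unfolding ball_five by simp linarith
  have len: "length [4::nat, 1, 3, 5, 2] = 5" by simp
  show ?thesis
  proof (cases ?o)
    case False
    then show ?thesis unfolding p2_def mesh_occurrence_five[OF sl refl len] iso by blast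
  next
    case o: True
    have "\<pi> ` S = {\<pi> s2, \<pi> s5, \<pi> s3, \<pi> s1, \<pi> s4}" unfolding S by auto
    then have tl: "sorted_list_of_set (\<pi> ` S) = [\<pi> s2, \<pi> s5, \<pi> s3, \<pi> s1, \<pi> s4]"
      using sorted_list_of_five[of "\<pi> s2" "\<pi> s5" "\<pi> s3" "\<pi> s1" "\<pi> s4"] o by simp
    have cells: "(\<forall>(i, j)\<in>{(0,1), (0,2), (1,2), (4,3), (5,3), (5,4)}.
        \<not> (?s ! i < l \<and> l < ?s ! (i + 1) \<and>
          (0 # [\<pi> s2, \<pi> s5, \<pi> s3, \<pi> s1, \<pi> s4] @ [n + 1]) ! j < \<pi> l \<and>
          \<pi> l < (0 # [\<pi> s2, \<pi> s5, \<pi> s3, \<pi> s1, \<pi> s4] @ [n + 1]) ! (j + 1)))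
        \<longleftrightarrow> (\<pi> s3 < \<pi> l \<and> \<pi> l < \<pi> s1 \<longrightarrow> l < s4) \<and> (\<pi> s1 < \<pi> l \<and> \<pi> l < \<pi> s4 \<longrightarrow> l < s5) \<and>
      (\<pi> s5 < \<pi> l \<and> \<pi> l < \<pi> s3 \<longrightarrow> s2 < l) \<and> (\<pi> s2 < \<pi> l \<and> \<pi> l < \<pi> s5 \<longrightarrow> s1 < l)" (is "?L \<longleftrightarrow> _")
      if l: "l \<in> {1..n}" for l
    proof -
      let ?A = "\<pi> s5 < \<pi> l \<and> \<pi> l < \<pi> s3" and ?B = "\<pi> s2 < \<pi> l \<and> \<pi> l < \<pi> s5" and ?C = "\<pi> s3 < \<pi> l \<and> \<pi> l < \<pi> s1" and ?D = "\<pi> s1 < \<pi> l \<and> \<pi> l < \<pi> s4"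
      have l': "0 < l" "l < n + 1" using l by auto
      have "?L = ((\<not> (0 < l \<and> l < s1 \<and> ?B)) \<and> (\<not> (0 < l \<and> l < s1 \<and> ?A)) \<and> (\<not> (s1 < l \<and> l < s2 \<and> ?A)) \<and> (\<not> (s4 < l \<and> l < s5 \<and> ?C)) \<and> (\<not> (s5 < l \<and> l < n + 1 \<and> ?C)) \<and> (\<not> (s5 < l \<and> l < n + 1 \<and> ?D)))"
        using l' by simp
      also have "\<dots> = ((\<not> (0 < l \<and> l < s1 \<and> ?A) \<and> \<not> (s1 < l \<and> l < s2 \<and> ?A)) \<and> \<not> (0 < l \<and> l < s1 \<and> ?B) \<and>
          (\<not> (s4 < l \<and> l < s5 \<and> ?C) \<and> \<not> (s5 < l \<and> l < n + 1 \<and> ?C)) \<and> \<not> (s5 < l \<and> l < n + 1 \<and> ?D))"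
        by (rule iffI; elim conjE; intro conjI; assumption)
      also have "(\<not> (0 < l \<and> l < s1 \<and> ?A) \<and> \<not> (s1 < l \<and> l < s2 \<and> ?A)) = (?A \<longrightarrow> s2 < l)"
        by (rule empty_cells(1)) (use l' s o in auto)
      also have "(\<not> (0 < l \<and> l < s1 \<and> ?B)) = (?B \<longrightarrow> s1 < l)"
        by (rule empty_cells(2)) (use l' s o in auto)
      also have "(\<not> (s4 < l \<and> l < s5 \<and> ?C) \<and> \<not> (s5 < l \<and> l < n + 1 \<and> ?C)) = (?C \<longrightarrow> l < s4)"
        by (rule empty_cells(3)) (use l' s o in auto)
      also have "(\<not> (s5 < l \<and> l < n + 1 \<and> ?D)) = (?D \<longrightarrow> l < s5)"
        by (rule empty_cells(4)) (use l' s o in auto)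
      finally show ?thesis by (rule trans) (rule iffI; elim conjE; intro conjI; assumption)
    qed
    show ?thesis
      unfolding p2_def mesh_occurrence_five[OF sl tl len] iso
      by (simp only: card o conj_assoc simp_thms cells cong: ball_cong)
  qed
qed

section \<open>Windmills as pattern occurrences\<close>

lemma inv_permutes:
  assumes "\<pi> permutes {1..n}"
  shows "\<And>v. v \<in> {1..n} \<Longrightarrow> inv \<pi> v \<in> {1..n}" "\<And>v. \<pi> (inv \<pi> v) = v" "\<And>l. inv \<pi> (\<pi> l) = l"
    "\<And>l. l \<in> {1..n} \<Longrightarrow> \<pi> l \<in> {1..n}"
  using permutes_in_image[OF permutes_inv[OF assms]] permutes_inverses[OF assms] permutes_in_image[OF assms]
  by blast+

text \<open>An occurrence lists positions and a windmill lists values; \<open>inv \<pi>\<close>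
  translates. Ordered by value, the entries of 25314 stand at \<open>s4\<close>, \<open>s1\<close>,
  \<open>s3\<close>, \<open>s5\<close>, \<open>s2\<close>, and their values are \<open>v1\<close> to
  \<open>v5\<close>.\<close>

lemma windmill_iff_p1:
  assumes "\<pi> permutes {1..n}"
  shows "has_windmill (position \<pi>) 1 n \<longleftrightarrow> \<not> avoids n \<pi> p1"
proof -
  note I = inv_permutes[OF assms]
  have "has_windmill (position \<pi>) 1 n \<longleftrightarrow> (\<exists>S. mesh_occurrence n \<pi> p1 S)"
  proof
    assume "has_windmill (position \<pi>) 1 n"
    then obtain v1 v2 v3 v4 v5 where v: "1 \<le> v1" "v5 \<le> n" and w: "windmill (position \<pi>) v1 v2 v3 v4 v5"
      unfolding has_windmill_def by blast
    note W = w[unfolded windmill_def position_def of_nat_less_iff]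
    have m: "v1 \<in> {1..n}" "v2 \<in> {1..n}" "v3 \<in> {1..n}" "v4 \<in> {1..n}" "v5 \<in> {1..n}" using v W by auto
    let ?S = "{inv \<pi> v2, inv \<pi> v5, inv \<pi> v3, inv \<pi> v1, inv \<pi> v4}"
    have o: "inv \<pi> v2 < inv \<pi> v5" "inv \<pi> v5 < inv \<pi> v3" "inv \<pi> v3 < inv \<pi> v1" "inv \<pi> v1 < inv \<pi> v4"
      using W by blast+
    have "card ?S = 5" using o by simp
    have R: "v3 < v \<and> v < v4 \<longrightarrow> inv \<pi> v5 < inv \<pi> v" "v4 < v \<and> v < v5 \<longrightarrow> inv \<pi> v2 < inv \<pi> v"
      "v2 < v \<and> v < v3 \<longrightarrow> inv \<pi> v < inv \<pi> v1" "v1 < v \<and> v < v2 \<longrightarrow> inv \<pi> v < inv \<pi> v4" for v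
      using W by auto
    have "mesh_occurrence n \<pi> p1 ?S"
      unfolding mesh_occurrence_p1_iff[OF sorted_list_of_five[OF o] \<open>card ?S = 5\<close> refl o] I(2)
    proof (intro conjI ballI)
      show "?S \<subseteq> {1..n}" using I(1) m by blast
    qed (use W in blast, use W in blast, use W in blast, use W in blast,
        (use R[of "\<pi> _", unfolded I(3)] in blast)+)
    then show "\<exists>S. mesh_occurrence n \<pi> p1 S" by blast
  next
    assume "\<exists>S. mesh_occurrence n \<pi> p1 S"
    then obtain S where S: "mesh_occurrence n \<pi> p1 S" by blast
    then have card: "card S = 5" by (simp add: mesh_occurrence_def p1_def Let_def)
    obtain s1 s2 s3 s4 s5 where s: "sorted_list_of_set S = [s1, s2, s3, s4, s5]"
      "s1 < s2" "s2 < s3" "s3 < s4" "s4 < s5" "S = {s1, s2, s3, s4, s5}" using sorted_list_five[OF card] .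
    note M = S[unfolded mesh_occurrence_p1_iff[OF s(1) card s(6) s(2-5)]]
    have m: "\<pi> s1 \<in> {1..n}" "\<pi> s2 \<in> {1..n}" "\<pi> s3 \<in> {1..n}" "\<pi> s4 \<in> {1..n}" "\<pi> s5 \<in> {1..n}"
      using M I(4) s(6) by blast+
    have R: "(\<pi> s3 < v \<and> v < \<pi> s5 \<longrightarrow> s2 < inv \<pi> v) \<and> (\<pi> s5 < v \<and> v < \<pi> s2 \<longrightarrow> s1 < inv \<pi> v) \<and>
      (\<pi> s1 < v \<and> v < \<pi> s3 \<longrightarrow> inv \<pi> v < s4) \<and> (\<pi> s4 < v \<and> v < \<pi> s1 \<longrightarrow> inv \<pi> v < s5)" if "v \<in> {1..n}" for v
      using bspec[OF M[THEN conjunct2, THEN conjunct2, THEN conjunct2, THEN conjunct2, THEN conjunct2] I(1)[OF that]]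
      unfolding I(2) .
    have "windmill (position \<pi>) (\<pi> s4) (\<pi> s1) (\<pi> s3) (\<pi> s5) (\<pi> s2)"
      unfolding windmill_def position_def of_nat_less_iff I(3)
      using M s(2-5) R m by auto
    moreover have "1 \<le> \<pi> s4" "\<pi> s2 \<le> n" using m by auto
    ultimately show "has_windmill (position \<pi>) 1 n" unfolding has_windmill_def by blast
  qed
  then show ?thesis by (simp add: avoids_def)
qed

text \<open>The sign reverses the order of the positions. Ordered by value, the entries of 41352
  stand at \<open>s2\<close>, \<open>s5\<close>, \<open>s3\<close>, \<open>s1\<close>,
  \<open>s4\<close>.\<close>

lemma windmill_iff_p2:
  assumes "\<pi> permutes {1..n}"
  shows "has_windmill (\<lambda>v. - position \<pi> v) 1 n \<longleftrightarrow> \<not> avoids n \<pi> p2"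
proof -
  note I = inv_permutes[OF assms]
  have "has_windmill (\<lambda>v. - position \<pi> v) 1 n \<longleftrightarrow> (\<exists>S. mesh_occurrence n \<pi> p2 S)"
  proof
    assume "has_windmill (\<lambda>v. - position \<pi> v) 1 n"
    then obtain v1 v2 v3 v4 v5 where v: "1 \<le> v1" "v5 \<le> n" and w: "windmill (\<lambda>v. - position \<pi> v) v1 v2 v3 v4 v5"
      unfolding has_windmill_def by blast
    note W = w[unfolded windmill_def position_def neg_less_iff_less of_nat_less_iff]
    have m: "v1 \<in> {1..n}" "v2 \<in> {1..n}" "v3 \<in> {1..n}" "v4 \<in> {1..n}" "v5 \<in> {1..n}" using v W by auto
    let ?S = "{inv \<pi> v4, inv \<pi> v1, inv \<pi> v3, inv \<pi> v5, inv \<pi> v2}"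
    have o: "inv \<pi> v4 < inv \<pi> v1" "inv \<pi> v1 < inv \<pi> v3" "inv \<pi> v3 < inv \<pi> v5" "inv \<pi> v5 < inv \<pi> v2"
      using W by blast+
    have "card ?S = 5" using o by simp
    have R: "v3 < v \<and> v < v4 \<longrightarrow> inv \<pi> v < inv \<pi> v5" "v4 < v \<and> v < v5 \<longrightarrow> inv \<pi> v < inv \<pi> v2"
      "v2 < v \<and> v < v3 \<longrightarrow> inv \<pi> v1 < inv \<pi> v" "v1 < v \<and> v < v2 \<longrightarrow> inv \<pi> v4 < inv \<pi> v" for v
      using W by auto
    have "mesh_occurrence n \<pi> p2 ?S"
      unfolding mesh_occurrence_p2_iff[OF sorted_list_of_five[OF o] \<open>card ?S = 5\<close> refl o] I(2)
    proof (intro conjI ballI)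
      show "?S \<subseteq> {1..n}" using I(1) m by blast
    qed (use W in blast, use W in blast, use W in blast, use W in blast,
        (use R[of "\<pi> _", unfolded I(3)] in blast)+)
    then show "\<exists>S. mesh_occurrence n \<pi> p2 S" by blast
  next
    assume "\<exists>S. mesh_occurrence n \<pi> p2 S"
    then obtain S where S: "mesh_occurrence n \<pi> p2 S" by blast
    then have card: "card S = 5" by (simp add: mesh_occurrence_def p2_def Let_def)
    obtain s1 s2 s3 s4 s5 where s: "sorted_list_of_set S = [s1, s2, s3, s4, s5]"
      "s1 < s2" "s2 < s3" "s3 < s4" "s4 < s5" "S = {s1, s2, s3, s4, s5}" using sorted_list_five[OF card] .
    note M = S[unfolded mesh_occurrence_p2_iff[OF s(1) card s(6) s(2-5)]]
    have m: "\<pi> s1 \<in> {1..n}" "\<pi> s2 \<in> {1..n}" "\<pi> s3 \<in> {1..n}" "\<pi> s4 \<in> {1..n}" "\<pi> s5 \<in> {1..n}"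
      using M I(4) s(6) by blast+
    have R: "(\<pi> s3 < v \<and> v < \<pi> s1 \<longrightarrow> inv \<pi> v < s4) \<and> (\<pi> s1 < v \<and> v < \<pi> s4 \<longrightarrow> inv \<pi> v < s5) \<and>
      (\<pi> s5 < v \<and> v < \<pi> s3 \<longrightarrow> s2 < inv \<pi> v) \<and> (\<pi> s2 < v \<and> v < \<pi> s5 \<longrightarrow> s1 < inv \<pi> v)" if "v \<in> {1..n}" for v
      using bspec[OF M[THEN conjunct2, THEN conjunct2, THEN conjunct2, THEN conjunct2, THEN conjunct2] I(1)[OF that]]
      unfolding I(2) .
    have "windmill (\<lambda>v. - position \<pi> v) (\<pi> s2) (\<pi> s5) (\<pi> s3) (\<pi> s1) (\<pi> s4)"
      unfolding windmill_def position_def neg_less_iff_less of_nat_less_iff I(3)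
      using M s(2-5) R m by auto
    moreover have "1 \<le> \<pi> s2" "\<pi> s4 \<le> n" using m by auto
    ultimately show "has_windmill (\<lambda>v. - position \<pi> v) 1 n" unfolding has_windmill_def by blast
  qed
  then show ?thesis by (simp add: avoids_def)
qed

theorem theorem5p1:
  fixes n :: nat and \<pi> :: "nat \<Rightarrow> nat"
  assumes "n \<ge> 1" and "\<pi> permutes {1..n}"
  shows "(guillotine_class (gamma_w n \<pi>) \<longleftrightarrow> guillotine_class (gamma_s n \<pi>)) \<and>
         (guillotine_class (gamma_s n \<pi>) \<longleftrightarrow> avoids n \<pi> p1 \<and> avoids n \<pi> p2)"
proof -
  let ?sep = "interval_sep (position \<pi>) 1 n"
  have avoid: "?sep \<longleftrightarrow> avoids n \<pi> p1 \<and> avoids n \<pi> p2"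
    using interval_sep_iff[OF assms(1) position_inj[OF assms(2)]] windmill_iff_p1[OF assms(2)]
      windmill_iff_p2[OF assms(2)] by blast
  note W = weak_drawing[OF assms]
  \<comment> \<open>Every member of the class agrees with the grid drawing, so it remains only to
    see that the class is nonempty.\<close>
  have "guillotine R' D' \<longleftrightarrow> ?sep" if "(R', D') \<in> gamma_w n \<pi>" for R' D'
    using that weak_iso_guillotine_iff[OF W(1)] W(3) by (auto simp: gamma_w_def weak_class_def)
  moreover have "(grid_square n, drawing n \<pi> (\<lambda>j. real j) (\<lambda>j. real n - real j + 1)) \<in> gamma_w n \<pi>"
    using W(1,2) weak_iso_id by (auto simp: gamma_w_def weak_class_def)
  ultimately have w: "guillotine_class (gamma_w n \<pi>) \<longleftrightarrow> ?sep"
    unfolding guillotine_class_def by fastforce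
  have "guillotine R' D' \<longleftrightarrow> ?sep" if RD: "(R', D') \<in> gamma_s n \<pi>" for R' D'
  proof -
    obtain x y f where tj: "T_joint_choice n \<pi> x y" and R': "rectangulation R' D'"
      and f: "weak_iso (grid_square n) (drawing n \<pi> x y) R' D' f"
      using RD by (auto simp: gamma_s_def strong_class_def strong_iso_def)
    note S = strong_drawing[OF assms tj]
    show ?thesis using weak_iso_guillotine_iff[OF S(1) R' f] S(3) by simp
  qed
  \<comment> \<open>Without admissible sizes the union would be empty and
    \<open>guillotine_class\<close> false.\<close>
  moreover have "\<exists>RD. RD \<in> gamma_s n \<pi>"
  proof -
    obtain x y where tj: "T_joint_choice n \<pi> x y"
      using ex_joints[OF assms, of n] joints_upto_n by blast
    have "(grid_square n, drawing n \<pi> x y) \<in> strong_class (grid_square n) (drawing n \<pi> x y)"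
      unfolding strong_class_def using strong_drawing(1,2)[OF assms tj] strong_iso_id by blast
    then have "(grid_square n, drawing n \<pi> x y) \<in> gamma_s n \<pi>"
      unfolding gamma_s_def using tj by blast
    then show ?thesis by blast
  qed
  ultimately have s: "guillotine_class (gamma_s n \<pi>) \<longleftrightarrow> ?sep"
    unfolding guillotine_class_def by fastforce
  show ?thesis using w s avoid by blast
qed

end
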